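(* Let $R$ be of type $A_2$ and $\mathsf P=[-\imath\pi a,\imath\pi a]$. For $-\ell-0.5<\Re k<-\ell$, $\ell\in\mathbb Z_{\ge0}$, and any Laurent polynomial $f\in\mathbb C[X^{\pm1},Y^{\pm1}]$: $$\begin{aligned}\mathrm{ct}(f\mu)=\ &Int_0(f)+\frac1{2\pi\imath a}\Bigl(\sum_{m=0}^\ell\int_{\mathsf P}\bigl(f(t^{-1}q^{-m},q^y)+f(q^y,t^{-1}q^{-m})\bigr)\zeta^1_m(q^y)\,dy\\&+\sum_{m=0}^\ell\int_{\mathsf P}f(t^{-1}q^{-y-m},q^y)\zeta^2_m(q^y)\,dy+\sum_{m=1}^\ell\int_{\mathsf P}f(tq^{-y+m},q^y)\zeta^1_{m-1}(q^y)\,dy\\&+\sum_{m=1}^\ell\int_{\mathsf P}\bigl(f(tq^m,q^y)+f(q^y,tq^m)\bigr)\zeta^2_{m-1}(q^y)\,dy\Bigr)\\&+\varrho\Bigl(\sum_{m,n=1}^\ell\varpi_1(m,n)f(tq^m,tq^n)+\sum_{m=1}^{2\ell}\sum_{n=m+1}^{2\ell+1}\varpi_1(m,n-m)f(tq^m,t^{-2}q^{-n+1})\\&+\sum_{m=1}^{2\ell}\sum_{n=m}^{2\ell}\varpi_2(m,n)f(t^{-1}q^{m-n},t^2q^n)+\sum_{m=0}^\ell\sum_{n=m+1}^{2\ell}\varpi_2(n-m,n)f(t^2q^n,t^{-1}q^{-m})\\&+\sum_{m=1}^{\ell+1}\sum_{n=m}^{m+\ell}\varpi_2(m,n)f(t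^{-1}q^{m-n},t^{-1}q^{-m+1})+\sum_{m=1}^\ell\sum_{n=m+1}^{2\ell+1}\varpi_1(n-m,m)f(t^{-2}q^{-n+1},tq^m)\Bigr).\end{aligned}$$
   Context: $q=e^{-1/a}$, $a>0$, $t=q^k$. For $A_2$ with simple roots $\alpha_1,\alpha_2$ write $x=x_{\alpha_1}$, $y=x_{\alpha_2}$, $X=q^x$, $Y=q^y$; functions are written $f(X,Y)=f(q^x,q^y)$. Sums with lower limit greater than the upper limit are empty. The mu-function is $$\mu(X,Y)=\prod_{Z\in\{X,Y,XY\}}\prod_{i=0}^\infty\frac{(1-Zq^i)(1-Z^{-1}q^{i+1})}{(1-tZq^i)(1-tZ^{-1}q^{i+1})}.$$ $Int_0(f)=\frac1{(2\pi\imath a)^2}\int_{-\imath\pi a}^{\imath\pi a}\int_{-\imath\pi a}^{\imath\pi a}f(q^x,q^y)\mu(q^x,q^y)\,dx\,dy$. $\mathrm{ct}(f\mu)$ is the constant term of $f\mu$ ($\mu$ being expanded in terms of $t$ and of $X_{\tilde\alpha}$ for positive affine roots $\tilde\alpha$); it is a meromorphic function of $k$, equal to $Int_0(f)$ for $\Re k>0$, so that for $\Re k\le0$ it is the meromorphic continuation of the latter. Notation: $$\varrho_0=\prod_{i=0}^\infty\frac{(1-t^{-1}q^i)(1-tq^{i+1})}{(1-q^{i+1})(1-t^2q^{i+1})},\qquad \varrho=\prod_{i=0}^\infty\frac{(1-t^{-1}q^i)(1-tq^{i+1})^2(1-t^{-2}q^i)}{(1-q^{i+1})^2(1-t^2q^{i+1})(1-t^3q^{i+1})},$$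 $$\zeta^1_m(q^z)=\varrho_0t^{-2m}\prod_{j=1}^m\frac{(1-t^2q^j)(1-t^2q^{j-z})}{(1-q^j)(1-q^{j-z})}\prod_{j=0}^\infty\frac{(1-q^{-z+j+1})(1-t^{-1}q^{z+j})}{(1-tq^{z+j})(1-t^2q^{-z+j+1})},$$ $$\zeta^2_m(q^z)=\varrho_0t^{-2m-1}\prod_{j=1}^m\frac{(1-t^2q^j)(1-t^2q^{j+z})}{(1-q^j)(1-q^{j+z})}\prod_{j=1}^\infty\frac{(1-q^{z+j})(1-t^{-1}q^{-z+j})}{(1-tq^{-z+j})(1-t^2q^{z+j})},$$ $$\varpi_1(m,n)=t^{3-2(m+n)}\prod_{j=1}^{m-1}\frac{1-t^2q^j}{1-q^j}\prod_{j=1}^{n-1}\frac{1-t^2q^j}{1-q^j}\prod_{j=1}^{m+n-1}\frac{1-t^3q^j}{1-tq^j}\quad(m,n>0),$$ $$\varpi_2(m,n)=t^{2-2n}\prod_{j=1}^{m-1}\frac{(1-t^2q^j)(1-q^{n-j})}{(1-q^j)(1-t^2q^{n-j})}\prod_{j=1}^{n-1}\frac{(1-t^2q^j)(1-t^3q^j)}{(1-q^j)(1-tq^j)}\quad(m>0,\ n\ge m).$$ *)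

theory Defs
  imports "HOL-Complex_Analysis.Complex_Analysis" "HOL-Library.Poly_Mapping"
begin

text \<open>
  The parameter \<open>q = e\<^sup>-\<^sup>1\<^sup>/\<^sup>a\<close> is a positive real, so \<open>qpar a powr x = exp (- x / a)\<close> for every
  complex \<open>x\<close>. Most definitions below take \<open>q\<close> and \<open>t = q\<^sup>k\<close> as separate arguments.
\<close>

definition qpar :: "real \<Rightarrow> complex" where
  "qpar a = complex_of_real (exp (- 1 / a))"

text \<open>
  A Laurent polynomial in \<open>X\<close>, \<open>Y\<close> is the finitely supported function sending \<open>(i, j)\<close> to the
  coefficient of \<open>X\<^sup>i Y\<^sup>j\<close>.
\<close>

type_synonym laurent2 = "(int \<times> int) \<Rightarrow>\<^sub>0 complex"

definition leval :: "laurent2 \<Rightarrow> complex \<Rightarrow> complex \<Rightarrow> complex" where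
  "leval f X Y = (\<Sum>(i, j)\<in>Poly_Mapping.keys f. Poly_Mapping.lookup f (i, j) * X powi i * Y powi j)"

definition mu_factor :: "complex \<Rightarrow> complex \<Rightarrow> complex \<Rightarrow> complex" where
  "mu_factor q t Z =
     prodinf (\<lambda>i. ((1 - Z * q ^ i) * (1 - inverse Z * q ^ (i + 1))) /
           ((1 - t * Z * q ^ i) * (1 - t * inverse Z * q ^ (i + 1))))"

definition mu :: "complex \<Rightarrow> complex \<Rightarrow> complex \<Rightarrow> complex \<Rightarrow> complex" where
  "mu q t X Y = mu_factor q t X * mu_factor q t Y * mu_factor q t (X * Y)"

definition Ppath :: "real \<Rightarrow> real \<Rightarrow> complex" where
  "Ppath a = linepath (- (\<i> * of_real (pi * a))) (\<i> * of_real (pi * a))"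

definition Int0 :: "real \<Rightarrow> complex \<Rightarrow> laurent2 \<Rightarrow> complex" where
  "Int0 a k f =
     1 / (2 * of_real pi * \<i> * of_real a)\<^sup>2 *
     contour_integral (Ppath a) (\<lambda>y. contour_integral (Ppath a) (\<lambda>x.
       leval f (qpar a powr x) (qpar a powr y) *
       mu (qpar a) (qpar a powr k) (qpar a powr x) (qpar a powr y)))"

text \<open>
  The constant term. The pair \<open>((b, c), j)\<close> stands for the affine root \<open>[b \<alpha>\<^sub>1 + c \<alpha>\<^sub>2, j]\<close>, with
  \<open>X\<close>-monomial \<open>q\<^sup>j X\<^sup>b Y\<^sup>c\<close>. Then \<open>\<mu>\<close> is the product of \<open>(1 - W) / (1 - t W)\<close> over the monomials
  \<open>W\<close> of the positive affine roots, and \<open>(1 - W) / (1 - t W) = 1 + (\<Sum>n\<ge>1. (t\<^sup>n - t\<^sup>n\<^sup>-\<^sup>1) W\<^sup>n)\<close>.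
  Multiplying out, a term of the expansion of \<open>\<mu>\<close> is given by a finitely supported family \<open>e\<close> of
  exponents; for \<open>\<bar>t\<bar> < 1\<close> the resulting series is absolutely convergent.
\<close>

definition pos_affine_roots :: "((int \<times> int) \<times> nat) set" where
  "pos_affine_roots =
     {(1, 0), (0, 1), (1, 1)} \<times> UNIV \<union> {(-1, 0), (0, -1), (-1, -1)} \<times> {1..}"

definition factor_coeff :: "complex \<Rightarrow> nat \<Rightarrow> complex" where
  "factor_coeff t n = (if n = 0 then 1 else t ^ n - t ^ (n - 1))"

text \<open>The coefficient of \<open>X\<^sup>i Y\<^sup>j\<close> in the expansion of \<open>\<mu>\<close>.\<close>

definition mu_coeff :: "complex \<Rightarrow> complex \<Rightarrow> int \<Rightarrow> int \<Rightarrow> complex" where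
  "mu_coeff q t i j =
     infsum (\<lambda>e. \<Prod>r\<in>Poly_Mapping.keys e.
               factor_coeff t (Poly_Mapping.lookup e r) * (q ^ snd r) ^ Poly_Mapping.lookup e r)
       {e :: ((int \<times> int) \<times> nat) \<Rightarrow>\<^sub>0 nat. Poly_Mapping.keys e \<subseteq> pos_affine_roots \<and>
          (\<Sum>r\<in>Poly_Mapping.keys e. int (Poly_Mapping.lookup e r) * fst (fst r)) = i \<and>
          (\<Sum>r\<in>Poly_Mapping.keys e. int (Poly_Mapping.lookup e r) * snd (fst r)) = j}"

definition ct_series :: "complex \<Rightarrow> complex \<Rightarrow> laurent2 \<Rightarrow> complex" where
  "ct_series q t f =
     (\<Sum>(i, j)\<in>Poly_Mapping.keys f. Poly_Mapping.lookup f (i, j) * mu_coeff q t (- i) (- j))"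

text \<open>
  \<open>ct(f\<mu>)\<close> as a meromorphic function of \<open>k\<close>: the meromorphic function on the whole plane given by
  the expansion above for \<open>Re k > 0\<close>. Being nicely meromorphic (removable singularities removed,
  value \<open>0\<close> at poles) makes its values at all points unique.
\<close>

definition ct :: "real \<Rightarrow> laurent2 \<Rightarrow> complex \<Rightarrow> complex" where
  "ct a f = (THE g. g nicely_meromorphic_on UNIV \<and>
                    (\<forall>k. Re k > 0 \<longrightarrow> g k = ct_series (qpar a) (qpar a powr k) f))"

definition rho0 :: "complex \<Rightarrow> complex \<Rightarrow> complex" where
  "rho0 q t =
     prodinf (\<lambda>i. ((1 - inverse t * q ^ i) * (1 - t * q ^ (i + 1))) /
           ((1 - q ^ (i + 1)) * (1 - t\<^sup>2 * q ^ (i + 1))))"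

definition rho :: "complex \<Rightarrow> complex \<Rightarrow> complex" where
  "rho q t =
     prodinf (\<lambda>i. ((1 - inverse t * q ^ i) * (1 - t * q ^ (i + 1))\<^sup>2 * (1 - t powi (-2) * q ^ i)) /
           ((1 - q ^ (i + 1))\<^sup>2 * (1 - t\<^sup>2 * q ^ (i + 1)) * (1 - t ^ 3 * q ^ (i + 1))))"

text \<open>
  In \<open>zeta1\<close> and \<open>zeta2\<close> the argument \<open>Z\<close> is \<open>q\<^sup>z\<close>, so \<open>q\<^sup>j\<^sup>-\<^sup>z\<close> is \<open>q ^ j / Z\<close>. The infinite
  product in \<open>\<zeta>\<^sup>2\<close> starts at \<open>1\<close>, hence the shifted index.
\<close>

definition zeta1 :: "complex \<Rightarrow> complex \<Rightarrow> nat \<Rightarrow> complex \<Rightarrow> complex" where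
  "zeta1 q t m Z =
     rho0 q t * t powi (- 2 * int m) *
     (\<Prod>j=1..m. ((1 - t\<^sup>2 * q ^ j) * (1 - t\<^sup>2 * (q ^ j / Z))) / ((1 - q ^ j) * (1 - q ^ j / Z))) *
     prodinf (\<lambda>j. ((1 - q ^ (j + 1) / Z) * (1 - inverse t * (Z * q ^ j))) /
           ((1 - t * (Z * q ^ j)) * (1 - t\<^sup>2 * (q ^ (j + 1) / Z))))"

definition zeta2 :: "complex \<Rightarrow> complex \<Rightarrow> nat \<Rightarrow> complex \<Rightarrow> complex" where
  "zeta2 q t m Z =
     rho0 q t * t powi (- 2 * int m - 1) *
     (\<Prod>j=1..m. ((1 - t\<^sup>2 * q ^ j) * (1 - t\<^sup>2 * (Z * q ^ j))) / ((1 - q ^ j) * (1 - Z * q ^ j))) *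
     prodinf (\<lambda>j. ((1 - Z * q ^ (j + 1)) * (1 - inverse t * (q ^ (j + 1) / Z))) /
           ((1 - t * (q ^ (j + 1) / Z)) * (1 - t\<^sup>2 * (Z * q ^ (j + 1)))))"

definition varpi1 :: "complex \<Rightarrow> complex \<Rightarrow> nat \<Rightarrow> nat \<Rightarrow> complex" where
  "varpi1 q t m n =
     t powi (3 - 2 * (int m + int n)) *
     (\<Prod>j=1..m-1. (1 - t\<^sup>2 * q ^ j) / (1 - q ^ j)) *
     (\<Prod>j=1..n-1. (1 - t\<^sup>2 * q ^ j) / (1 - q ^ j)) *
     (\<Prod>j=1..m+n-1. (1 - t ^ 3 * q ^ j) / (1 - t * q ^ j))"

definition varpi2 :: "complex \<Rightarrow> complex \<Rightarrow> nat \<Rightarrow> nat \<Rightarrow> complex" where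
  "varpi2 q t m n =
     t powi (2 - 2 * int n) *
     (\<Prod>j=1..m-1. ((1 - t\<^sup>2 * q ^ j) * (1 - q ^ (n - j))) /
                    ((1 - q ^ j) * (1 - t\<^sup>2 * q ^ (n - j)))) *
     (\<Prod>j=1..n-1. ((1 - t\<^sup>2 * q ^ j) * (1 - t ^ 3 * q ^ j)) /
                    ((1 - q ^ j) * (1 - t * q ^ j)))"

end

theory Submission
  imports Defs
begin

text \<open>
  For small \<open>t\<close> the constant term of \<open>X\<^sup>-\<^sup>i Y\<^sup>-\<^sup>j \<mu>\<close> is \<open>\<Sum>n. c(i - n) c(j - n) c(n)\<close>, where
  Ramanujan's bilateral sum gives the Fourier coefficients \<open>c(n)\<close> of one factor of \<open>\<mu>\<close> in closed
  form. A regularised value of this sum continues it meromorphically in \<open>t\<close>. In the strip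
  \<open>c = d + e\<close>, where \<open>d\<close> are the Fourier coefficients on the unit circle of the same factor for
  the actual \<open>t\<close>, and \<open>e\<close> is a finite sum of exponentials coming from the poles that have crossed
  the circle. On multiplying out, \<open>d d d\<close> gives the double integral, the mixed terms give the
  single integrals and the residues, and \<open>e e e\<close> contributes nothing because exponentials have
  regularised sum \<open>0\<close>.
\<close>

section \<open>Regularised bilateral sums\<close>

text \<open>In the strip |t| > 1, so c(n) grows like t^n and the series for the constant term need
  no longer converge. Moving contours in two variables would give iterated residues at moving poles;
  here a residue is an exponential split off from a sequence, and the residue calculus becomes the
  expansion of a triple product.

  The roots that regularise this product can be chosen holomorphic in t. Dividing by all factors 1 -
  r therefore gives a meromorphic function of k, with poles at most where t^3 q^(j+1) = 1 or, from
  the normalisation of c, t^2 q^(j+1) = 1. The second kind does not occur in the strip; the first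
  kind gives the exceptional points of the theorem.

  The width 1/2 of the strip comes from the single integrals: their integrands have poles at t^2 q^i
  and 1/(t^2 q^i), which reach the unit circle when 2 Re k is an integer. These integrands pose a
  further problem: they are products in which a pole at Z = 1 of one factor is cancelled by a zero
  of the other, so the series of the factors cannot be multiplied on the unit circle itself, and the
  integrals arise as limits from smaller circles.\<close>

text \<open>
  A polynomial \<open>\<Prod>(E - r)\<close> in the shift \<open>E\<close>, given by its list of roots, annihilates exponentials
  \<open>r\<^sup>n\<close>. A bilateral sequence whose image under such a polynomial is summable gets a
  regularised sum by dividing by \<open>\<Prod>(1 - r)\<close>; the bilateral sum of every exponential is then \<open>0\<close>.
\<close>

primrec shift_poly :: "complex list \<Rightarrow> (int \<Rightarrow> complex) \<Rightarrow> int \<Rightarrow> complex" where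
  "shift_poly [] u = u"
| "shift_poly (r # rs) u = shift_poly rs (\<lambda>n. u (n + 1) - r * u n)"

definition regsum :: "(int \<Rightarrow> complex) \<Rightarrow> complex \<Rightarrow> bool" where
  "regsum u S \<longleftrightarrow> (\<exists>rs. 0 \<notin> set rs \<and> 1 \<notin> set rs \<and>
     (shift_poly rs u has_sum (\<Prod>r\<leftarrow>rs. 1 - r) * S) UNIV)"

lemma shift_poly_append: "shift_poly (rs @ ss) u = shift_poly ss (shift_poly rs u)"
  by (induction rs arbitrary: u) auto

lemma shift_poly_add: "shift_poly rs (\<lambda>n. u n + v n) = (\<lambda>n. shift_poly rs u n + shift_poly rs v n)"
proof (induction rs arbitrary: u v)
  case (Cons r rs)
  have "(\<lambda>n. u (n + 1) + v (n + 1) - r * (u n + v n)) =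
        (\<lambda>n. (u (n + 1) - r * u n) + (v (n + 1) - r * v n))"
    by (auto simp: algebra_simps)
  then show ?case using Cons by simp
qed simp

lemma shift_poly_cmult: "shift_poly rs (\<lambda>n. c * u n) = (\<lambda>n. c * shift_poly rs u n)"
proof (induction rs arbitrary: u)
  case (Cons r rs)
  have "(\<lambda>n. c * u (n + 1) - r * (c * u n)) = (\<lambda>n. c * (u (n + 1) - r * u n))"
    by (auto simp: algebra_simps)
  then show ?case using Cons by simp
qed simp

lemma shift_poly_shift: "shift_poly rs (\<lambda>n. u (n + m)) = (\<lambda>n. shift_poly rs u (n + m))"
proof (induction rs arbitrary: u)
  case (Cons r rs)
  show ?case using Cons[of "\<lambda>n. u (n + 1) - r * u n"] by (simp add: add_ac)
qed simp

lemma shift_poly_step: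
  "shift_poly rs (\<lambda>n. u (n + 1) - r * u n) = (\<lambda>n. shift_poly rs u (n + 1) - r * shift_poly rs u n)"
  using shift_poly_add[of rs "\<lambda>n. u (n + 1)" "\<lambda>n. - r * u n"] shift_poly_shift[of rs u 1]
    shift_poly_cmult[of rs "-r" u] by simp

lemma shift_poly_commute: "shift_poly rs (shift_poly ss u) = shift_poly ss (shift_poly rs u)"
  by (induction rs arbitrary: u) (auto simp flip: shift_poly_step)

text \<open>Reflection of the index turns \<open>E - r\<close> into \<open>E - 1/r\<close>, up to
  the scalar \<open>- inverse r\<close> and a displacement by one place. Every root contributes one
  such place, whence \<open>length rs\<close>.\<close>

lemma shift_poly_uminus_index:
  assumes "0 \<notin> set rs"
  shows "shift_poly (map inverse rs) (\<lambda>n. u (- n)) =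
         (\<lambda>n. (\<Prod>r\<leftarrow>rs. - inverse r) * shift_poly rs u (- n - int (length rs)))"
  using assms
proof (induction rs arbitrary: u)
  case (Cons r rs)
  have "(\<lambda>n. u (- (n + 1)) - inverse r * u (- n)) =
        (\<lambda>n. - inverse r * (\<lambda>k. u (k + 1 + - 1) - r * u (k + - 1)) (- n))"
    using Cons.prems by (auto simp: field_simps)
  then have "shift_poly (map inverse (r # rs)) (\<lambda>n. u (- n)) =
      shift_poly (map inverse rs) (\<lambda>n. - inverse r * (\<lambda>k. u (k + 1 + - 1) - r * u (k + - 1)) (- n))"
    by simp
  also have "\<dots> = (\<lambda>n. - inverse r * ((\<Prod>r\<leftarrow>rs. - inverse r) *
      shift_poly rs (\<lambda>k. u (k + 1 + - 1) - r * u (k + - 1)) (- n - int (length rs))))"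
    unfolding shift_poly_cmult by (subst Cons.IH) (use Cons.prems in auto)
  also have "shift_poly rs (\<lambda>k. u (k + 1 + - 1) - r * u (k + - 1)) =
      (\<lambda>k. shift_poly rs (\<lambda>k. u (k + 1) - r * u k) (k + - 1))"
    using shift_poly_shift[of rs "\<lambda>k. u (k + 1) - r * u k" "-1"] by (simp add: add_ac)
  finally show ?case by (simp add: algebra_simps)
qed simp

lemma has_sum_shift_int: "((\<lambda>n::int. u (n + m)) has_sum S) UNIV \<longleftrightarrow> (u has_sum (S::complex)) UNIV"
  by (rule has_sum_reindex_bij_witness[of _ "\<lambda>n. n - m" "\<lambda>n. n + m"]) auto

lemma has_sum_uminus_int: "((\<lambda>n::int. u (- n)) has_sum S) UNIV \<longleftrightarrow> (u has_sum (S::complex)) UNIV"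
  by (rule has_sum_reindex_bij_witness[of _ uminus uminus]) auto

lemma has_sum_shift_poly:
  assumes "(u has_sum S) UNIV"
  shows "(shift_poly rs u has_sum (\<Prod>r\<leftarrow>rs. 1 - r) * S) UNIV"
  using assms
proof (induction rs arbitrary: u S)
  case (Cons r rs)
  have "((\<lambda>n. u (n + 1) + (- r) * u n) has_sum (S + (- r) * S)) UNIV"
    by (intro has_sum_add has_sum_cmult_right Cons.prems iffD2[OF has_sum_shift_int])
  from Cons.IH[OF this[simplified]] show ?case
    by (simp add: algebra_simps)
qed simp

text \<open>Shift polynomials commute, so applying to either certified sequence the polynomial of
  the other leads to the same convergent series. The scalars can be cancelled because no root is
  1.\<close>

lemma regsum_unique:
  assumes "regsum u S" "regsum u T"
  shows "S = T"
proof -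
  obtain rs where rs: "1 \<notin> set rs" "(shift_poly rs u has_sum (\<Prod>r\<leftarrow>rs. 1 - r) * S) UNIV"
    using assms(1) by (auto simp: regsum_def)
  obtain ss where ss: "1 \<notin> set ss" "(shift_poly ss u has_sum (\<Prod>r\<leftarrow>ss. 1 - r) * T) UNIV"
    using assms(2) by (auto simp: regsum_def)
  have nz: "(\<Prod>r\<leftarrow>ts. 1 - r) \<noteq> 0" if "1 \<notin> set ts" for ts :: "complex list"
    using that by (induction ts) auto
  have "(\<Prod>r\<leftarrow>ss. 1 - r) * ((\<Prod>r\<leftarrow>rs. 1 - r) * S) = (\<Prod>r\<leftarrow>rs. 1 - r) * ((\<Prod>r\<leftarrow>ss. 1 - r) * T)"
    using has_sum_unique[OF has_sum_shift_poly[OF rs(2), of ss]]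
      has_sum_shift_poly[OF ss(2), of rs] by (simp add: shift_poly_commute)
  then show ?thesis using nz[OF rs(1)] nz[OF ss(1)] by simp
qed

lemma regsum_has_sum: "(u has_sum S) UNIV \<Longrightarrow> regsum u S"
  unfolding regsum_def by (rule exI[of _ "[]"]) auto

lemma regsum_add:
  assumes "regsum u S" "regsum v T"
  shows "regsum (\<lambda>n. u n + v n) (S + T)"
proof -
  obtain rs where rs: "0 \<notin> set rs" "1 \<notin> set rs" "(shift_poly rs u has_sum (\<Prod>r\<leftarrow>rs. 1 - r) * S) UNIV"
    using assms(1) by (auto simp: regsum_def)
  obtain ss where ss: "0 \<notin> set ss" "1 \<notin> set ss" "(shift_poly ss v has_sum (\<Prod>r\<leftarrow>ss. 1 - r) * T) UNIV"
    using assms(2) by (auto simp: regsum_def)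
  have "(shift_poly (rs @ ss) u has_sum (\<Prod>r\<leftarrow>ss. 1 - r) * ((\<Prod>r\<leftarrow>rs. 1 - r) * S)) UNIV"
    using has_sum_shift_poly[OF rs(3), of ss] by (simp add: shift_poly_append)
  moreover have "(shift_poly (rs @ ss) v has_sum (\<Prod>r\<leftarrow>rs. 1 - r) * ((\<Prod>r\<leftarrow>ss. 1 - r) * T)) UNIV"
    using has_sum_shift_poly[OF ss(3), of rs] by (simp add: shift_poly_append shift_poly_commute)
  ultimately have "((\<lambda>n. shift_poly (rs @ ss) u n + shift_poly (rs @ ss) v n) has_sum
      ((\<Prod>r\<leftarrow>ss. 1 - r) * ((\<Prod>r\<leftarrow>rs. 1 - r) * S) +
       (\<Prod>r\<leftarrow>rs. 1 - r) * ((\<Prod>r\<leftarrow>ss. 1 - r) * T))) UNIV"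
    by (rule has_sum_add)
  then have "(shift_poly (rs @ ss) (\<lambda>n. u n + v n) has_sum
      (\<Prod>r\<leftarrow>rs @ ss. 1 - r) * (S + T)) UNIV"
    unfolding shift_poly_add by (simp add: algebra_simps)
  then show ?thesis unfolding regsum_def using rs ss by (intro exI[of _ "rs @ ss"]) auto
qed

lemma regsum_cmult: "regsum u S \<Longrightarrow> regsum (\<lambda>n. c * u n) (c * S)"
  unfolding regsum_def shift_poly_cmult
  by (metis has_sum_cmult_right mult.left_commute)

lemma regsum_diff: "regsum u S \<Longrightarrow> regsum v T \<Longrightarrow> regsum (\<lambda>n. u n - v n) (S - T)"
  using regsum_add[of u S "\<lambda>n. - 1 * v n" "- 1 * T"] regsum_cmult[of v T "-1"] by simp

lemma regsum_0: "regsum (\<lambda>_. 0) 0"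
  by (rule regsum_has_sum) simp

lemma regsum_sum:
  "(\<And>i. i \<in> I \<Longrightarrow> regsum (u i) (S i)) \<Longrightarrow> regsum (\<lambda>n. \<Sum>i\<in>I. u i n) (\<Sum>i\<in>I. S i)"
  by (induction I rule: infinite_finite_induct) (auto intro: regsum_0 regsum_add)

lemma regsum_shift:
  assumes "regsum u S"
  shows "regsum (\<lambda>n. u (n + m)) S"
  using assms unfolding regsum_def shift_poly_shift has_sum_shift_int .

lemma regsum_uminus_index:
  assumes "regsum u S"
  shows "regsum (\<lambda>n. u (- n)) S"
proof -
  obtain rs where rs: "0 \<notin> set rs" "1 \<notin> set rs" "(shift_poly rs u has_sum (\<Prod>r\<leftarrow>rs. 1 - r) * S) UNIV"
    using assms by (auto simp: regsum_def)
  \<comment> \<open>Root by root this is (- 1/r) (1 - r) = 1 - 1/r: the scalars produced by the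
    reflection are just those that the reflected roots require.\<close>
  have eq: "(\<Prod>r\<leftarrow>rs. - inverse r) * (\<Prod>r\<leftarrow>rs. 1 - r) = (\<Prod>r\<leftarrow>map inverse rs. 1 - r)"
    using rs(1) by (induction rs) (auto simp: field_simps)
  have "((\<lambda>n. shift_poly rs u (- n - int (length rs))) has_sum (\<Prod>r\<leftarrow>rs. 1 - r) * S) UNIV"
    using rs(3) has_sum_uminus_int[of "\<lambda>n. shift_poly rs u (n + - int (length rs))"]
      has_sum_shift_int[of "shift_poly rs u" "- int (length rs)"] by simp
  then have "(shift_poly (map inverse rs) (\<lambda>n. u (- n)) has_sum (\<Prod>r\<leftarrow>map inverse rs. 1 - r) * S) UNIV"
    unfolding shift_poly_uminus_index[OF rs(1)] eq[symmetric] mult.assoc by (rule has_sum_cmult_right)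
  then show ?thesis unfolding regsum_def using rs
    by (intro exI[of _ "map inverse rs"]) (auto simp: inverse_eq_1_iff)
qed

lemma regsum_reflect:
  assumes "regsum u S"
  shows "regsum (\<lambda>n. u (m - n)) S"
  using regsum_uminus_index[OF regsum_shift[OF assms, of m]] by (simp add: algebra_simps)

text \<open>Puts one more root in front of a certificate. A recurrence in the parameter t only
  controls \<open>(E - r) u\<close>; this carries the information back to \<open>u\<close>.\<close>

lemma regsum_step:
  assumes "regsum (\<lambda>n. u (n + 1) - r * u n) ((1 - r) * S)" "r \<noteq> 0" "r \<noteq> 1"
  shows "regsum u S"
proof -
  obtain rs where rs: "0 \<notin> set rs" "1 \<notin> set rs"
    "(shift_poly rs (\<lambda>n. u (n + 1) - r * u n) has_sum (\<Prod>r\<leftarrow>rs. 1 - r) * ((1 - r) * S)) UNIV"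
    using assms(1) by (auto simp: regsum_def)
  then show ?thesis unfolding regsum_def using assms
    by (intro exI[of _ "r # rs"]) (auto simp: algebra_simps)
qed

lemma regsum_exponential:
  assumes "r \<noteq> 0" "r \<noteq> 1"
  shows "regsum (\<lambda>n. r powi n) 0"
proof (rule regsum_step[of _ r])
  have "(\<lambda>n. r powi (n + 1) - r * r powi n) = (\<lambda>_. 0)"
    using assms by (auto simp: power_int_add_1')
  then show "regsum (\<lambda>n. r powi (n + 1) - r * r powi n) ((1 - r) * 0)"
    using regsum_0 by simp
qed (use assms in auto)


section \<open>Infinite \<open>q\<close>-products\<close>

locale qbase =
  fixes q :: complex
  assumes q_nonzero [simp]: "q \<noteq> 0" and norm_q: "norm q < 1"
begin

text \<open>The infinite q-Pochhammer symbol (z; q).\<close>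

definition ph :: "complex \<Rightarrow> complex" where
  "ph z = prodinf (\<lambda>i. 1 - z * q ^ i)"

text \<open>With the four products kept apart, zeros and poles can be read off: for generic
  \<open>t\<close> the zeros are the integral powers of \<open>q\<close>, the poles are 1/(t q^i)
  and t q^(i+1) for i >= 0.\<close>

definition dl :: "complex \<Rightarrow> complex \<Rightarrow> complex" where
  "dl t Z = ph Z * ph (q / Z) / (ph (t * Z) * ph (t * q / Z))"

lemma q_neq_1 [simp]: "q \<noteq> 1" and norm_q_pos: "norm q > 0"
  using norm_q by auto

lemma q_powi_eq_1_iff: "q powi n = 1 \<longleftrightarrow> n = 0"
proof
  assume "q powi n = 1"
  then have "norm q powi n = 1" by (metis norm_one norm_power_int)
  then show "n = 0" using norm_q norm_q_pos
    by (metis less_irrefl linorder_neqE power_int_0_right power_int_strict_decreasing)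
qed auto

lemma q_power_eq_1_iff: "q ^ n = 1 \<longleftrightarrow> n = 0"
  using q_powi_eq_1_iff[of "int n"] by simp

lemma q_power_Suc_neq_1 [simp]: "q ^ Suc n \<noteq> 1" "q * q ^ n \<noteq> 1"
  using q_power_eq_1_iff[of "Suc n"] by auto

lemma convergent_ph: "convergent_prod (\<lambda>i. 1 - z * q ^ i)"
proof -
  have "summable (\<lambda>i. norm (1 - z * q ^ i - 1))"
    using norm_q by (auto simp: norm_mult norm_power intro!: summable_mult)
  then show ?thesis
    by (intro abs_convergent_prod_imp_convergent_prod summable_imp_abs_convergent_prod)
qed

lemma ph_0 [simp]: "ph 0 = 1"
  by (simp add: ph_def)

lemma ph_split: "ph z = (\<Prod>i<n. 1 - z * q ^ i) * ph (z * q ^ n)"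
proof -
  have "(\<lambda>i. 1 - z * q ^ i) has_prod ((\<Prod>i<n. 1 - z * q ^ i) * prodinf (\<lambda>i. 1 - z * q ^ (i + n)))"
    by (rule has_prod_ignore_initial_segment'[OF convergent_ph])
  then show ?thesis by (simp add: has_prod_iff ph_def power_add mult_ac)
qed

lemma ph_rec: "ph z = (1 - z) * ph (z * q)"
  using ph_split[of z 1] by simp

lemma ph_eq_0_iff: "ph z = 0 \<longleftrightarrow> (\<exists>i. z * q ^ i = 1)"
proof
  assume *: "ph z = 0"
  have "(\<lambda>i. 1 - z * q ^ i) has_prod 0"
    using convergent_prod_has_prod[OF convergent_ph[of z]] * by (simp add: ph_def)
  then show "\<exists>i. z * q ^ i = 1"
    unfolding has_prod_def by (auto dest: raw_has_prod_eq_0 simp: raw_has_prod_def)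
next
  assume "\<exists>i. z * q ^ i = 1"
  then obtain i where "z * q ^ i = 1" by auto
  then show "ph z = 0" using ph_split[of z "Suc i"] by simp
qed

lemma ph_nonzero: "norm z < 1 \<Longrightarrow> ph z \<noteq> 0"
proof
  assume z: "norm z < 1" and "ph z = 0"
  then obtain i where "z * q ^ i = 1" by (auto simp: ph_eq_0_iff)
  then have "norm z * norm q ^ i = 1" by (metis norm_mult norm_one norm_power)
  moreover have "norm z * norm q ^ i \<le> norm z * 1"
    by (intro mult_left_mono power_le_one) (use norm_q in auto)
  ultimately show False using z by simp
qed

lemma ph_q_nonzero [simp]: "ph q \<noteq> 0"
  using ph_nonzero norm_q by auto

lemma ph_holomorphic: "ph holomorphic_on A"
proof -
  have "ph holomorphic_on UNIV"
  proof (rule holomorphic_uniform_sequence)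
    show "(\<lambda>z. \<Prod>i<n. 1 - z * q ^ i) holomorphic_on UNIV" for n
      by (intro holomorphic_intros)
    fix x :: complex
    have "uniform_limit (cball x 1) (\<lambda>n z. \<Prod>i<n. 1 - z * q ^ i) ph sequentially"
    proof -
      have "uniformly_convergent_on (cball x 1) (\<lambda>n z. \<Sum>i<n. norm (- z * q ^ i))"
      proof (rule Weierstrass_m_test'[of _ _ "\<lambda>i. (norm x + 1) * norm q ^ i"])
        fix n and y assume "y \<in> cball x 1"
        then have "norm y \<le> norm x + 1"
          using norm_triangle_ineq3[of y x] by (auto simp: dist_norm norm_minus_commute)
        then show "norm (norm (- y * q ^ n)) \<le> (norm x + 1) * norm q ^ n"
          by (auto simp: norm_mult norm_power intro!: mult_right_mono)
      qed (use norm_q in \<open>auto intro!: summable_mult\<close>)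
      then have "uniformly_convergent_on (cball x 1) (\<lambda>n z. \<Prod>i<n. 1 + (- z * q ^ i))"
        by (intro uniformly_convergent_on_prod) (auto intro!: continuous_intros)
      then obtain g where g: "uniform_limit (cball x 1) (\<lambda>n z. \<Prod>i<n. 1 - z * q ^ i) g sequentially"
        by (auto simp: uniformly_convergent_on_def)
      have "g z = ph z" if "z \<in> cball x 1" for z
      proof -
        have "(\<lambda>n. \<Prod>i<n. 1 - z * q ^ i) \<longlonglongrightarrow> g z"
          using g that by (rule tendsto_uniform_limitI)
        moreover have "(\<lambda>n. \<Prod>i<n. 1 - z * q ^ i) \<longlonglongrightarrow> ph z"
          unfolding ph_def using convergent_prod_LIMSEQ[OF convergent_ph[of z]]
          by (simp add: LIMSEQ_lessThan_iff_atMost)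
        ultimately show ?thesis by (rule LIMSEQ_unique)
      qed
      then show ?thesis using g by (metis (no_types, lifting) uniform_limit_cong')
    qed
    then show "\<exists>d>0. cball x d \<subseteq> UNIV \<and>
        uniform_limit (cball x d) (\<lambda>n z. \<Prod>i<n. 1 - z * q ^ i) ph sequentially"
      by (intro exI[of _ 1]) auto
  qed auto
  then show ?thesis by (rule holomorphic_on_subset) auto
qed

lemma ph_holomorphic' [holomorphic_intros]:
  "f holomorphic_on A \<Longrightarrow> (\<lambda>z. ph (f z)) holomorphic_on A"
  using holomorphic_on_compose[OF _ ph_holomorphic, of f A] by (simp add: o_def)

lemma ph_continuous' [continuous_intros]:
  "continuous_on A f \<Longrightarrow> continuous_on A (\<lambda>z. ph (f z))"
  using continuous_on_compose[OF _ holomorphic_on_imp_continuous_on[OF ph_holomorphic], of A f]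
  by (simp add: o_def)

lemma mu_factor_eq: "mu_factor q t Z = dl t Z"
proof -
  have "mu_factor q t Z = prodinf (\<lambda>i. ((1 - Z * q ^ i) * (1 - q / Z * q ^ i)) /
      ((1 - t * Z * q ^ i) * (1 - t * q / Z * q ^ i)))"
    by (simp add: mu_factor_def divide_inverse mult_ac)
  also have "\<dots> = dl t Z"
    unfolding dl_def ph_def
    by (simp only: prodinf_divide prodinf_mult convergent_prod_mult convergent_ph)
  finally show ?thesis .
qed

lemma dl_reflect: "Z \<noteq> 0 \<Longrightarrow> dl t (q / Z) = dl t Z"
  by (simp add: dl_def mult_ac)

text \<open>Quasi-periodicity: replacing Z by q Z moves one linear factor in each of the four
  products. This relation drives the later inductions for \<open>zeta1\<close>, \<open>zeta2\<close>
  and for the values of \<open>dl\<close> at t^2 q^(M+1).\<close>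

lemma dl_q_shift:
  assumes "Z \<noteq> 0" "Z \<noteq> 1" "t * Z \<noteq> 1" "Z \<noteq> t"
  shows "dl t (q * Z) * (Z - t) = dl t Z * (t * Z - 1)"
proof -
  have "ph Z = (1 - Z) * ph (q * Z)" "ph (t * Z) = (1 - t * Z) * ph (t * (q * Z))"
    "ph (1 / Z) = (1 - 1 / Z) * ph (q / Z)" "ph (t / Z) = (1 - t / Z) * ph (t * q / Z)"
    using ph_rec[of Z] ph_rec[of "t * Z"] ph_rec[of "1 / Z"] ph_rec[of "t / Z"]
    by (simp_all add: mult_ac)
  then have *: "dl t Z = (1 - Z) * ph (q * Z) * ph (q / Z) /
       ((1 - t * Z) * ph (t * (q * Z)) * ph (t * q / Z))"
    "dl t (q * Z) = ph (q * Z) * ((1 - 1 / Z) * ph (q / Z)) /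
       (ph (t * (q * Z)) * ((1 - t / Z) * ph (t * q / Z)))"
    by (simp_all add: dl_def)
  have "(1 - 1 / Z) * (Z - t) * (1 - t * Z) = (1 - t / Z) * ((1 - Z) * (t * Z - 1))"
    using assms by (simp add: field_simps)
  moreover have "1 - t / Z \<noteq> 0" "1 - t * Z \<noteq> 0" using assms by auto
  ultimately have "(1 - 1 / Z) * (Z - t) / (1 - t / Z) = (1 - Z) * (t * Z - 1) / (1 - t * Z)"
    by (simp add: frac_eq_eq mult_ac)
  then have "ph (q * Z) * ph (q / Z) / (ph (t * (q * Z)) * ph (t * q / Z)) *
      ((1 - 1 / Z) * (Z - t) / (1 - t / Z)) =
    ph (q * Z) * ph (q / Z) / (ph (t * (q * Z)) * ph (t * q / Z)) *
      ((1 - Z) * (t * Z - 1) / (1 - t * Z))" by simp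
  then show ?thesis unfolding * by (simp add: mult_ac)
qed

lemma dl_t_shift:
  assumes "Z \<noteq> 0" "t * Z \<noteq> 1" "t * q \<noteq> Z"
  shows "dl (t * q) Z = dl t Z * ((1 - t * Z) * (1 - t * q / Z))"
proof -
  have "ph (t * Z) = (1 - t * Z) * ph (t * q * Z)" "ph (t * q / Z) = (1 - t * q / Z) * ph (t * q * q / Z)"
    using ph_rec[of "t * Z"] ph_rec[of "t * q / Z"] by (simp_all add: mult_ac)
  then show ?thesis using assms by (simp add: dl_def)
qed

text \<open>One of the two numerator products contains the factor 0. Because of this, two crossed
  exponentials that combine to a pure power of \<open>q\<close> leave no residue.\<close>

lemma dl_q_powi: "dl t (q powi m) = 0"
proof (cases "m \<ge> 1")
  case True
  then have "q / q powi m * q ^ nat (m - 1) = q powi (1 - m) * q powi (m - 1)"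
    using power_int_diff[of q 1 m] by (simp add: power_int_def[of q "m - 1"])
  also have "\<dots> = 1" by (simp flip: power_int_add)
  finally have "ph (q / q powi m) = 0" unfolding ph_eq_0_iff by blast
  then show ?thesis by (simp add: dl_def)
next
  case False
  then have "q powi m * q ^ nat (- m) = 1"
    by (simp add: power_int_def flip: power_mult_distrib)
  then have "ph (q powi m) = 0" unfolding ph_eq_0_iff by blast
  then show ?thesis by (simp add: dl_def)
qed

end


section \<open>Ramanujan's bilateral sum\<close>

lemma summable_on_int_geometric:
  fixes x :: real
  assumes "0 \<le> x" "x < 1"
  shows "(\<lambda>n::int. x ^ nat \<bar>n\<bar>) summable_on UNIV"
proof -
  have *: "(\<lambda>n::nat. x ^ n) summable_on UNIV"
    using assms by (subst summable_on_UNIV_nonneg_real_iff) (auto intro: summable_geometric)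
  have "(\<lambda>n::int. x ^ nat \<bar>n\<bar>) summable_on {0..} \<longleftrightarrow> (\<lambda>n::nat. x ^ n) summable_on UNIV"
    by (rule summable_on_reindex_bij_witness[of _ int nat]) auto
  then have "(\<lambda>n::int. x ^ nat \<bar>n\<bar>) summable_on {0..}" using * by blast
  moreover have "(\<lambda>n::int. x ^ nat \<bar>n\<bar>) summable_on {..0} \<longleftrightarrow> (\<lambda>n::nat. x ^ n) summable_on UNIV"
    by (rule summable_on_reindex_bij_witness[of _ "\<lambda>n. - int n" "\<lambda>n. nat (- n)"]) auto
  then have "(\<lambda>n::int. x ^ nat \<bar>n\<bar>) summable_on {..0}" using * by blast
  ultimately have "(\<lambda>n::int. x ^ nat \<bar>n\<bar>) summable_on ({0..} \<union> {..0})"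
    by (rule summable_on_union)
  moreover have "{0..} \<union> {..0::int} = UNIV" by auto
  ultimately show ?thesis by simp
qed

text \<open>Local domination makes the finite partial sums converge uniformly on small closed balls.
  The limit is taken along the filter of finite subsets, so the index set needs no
  enumeration.\<close>

lemma holomorphic_on_infsum:
  fixes f :: "'a \<Rightarrow> complex \<Rightarrow> complex"
  assumes "open U" and hol: "\<And>n. n \<in> I \<Longrightarrow> f n holomorphic_on U"
    and bound: "\<And>x. x \<in> U \<Longrightarrow> \<exists>d>0. cball x d \<subseteq> U \<and>
          (\<exists>B. B summable_on I \<and> (\<forall>n\<in>I. \<forall>y\<in>cball x d. norm (f n y) \<le> B n))"
  shows "(\<lambda>y. \<Sum>\<^sub>\<infinity>n\<in>I. f n y) holomorphic_on U"
proof -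
  have "(\<lambda>y. \<Sum>\<^sub>\<infinity>n\<in>I. f n y) field_differentiable (at x)" if x: "x \<in> U" for x
  proof -
    obtain d B where d: "d > 0" "cball x d \<subseteq> U" "B summable_on I"
      "\<forall>n\<in>I. \<forall>y\<in>cball x d. norm (f n y) \<le> B n" using bound[OF x] by blast
    have ul: "uniform_limit (cball x d) (\<lambda>X y. \<Sum>n\<in>X. f n y) (\<lambda>y. \<Sum>\<^sub>\<infinity>n\<in>I. f n y) (finite_subsets_at_top I)"
      using d by (intro Weierstrass_m_test_general[of _ _ _ B]) auto
    have ev: "\<forall>\<^sub>F X in finite_subsets_at_top I. continuous_on (cball x d) (\<lambda>y. \<Sum>n\<in>X. f n y) \<and>
        (\<lambda>y. \<Sum>n\<in>X. f n y) holomorphic_on ball x d"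
    proof (rule eventually_finite_subsets_at_top_weakI)
      fix X assume X: "finite X" "X \<subseteq> I"
      then have "(\<lambda>y. \<Sum>n\<in>X. f n y) holomorphic_on U"
        using hol by (intro holomorphic_intros) auto
      then have hol': "(\<lambda>y. \<Sum>n\<in>X. f n y) holomorphic_on cball x d"
        using d(2) by (rule holomorphic_on_subset)
      then show "continuous_on (cball x d) (\<lambda>y. \<Sum>n\<in>X. f n y) \<and>
          (\<lambda>y. \<Sum>n\<in>X. f n y) holomorphic_on ball x d"
        using holomorphic_on_imp_continuous_on[OF hol'] holomorphic_on_subset[OF hol' ball_subset_cball]
        by blast
    qed
    have "(\<lambda>y. \<Sum>\<^sub>\<infinity>n\<in>I. f n y) holomorphic_on ball x d"
      using holomorphic_uniform_limit[OF ev ul] by auto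
    then show ?thesis
      by (rule holomorphic_on_imp_differentiable_at) (use d(1) in auto)
  qed
  then show ?thesis
    by (auto simp: holomorphic_on_def intro: field_differentiable_at_within)
qed

section \<open>The Fourier coefficients of one factor of mu and their recurrence in t\<close>

context qbase
begin

text \<open>Ramanujan's coefficient for the upper parameter 1/t, the lower parameter t q and the
  argument t Z, multiplied by \<open>ph q * ph (t\<^sup>2 * q)\<close>. The factor t^n is absorbed
  into (1/t; q)_n, and (t q; q)_n is cancelled against an infinite product, so that the result is
  entire in t.\<close>

definition ch :: "complex \<Rightarrow> nat \<Rightarrow> complex" where
  "ch t n = ph (t * q) * ph (t * q ^ (n + 1)) * (\<Prod>i<n. t - q ^ i)"

text \<open>The values at negative indices are forced by the symmetry Z -> q / Z of
  \<open>dl\<close>.\<close>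

definition cf :: "complex \<Rightarrow> int \<Rightarrow> complex" where
  "cf t n = (if n \<ge> 0 then ch t (nat n) else q ^ nat (- n) * ch t (nat (- n)))"

definition cc :: "complex \<Rightarrow> int \<Rightarrow> complex" where
  "cc t n = cf t n / (ph q * ph (t\<^sup>2 * q))"

lemma cf_uminus: "cf t (- n) = q powi n * cf t n"
proof -
  have "inverse q ^ m * (q ^ m * z) = z" for m z
    by (simp add: power_inverse)
  then show ?thesis
    by (cases n "0 :: int" rule: linorder_cases) (auto simp: cf_def power_int_def)
qed

lemma cc_uminus: "cc t (- n) = q powi n * cc t n"
  by (simp add: cc_def cf_uminus)

text \<open>All four terms contain the product \<open>S * R * P\<close>. Once it is taken out, what
  remains is the polynomial identity \<open>key\<close> in t, q and x = q^m.\<close>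

lemma cf_t_shift_aux1:
  "(1 - t\<^sup>2 * q) * (1 - t\<^sup>2 * q\<^sup>2) * ch (t * q) (Suc m) =
   (1 + t\<^sup>2 * q) * ch t (Suc m) - t * ch t m - t * q * ch t (Suc (Suc m))"
proof -
  define P where "P = (\<Prod>i<m. t - q ^ i)"
  define R where "R = ph (t * q ^ (m + 3))"
  define S where "S = ph (t * q * q)"
  have P1: "(\<Prod>i<Suc m. t * q - q ^ i) = (t * q - 1) * q ^ m * P"
  proof -
    have "(\<Prod>i<Suc m. t * q - q ^ i) = (t * q - 1) * (\<Prod>i<m. q * (t - q ^ i))"
      by (subst prod.lessThan_Suc_shift) (simp add: algebra_simps)
    then show ?thesis by (simp add: P_def prod.distrib)
  qed
  have R2: "ph (t * q ^ (m + 2)) = (1 - t * q ^ (m + 2)) * R"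
    using ph_rec[of "t * q ^ (m + 2)"]
    by (simp only: R_def mult.assoc flip: power_Suc2) (simp add: eval_nat_numeral)
  have R1: "ph (t * q ^ (m + 1)) = (1 - t * q ^ (m + 1)) * ((1 - t * q ^ (m + 2)) * R)"
    using ph_rec[of "t * q ^ (m + 1)"] unfolding R2[symmetric]
    by (simp only: mult.assoc flip: power_Suc2) simp
  have S1: "ph (t * q) = (1 - t * q) * S"
    using ph_rec[of "t * q"] by (simp add: S_def)
  have c1: "ch (t * q) (Suc m) = S * R * ((t * q - 1) * q ^ m * P)"
    unfolding ch_def P1 S_def R_def by (simp add: mult_ac eval_nat_numeral)
  have c2: "ch t m = (1 - t * q) * S * ((1 - t * q ^ (m + 1)) * ((1 - t * q ^ (m + 2)) * R)) * P"
    unfolding ch_def S1 R1 P_def by simp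
  have c3: "ch t (Suc m) = (1 - t * q) * S * ((1 - t * q ^ (m + 2)) * R) * (P * (t - q ^ m))"
    using R2 unfolding ch_def S1 P_def by simp
  have c4: "ch t (Suc (Suc m)) = (1 - t * q) * S * R * (P * (t - q ^ m) * (t - q ^ (m + 1)))"
    unfolding ch_def S1 P_def R_def by (simp add: eval_nat_numeral)
  define x where "x = q ^ m"
  have key: "(1 + t\<^sup>2 * q) * (1 - t * (q\<^sup>2 * x)) * (t - x) - t * (1 - t * (q * x)) * (1 - t * (q\<^sup>2 * x))
      - t * q * (t - x) * (t - q * x) = - ((1 - t\<^sup>2 * q) * (1 - t\<^sup>2 * q\<^sup>2)) * x"
    by (simp add: algebra_simps power2_eq_square)
  have x: "q ^ (m + 1) = q * x" "q ^ (m + 2) = q\<^sup>2 * x" "q ^ m = x"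
    by (simp_all add: x_def power_add power2_eq_square)
  have "(1 + t\<^sup>2 * q) * ch t (Suc m) - t * ch t m - t * q * ch t (Suc (Suc m)) = (1 - t * q) * S * R * P *
    ((1 + t\<^sup>2 * q) * (1 - t * (q\<^sup>2 * x)) * (t - x) - t * (1 - t * (q * x)) * (1 - t * (q\<^sup>2 * x))
      - t * q * (t - x) * (t - q * x))"
  proof -
    have "L * (A * S * (b * R) * (P * d)) - t * (A * S * (a * (b * R)) * P) - t * q * (A * S * R * (P * d * e)) =
      A * S * R * P * (L * b * d - t * a * b - t * q * d * e)" for L A a b d e :: complex
      by (simp add: algebra_simps)
    then show ?thesis unfolding c2 c3 c4 x .
  qed
  then show ?thesis unfolding c1 key x by (simp add: algebra_simps)
qed

lemma cf_t_shift_aux2: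
  "(1 - t\<^sup>2 * q) * (1 - t\<^sup>2 * q\<^sup>2) * ch (t * q) 0 = (1 + t\<^sup>2 * q) * ch t 0 - 2 * t * q * ch t 1"
proof -
  define S where "S = ph (t * q * q)"
  have S1: "ph (t * q) = (1 - t * q) * S"
    using ph_rec[of "t * q"] by (simp add: S_def)
  have h: "ch (t * q) 0 = S * S" "ch t 0 = ((1 - t * q) * S) * ((1 - t * q) * S)"
    "ch t 1 = ((1 - t * q) * S) * S * (t - 1)"
    unfolding ch_def S1 by (simp_all add: S1 S_def[symmetric] mult.assoc[symmetric])
  show ?thesis unfolding h by (simp add: algebra_simps power2_eq_square)
qed

text \<open>This is the coefficient of Z^n in dl (t q) Z = dl t Z (1 - t Z) (1 - t q / Z), derived
  from the closed form because the expansion of \<open>dl\<close> is yet to be established. The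
  factor on the left is the change of the normalisation \<open>ph (t\<^sup>2 * q)\<close>.\<close>

lemma cf_t_shift:
  "(1 - t\<^sup>2 * q) * (1 - t\<^sup>2 * q\<^sup>2) * cf (t * q) n =
   (1 + t\<^sup>2 * q) * cf t n - t * cf t (n - 1) - t * q * cf t (n + 1)"
proof -
  have nonneg: "(1 - t\<^sup>2 * q) * (1 - t\<^sup>2 * q\<^sup>2) * cf (t * q) n =
      (1 + t\<^sup>2 * q) * cf t n - t * cf t (n - 1) - t * q * cf t (n + 1)" if "n \<ge> 0" for n
  proof (cases "n = 0")
    case True
    then show ?thesis using cf_t_shift_aux2[of t] by (simp add: cf_def algebra_simps)
  next
    case False
    define m where "m = nat (n - 1)"
    have "n = int (Suc m)" using False that by (simp add: m_def)
    then show ?thesis using cf_t_shift_aux1[of t m] by (simp add: cf_def nat_add_distrib)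
  qed
  show ?thesis
  proof (cases "n \<ge> 0")
    case False
    define k where "k = - n"
    have *: "cf t (n - 1) = q powi (k + 1) * cf t (k + 1)" "cf t (n + 1) = q powi (k - 1) * cf t (k - 1)"
      "cf t n = q powi k * cf t k" "cf (t * q) n = q powi k * cf (t * q) k"
      using cf_uminus[of t "k + 1"] cf_uminus[of t "k - 1"] cf_uminus[of t k] cf_uminus[of "t * q" k]
      by (simp_all add: k_def add.commute)
    have "q powi k * ((1 - t\<^sup>2 * q) * (1 - t\<^sup>2 * q\<^sup>2) * cf (t * q) k) =
      q powi k * ((1 + t\<^sup>2 * q) * cf t k - t * cf t (k - 1) - t * q * cf t (k + 1))"
      using nonneg[of k] False by (simp add: k_def)
    then show ?thesis unfolding *
      by (simp add: power_int_diff power_int_add field_simps)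
  qed (rule nonneg)
qed

lemma cc_t_shift:
  assumes "t\<^sup>2 * q \<noteq> 1" "t\<^sup>2 * q\<^sup>2 \<noteq> 1"
  shows "cc (t * q) n = (1 + t\<^sup>2 * q) * cc t n - t * cc t (n - 1) - t * q * cc t (n + 1)"
proof -
  have "ph (t\<^sup>2 * q) = (1 - t\<^sup>2 * q) * ((1 - t\<^sup>2 * q\<^sup>2) * ph ((t * q)\<^sup>2 * q))"
    using ph_rec[of "t\<^sup>2 * q"] ph_rec[of "t\<^sup>2 * q\<^sup>2"] by (simp add: power2_eq_square mult_ac)
  then have "(1 + t\<^sup>2 * q) * cc t n - t * cc t (n - 1) - t * q * cc t (n + 1) =
     ((1 - t\<^sup>2 * q) * (1 - t\<^sup>2 * q\<^sup>2) * cf (t * q) n) /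
     (ph q * ((1 - t\<^sup>2 * q) * ((1 - t\<^sup>2 * q\<^sup>2) * ph ((t * q)\<^sup>2 * q))))"
    unfolding cf_t_shift cc_def by (simp add: diff_divide_distrib)
  then show ?thesis using assms by (simp add: cc_def)
qed

text \<open>At t = q^m the quotient \<open>dl\<close> collapses to a finite triple product. For m =
  0 the coefficients are concentrated at n = 0, and the recurrence in t multiplies the sum by (1 - Z
  q^m) (1 - q^(m+1) / Z).\<close>

lemma finite_theta_expansion:
  assumes Z: "Z \<noteq> 0"
  shows "((\<lambda>n. cc (q ^ m) n * Z powi n) has_sum (\<Prod>i<m. (1 - Z * q ^ i) * (1 - q ^ (i + 1) / Z))) UNIV"
proof (induction m)
  case 0
  have "cf 1 n = 0" if "n \<noteq> 0" for n
  proof -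
    have "ch 1 k = 0" if "k > 0" for k
      using that unfolding ch_def by (auto intro!: bexI[of _ 0])
    then show ?thesis using that by (auto simp: cf_def)
  qed
  moreover have "cf 1 0 = ph q * ph q" by (simp add: cf_def ch_def)
  ultimately have "cc 1 n * Z powi n = (if n = 0 then 1 else 0)" for n
    by (auto simp: cc_def)
  then show ?case by (auto intro!: has_sum_finite_neutralI[of "{0}"] split: if_splits)
next
  case (Suc m)
  let ?t = "q ^ m" and ?S = "\<Prod>i<m. (1 - Z * q ^ i) * (1 - q ^ (i + 1) / Z)"
  let ?u = "\<lambda>n. cc ?t n * Z powi n"
  have t: "?t\<^sup>2 * q \<noteq> 1" "?t\<^sup>2 * q\<^sup>2 \<noteq> 1"
  proof -
    have "?t\<^sup>2 * q = q ^ (m * 2 + 1)" "?t\<^sup>2 * q\<^sup>2 = q ^ (m * 2 + 2)"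
      by (simp_all only: power_add power_mult power_one_right)
    then show "?t\<^sup>2 * q \<noteq> 1" "?t\<^sup>2 * q\<^sup>2 \<noteq> 1" by (simp_all only: q_power_eq_1_iff)
  qed
  have "((\<lambda>n. (1 + ?t\<^sup>2 * q) * ?u n + (- ?t * Z) * ?u (n + - 1) + (- ?t * q / Z) * ?u (n + 1)) has_sum
      (1 + ?t\<^sup>2 * q) * ?S + (- ?t * Z) * ?S + (- ?t * q / Z) * ?S) UNIV"
    by (intro has_sum_add has_sum_cmult_right iffD2[OF has_sum_shift_int] Suc)
  also have "(\<lambda>n. (1 + ?t\<^sup>2 * q) * ?u n + (- ?t * Z) * ?u (n + - 1) + (- ?t * q / Z) * ?u (n + 1)) =
      (\<lambda>n. cc (q ^ Suc m) n * Z powi n)"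
  proof
    fix n
    have Zn: "Z powi (n + - 1) = Z powi n / Z" "Z powi (n + 1) = Z powi n * Z"
      using Z power_int_add[of Z n "- 1"] power_int_add[of Z n 1] by (simp_all add: field_simps)
    have C: "cc (q ^ Suc m) n = (1 + ?t\<^sup>2 * q) * cc ?t n - ?t * cc ?t (n + - 1) - ?t * q * cc ?t (n + 1)"
      using cc_t_shift[OF t, of n] by (simp add: mult.commute)
    then show "(1 + ?t\<^sup>2 * q) * ?u n + (- ?t * Z) * ?u (n + - 1) + (- ?t * q / Z) * ?u (n + 1) =
        cc (q ^ Suc m) n * Z powi n"
      unfolding Zn C using Z by (simp add: algebra_simps)
  qed
  also have "(1 + ?t\<^sup>2 * q) * ?S + (- ?t * Z) * ?S + (- ?t * q / Z) * ?S =
      (\<Prod>i<Suc m. (1 - Z * q ^ i) * (1 - q ^ (i + 1) / Z))"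
    using Z by (simp add: field_simps power2_eq_square)
  finally show ?case .
qed

lemma cf_holomorphic: "(\<lambda>t. cf t n) holomorphic_on A"
  unfolding cf_def ch_def by (cases "n \<ge> 0") (auto intro!: holomorphic_intros)

text \<open>The constant serves the whole disc |t| <= s, as domination with varying t requires. The
  only growing part is the product of the t - q^i; since the q^i are summable it exceeds s^n by a
  bounded factor only.\<close>

lemma ch_bound:
  assumes "s > 0"
  obtains C where "C > 0" "\<And>t n. norm t \<le> s \<Longrightarrow> norm (ch t n) \<le> C * s ^ n"
proof -
  have "compact (ph ` cball 0 s)"
    by (intro compact_continuous_image ph_continuous' continuous_on_id) auto
  then obtain K where K: "K > 0" "\<And>z. norm z \<le> s \<Longrightarrow> norm (ph z) \<le> K"
    using compact_imp_bounded[of "ph ` cball 0 s"] unfolding bounded_pos by auto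
  define E where "E = exp (1 / (s * (1 - norm q)))"
  have E: "(\<Prod>i<n. s + norm q ^ i) \<le> E * s ^ n" for n
  proof -
    have "(\<Prod>i<n. 1 + norm q ^ i / s) \<le> exp (\<Sum>i<n. norm q ^ i / s)"
      unfolding exp_sum[OF finite_lessThan]
      by (intro prod_mono) (use assms in \<open>auto intro: add_nonneg_nonneg\<close>)
    also have "(\<Sum>i<n. norm q ^ i / s) \<le> 1 / (s * (1 - norm q))"
    proof -
      have "(\<Sum>i<n. norm q ^ i) \<le> suminf (\<lambda>i. norm q ^ i)"
        using norm_q by (intro sum_le_suminf) auto
      also have "\<dots> = 1 / (1 - norm q)" using norm_q by (simp add: suminf_geometric)
      finally have "(\<Sum>i<n. norm q ^ i) / s \<le> 1 / (1 - norm q) / s"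
        using assms by (intro divide_right_mono) auto
      then show ?thesis by (simp add: sum_divide_distrib mult.commute)
    qed
    finally have "(\<Prod>i<n. 1 + norm q ^ i / s) \<le> E" by (simp add: E_def)
    moreover have "(\<Prod>i<n. s + norm q ^ i) = s ^ n * (\<Prod>i<n. 1 + norm q ^ i / s)"
    proof -
      have "(\<Prod>i<n. s + norm q ^ i) = (\<Prod>i<n. s * (1 + norm q ^ i / s))"
        using assms by (intro prod.cong) (auto simp: field_simps)
      then show ?thesis by (simp add: prod.distrib)
    qed
    ultimately show ?thesis using assms mult_left_mono[of "\<Prod>i<n. 1 + norm q ^ i / s" E "s ^ n"]
      by (simp add: mult.commute)
  qed
  have "norm (ch t n) \<le> (K * K * E) * s ^ n" if "norm t \<le> s" for t n
  proof -
    have le: "norm (t * q ^ k) \<le> s" for k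
    proof -
      have "norm t * norm q ^ k \<le> s * 1"
        by (intro mult_mono power_le_one) (use norm_q that assms in auto)
      then show ?thesis by (simp add: norm_mult norm_power)
    qed
    have "norm (\<Prod>i<n. t - q ^ i) \<le> (\<Prod>i<n. s + norm q ^ i)"
      unfolding prod_norm[symmetric]
    proof (intro prod_mono conjI)
      show "norm (t - q ^ i) \<le> s + norm q ^ i" for i
        using norm_triangle_ineq4[of t "q ^ i"] that by (simp add: norm_power)
    qed auto
    also note E
    finally have "norm (\<Prod>i<n. t - q ^ i) \<le> E * s ^ n" .
    then have "norm (ch t n) \<le> K * K * (E * s ^ n)"
      unfolding ch_def norm_mult
      by (intro mult_mono K(2)) (use K(1) le[of 1] le[of "n + 1"] in auto)
    then show ?thesis by (simp add: mult_ac)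
  qed
  moreover have "K * K * E > 0" using K by (simp add: E_def)
  ultimately show thesis by (rule that[rotated])
qed

lemma cf_bound:
  assumes "s > 0" "Z \<noteq> 0"
  obtains C where "C > 0"
    "\<And>t n. norm t \<le> s \<Longrightarrow> norm (cf t n * Z powi n) \<le> C * (max (s * norm Z) (s * norm q / norm Z)) ^ nat \<bar>n\<bar>"
proof -
  obtain C where C: "C > 0" "\<And>t n. norm t \<le> s \<Longrightarrow> norm (ch t n) \<le> C * s ^ n"
    using ch_bound[OF assms(1)] by blast
  let ?l = "max (s * norm Z) (s * norm q / norm Z)"
  have "norm (cf t n * Z powi n) \<le> C * ?l ^ nat \<bar>n\<bar>" if t: "norm t \<le> s" for t n
  proof (cases "n \<ge> 0")
    case True
    then have "norm (cf t n * Z powi n) = norm (ch t (nat n)) * norm Z ^ nat n"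
      by (simp add: cf_def norm_mult norm_power power_int_def)
    also have "\<dots> \<le> C * s ^ nat n * norm Z ^ nat n"
      by (intro mult_right_mono C t) auto
    also have "\<dots> = C * (s * norm Z) ^ nat n" by (simp add: power_mult_distrib)
    also have "\<dots> \<le> C * ?l ^ nat n"
      by (intro mult_left_mono power_mono) (use assms C in auto)
    finally show ?thesis using True by simp
  next
    case False
    then have "norm (cf t n * Z powi n) = norm (ch t (nat (- n))) * (norm q / norm Z) ^ nat (- n)"
      by (simp add: cf_def norm_mult norm_divide norm_power norm_inverse power_int_def field_simps)
    also have "\<dots> \<le> C * s ^ nat (- n) * (norm q / norm Z) ^ nat (- n)"
      by (intro mult_right_mono C t) auto
    also have "\<dots> = C * (s * norm q / norm Z) ^ nat (- n)" by (simp add: power_mult_distrib power_divide)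
    also have "\<dots> \<le> C * ?l ^ nat (- n)"
      by (intro mult_left_mono power_mono) (use assms C in auto)
    finally show ?thesis using False by simp
  qed
  then show thesis by (rule that[OF C(1)])
qed

text \<open>
  The theorem for small \<open>\<bar>t\<bar>\<close> follows Ismail: both sides are analytic in \<open>t\<close>, and they agree at
  the points \<open>t = q\<^sup>m\<close>, which accumulate at \<open>0\<close>.
\<close>

lemma ramanujan_small:
  assumes Z: "Z \<noteq> 0" and t: "norm (t * Z) < 1" "norm (t * q) < norm Z"
  shows "((\<lambda>n. cc t n * Z powi n) has_sum dl t Z) UNIV"
proof -
  \<comment> \<open>The series converges for |t Z| < 1 and |t q| < |Z|; \<open>T\<close> is the
    radius of this disc of parameters t.\<close>
  define T where "T = min (1 / norm Z) (norm Z / norm q)"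
  have "T > 0" using Z norm_q_pos by (simp add: T_def)
  have T_iff: "norm x < T \<longleftrightarrow> norm (x * Z) < 1 \<and> norm (x * q) < norm Z" for x
    using Z norm_q_pos by (auto simp: T_def norm_mult field_simps)
  define H where "H = (\<lambda>x. \<Sum>\<^sub>\<infinity>n. cf x n * Z powi n)"
  have bnd: "\<exists>B. B summable_on UNIV \<and> (\<forall>n. \<forall>x. norm x \<le> s \<longrightarrow> norm (cf x n * Z powi n) \<le> B n)"
    if s: "0 < s" "s < T" for s
  proof -
    obtain C where C: "C > 0" "\<And>t n. norm t \<le> s \<Longrightarrow> norm (cf t n * Z powi n) \<le>
        C * (max (s * norm Z) (s * norm q / norm Z)) ^ nat \<bar>n\<bar>"
      by (rule cf_bound[OF s(1) Z]) (rule that)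
    have "max (s * norm Z) (s * norm q / norm Z) < 1"
      using s T_iff[of "of_real s"] Z by (simp add: norm_mult)
    then have "(\<lambda>n::int. C * (max (s * norm Z) (s * norm q / norm Z)) ^ nat \<bar>n\<bar>) summable_on UNIV"
      using s by (intro summable_on_cmult_right summable_on_int_geometric) (auto simp: le_max_iff_disj)
    then show ?thesis
      by (intro exI[of _ "\<lambda>n::int. C * (max (s * norm Z) (s * norm q / norm Z)) ^ nat \<bar>n\<bar>"])
        (auto intro: C)
  qed
  have summ: "(\<lambda>n. cf x n * Z powi n) summable_on UNIV" if "norm x < T" for x
  proof -
    obtain s where s: "norm x < s" "s < T" using dense \<open>norm x < T\<close> by blast
    have "0 < s" using s(1) norm_ge_zero[of x] by linarith
    then obtain B where B: "B summable_on UNIV" "\<And>n. norm (cf x n * Z powi n) \<le> B n"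
      using bnd[OF _ s(2)] s(1) by (meson less_imp_le)
    show ?thesis by (rule abs_summable_summable, rule Infinite_Sum.abs_summable_on_comparison_test'[OF B(1)]) (rule B(2))
  qed
  have "H holomorphic_on ball 0 T" unfolding H_def
  proof (rule holomorphic_on_infsum)
    show "(\<lambda>x. cf x n * Z powi n) holomorphic_on ball 0 T" for n
      by (intro holomorphic_intros cf_holomorphic)
    fix x :: complex assume "x \<in> ball 0 T"
    then obtain s where s: "norm x < s" "s < T" using dense by auto
    have sub: "norm y \<le> s" if "y \<in> cball x (s - norm x)" for y
      using that norm_triangle_ineq2[of y x] by (auto simp: dist_norm norm_minus_commute)
    have "0 < s" using s(1) norm_ge_zero[of x] by linarith
    then obtain B where "B summable_on UNIV" "\<And>n y. norm y \<le> s \<Longrightarrow> norm (cf y n * Z powi n) \<le> B n"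
      using bnd[OF _ s(2)] by meson
    then show "\<exists>d>0. cball x d \<subseteq> ball 0 T \<and> (\<exists>B. B summable_on UNIV \<and>
        (\<forall>n\<in>UNIV. \<forall>y\<in>cball x d. norm (cf y n * Z powi n) \<le> B n))"
    proof (intro exI[of _ "s - norm x"] conjI exI[of _ B] ballI subsetI)
      fix y assume "y \<in> cball x (s - norm x)"
      then show "y \<in> ball 0 T" using sub[of y] s(2) by simp
    qed (use s sub in simp_all)
  qed auto
  \<comment> \<open>The identity is stated without denominators, so that both sides are holomorphic
    in t on the whole disc, its centre included.\<close>
  then have hol: "(\<lambda>x. H x * (ph (x * Z) * ph (x * q / Z)) - ph q * ph (x\<^sup>2 * q) * (ph Z * ph (q / Z)))
      holomorphic_on ball 0 T"
    using Z by (intro holomorphic_intros) auto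
  define U where "U = {x \<in> ball 0 T. \<exists>m. x = q ^ m}"
  \<comment> \<open>The points q^m accumulate at 0, an interior point of the disc only because the
    coefficients \<open>cf\<close> are defined and holomorphic at t = 0.\<close>
  have lim: "0 islimpt U"
    unfolding islimpt_approachable
  proof (intro allI impI)
    fix e :: real assume "e > 0"
    then obtain m where m: "norm q ^ m < min e T"
      using real_arch_pow_inv[of "min e T" "norm q"] norm_q \<open>T > 0\<close> by auto
    then show "\<exists>x'\<in>U. x' \<noteq> 0 \<and> dist x' 0 < e"
      by (intro bexI[of _ "q ^ m"]) (auto simp: U_def norm_power)
  qed
  have "H x * (ph (x * Z) * ph (x * q / Z)) - ph q * ph (x\<^sup>2 * q) * (ph Z * ph (q / Z)) = 0"
    if xU: "x \<in> U" for x
  proof -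
    obtain m where x: "x = q ^ m" using xU by (auto simp: U_def)
    define P where "P = (\<Prod>i<m. 1 - Z * q ^ i)"
    define Q where "Q = (\<Prod>i<m. 1 - q / Z * q ^ i)"
    have nz: "ph (x\<^sup>2 * q) \<noteq> 0"
    proof -
      have "x\<^sup>2 * q = q ^ Suc (m * 2)"
        unfolding x by (simp only: power_mult power_Suc2)
      then have "norm (x\<^sup>2 * q) < 1"
        by (simp only: norm_power power_Suc_less_one norm_q_pos norm_q)
      then show ?thesis by (rule ph_nonzero)
    qed
    have "((\<lambda>n. (ph q * ph (x\<^sup>2 * q)) * (cc x n * Z powi n)) has_sum (ph q * ph (x\<^sup>2 * q)) * (P * Q)) UNIV"
      unfolding x using finite_theta_expansion[OF Z, of m]
      by (intro has_sum_cmult_right) (simp add: P_def Q_def prod.distrib[symmetric] mult_ac)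
    moreover have "(\<lambda>n. (ph q * ph (x\<^sup>2 * q)) * (cc x n * Z powi n)) = (\<lambda>n. cf x n * Z powi n)"
      using nz by (simp add: cc_def)
    ultimately have H: "H x = ph q * ph (x\<^sup>2 * q) * (P * Q)"
      unfolding H_def by (simp add: infsumI)
    have "ph Z = P * ph (x * Z)" "ph (q / Z) = Q * ph (x * q / Z)"
      using ph_split[of Z m] ph_split[of "q / Z" m] by (simp_all add: x P_def Q_def mult_ac)
    then show ?thesis unfolding H by simp
  qed
  note zero = this
  have "H t * (ph (t * Z) * ph (t * q / Z)) - ph q * ph (t\<^sup>2 * q) * (ph Z * ph (q / Z)) = 0"
  proof (rule analytic_continuation[OF hol _ _ _ _ lim zero])
    show "U \<subseteq> ball 0 T" by (auto simp: U_def)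
  qed (use T_iff[of t] t \<open>T > 0\<close> in simp_all)
  moreover have "ph (t * Z) \<noteq> 0" by (rule ph_nonzero) (rule t)
  moreover have "ph (t * q / Z) \<noteq> 0"
    using t Z by (intro ph_nonzero) (simp add: norm_divide)
  moreover have "ph (t\<^sup>2 * q) \<noteq> 0"
  proof (rule ph_nonzero)
    have "norm (t * Z) * norm (t * q / Z) < 1 * 1"
      using t Z by (intro mult_strict_mono') (auto simp: norm_divide)
    then show "norm (t\<^sup>2 * q) < 1" using Z by (simp add: norm_mult norm_divide power2_eq_square field_simps)
  qed
  ultimately have "H t / (ph q * ph (t\<^sup>2 * q)) = dl t Z"
    by (simp add: dl_def field_simps)
  moreover have "((\<lambda>n. cf t n * Z powi n / (ph q * ph (t\<^sup>2 * q))) has_sum H t / (ph q * ph (t\<^sup>2 * q))) UNIV"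
    unfolding H_def using T_iff[of t] t by (intro has_sum_divide_const has_sum_infsum summ) auto
  ultimately show ?thesis by (simp add: cc_def)
qed

text \<open>Induction on the number of factors q that bring t into the range of convergence. By the
  recurrence, (E - a) (E - b) with a = t Z and b = Z / (t q) maps the sequence for t to a shifted
  multiple of the one for t q. The roots a and b differ from 1 because Z is not a pole of
  \<open>dl t\<close>.\<close>

lemma ramanujan_regsum:
  assumes "t \<noteq> 0" "Z \<noteq> 0" "\<And>i. t * Z * q ^ i \<noteq> 1" "\<And>i. t * q ^ Suc i \<noteq> Z"
    "\<And>i. t\<^sup>2 * q ^ Suc i \<noteq> 1"
  shows "regsum (\<lambda>n. cc t n * Z powi n) (dl t Z)"
proof -
  obtain N where "norm q ^ N < min (1 / norm (t * Z)) (norm Z / norm (t * q))"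
    using real_arch_pow_inv[of "min (1 / norm (t * Z)) (norm Z / norm (t * q))" "norm q"] norm_q assms(1,2)
    by auto
  then have "norm (t * q ^ N * Z) < 1" "norm (t * q ^ N * q) < norm Z"
    using assms(1,2) by (auto simp: norm_mult norm_power field_simps)
  then show ?thesis using assms
  proof (induction N arbitrary: t)
    case 0
    then show ?case by (intro regsum_has_sum ramanujan_small) auto
  next
    case (Suc N)
    have t0: "t \<noteq> 0" "t * Z \<noteq> 1" "t * q \<noteq> Z" "t\<^sup>2 * q \<noteq> 1" "t\<^sup>2 * q\<^sup>2 \<noteq> 1"
      using Suc.prems(3) Suc.prems(5)[of 0] Suc.prems(6)[of 0] Suc.prems(7)[of 0] Suc.prems(7)[of 1]
      by (auto simp: power2_eq_square)
    have reg: "regsum (\<lambda>n. cc (t * q) n * Z powi n) (dl (t * q) Z)"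
    proof (rule Suc.IH)
      show "t * q * Z * q ^ i \<noteq> 1" for i using Suc.prems(5)[of "Suc i"] by (simp add: mult_ac)
      show "t * q * q ^ Suc i \<noteq> Z" for i using Suc.prems(6)[of "Suc i"] by (simp add: mult_ac)
      show "(t * q)\<^sup>2 * q ^ Suc i \<noteq> 1" for i
        using Suc.prems(7)[of "Suc (Suc i)"] by (simp add: mult_ac power2_eq_square)
    qed (use Suc.prems in \<open>auto simp: mult_ac\<close>)
    define u where "u = (\<lambda>n. cc t n * Z powi n)"
    define a where "a = t * Z"
    define b where "b = Z / (t * q)"
    define w where "w = (\<lambda>n. (u (n + 1 + 1) - a * u (n + 1)) - b * (u (n + 1) - a * u n))"
    have Z1: "Z powi (n + 1) = Z powi n * Z" "Z powi (1 + n) = Z powi n * Z" "Z powi (n + 2) = Z powi n * Z\<^sup>2" for n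
      using \<open>Z \<noteq> 0\<close> by (simp_all add: power_int_add power2_eq_square)
    have w: "w = (\<lambda>n. - b * (cc (t * q) (n + 1) * Z powi (n + 1)))"
    proof
      fix n show "w n = - b * (cc (t * q) (n + 1) * Z powi (n + 1))"
      unfolding w_def u_def a_def b_def cc_t_shift[OF t0(4,5)] using t0 \<open>Z \<noteq> 0\<close>
      by (simp add: Z1 field_simps power2_eq_square)
    qed
    have "regsum w (- b * dl (t * q) Z)"
      unfolding w by (rule regsum_cmult[OF regsum_shift[OF reg, of 1]])
    also have "- b * dl (t * q) Z = (1 - b) * ((1 - a) * dl t Z)"
    \<comment> \<open>The value for t q contains the factors 1 - a and 1 - t q / Z, and - b (1 - t q
      / Z) = 1 - b. Hence exactly the scalars demanded by the two new roots appear.\<close>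
    proof -
      have "- b * (1 - t * q / Z) = 1 - b" using t0 \<open>Z \<noteq> 0\<close> by (simp add: b_def field_simps)
      then show ?thesis
        unfolding dl_t_shift[OF \<open>Z \<noteq> 0\<close> t0(2,3)] a_def by (metis mult.commute mult.left_commute)
    qed
    finally have reg2: "regsum w ((1 - b) * ((1 - a) * dl t Z))" .
    have ab: "a \<noteq> 0" "a \<noteq> 1" "b \<noteq> 0" "b \<noteq> 1"
      using t0 \<open>Z \<noteq> 0\<close> by (auto simp: a_def b_def)
    have "regsum (\<lambda>n. u (n + 1) - a * u n) ((1 - a) * dl t Z)"
      by (rule regsum_step[OF reg2[unfolded w_def] ab(3,4)])
    then have "regsum u (dl t Z)"
      by (rule regsum_step[OF _ ab(1,2)])
    then show ?case by (simp add: u_def)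
  qed
qed

end


lemma summable_on_int_halves:
  fixes f :: "int \<Rightarrow> complex"
  assumes "summable (\<lambda>n. norm (f (int n)))" "summable (\<lambda>n. norm (f (- int n)))"
  shows "f summable_on UNIV"
proof -
  have "(\<lambda>n. f (int n)) summable_on UNIV" "(\<lambda>n. f (- int n)) summable_on UNIV"
    by (intro norm_summable_imp_summable_on assms)+
  moreover have "f summable_on {0..} \<longleftrightarrow> (\<lambda>n. f (int n)) summable_on UNIV"
    by (rule summable_on_reindex_bij_witness[of _ int nat]) auto
  moreover have "f summable_on {..0} \<longleftrightarrow> (\<lambda>n. f (- int n)) summable_on UNIV"
    by (rule summable_on_reindex_bij_witness[of _ "\<lambda>n. - int n" "\<lambda>n. nat (- n)"]) auto
  ultimately have "f summable_on ({0..} \<union> {..0})"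
    by (intro summable_on_union) auto
  moreover have "{0..} \<union> {..0::int} = UNIV" by auto
  ultimately show ?thesis by simp
qed

section \<open>Growth of the coefficients at both ends, and the coefficients on other
  circles\<close>

context qbase
begin

text \<open>The coefficients (t^2 q; q)_k / (q; q)_k t^(-k) of the q-binomial series.\<close>

definition gk :: "complex \<Rightarrow> nat \<Rightarrow> complex" where
  "gk t k = (\<Prod>j=1..k. (1 - t\<^sup>2 * q ^ j) / (1 - q ^ j)) / t ^ k"

text \<open>The weight of the exponential (t q^k)^n in c(n) as n tends to infinity; Rk / (1 - t q^k
  Z) is the corresponding principal part of \<open>dl\<close> at the pole 1 / (t q^k).\<close>

definition Rk :: "complex \<Rightarrow> nat \<Rightarrow> complex" where
  "Rk t k = rho0 q t * gk t k"

lemma rho0_eq: "rho0 q t = ph (1 / t) * ph (t * q) / (ph q * ph (t\<^sup>2 * q))"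
proof -
  have "rho0 q t = prodinf (\<lambda>i. ((1 - 1 / t * q ^ i) * (1 - t * q * q ^ i)) /
      ((1 - q * q ^ i) * (1 - t\<^sup>2 * q * q ^ i)))"
    by (simp add: rho0_def divide_inverse mult_ac)
  also have "\<dots> = ph (1 / t) * ph (t * q) / (ph q * ph (t\<^sup>2 * q))"
    unfolding ph_def
    by (simp only: prodinf_divide prodinf_mult convergent_prod_mult convergent_ph)
  finally show ?thesis .
qed

lemma gk_Suc: "gk t (Suc k) = gk t k * ((1 - t\<^sup>2 * q ^ Suc k) / (1 - q ^ Suc k)) / t"
  by (simp add: gk_def)

lemma gk_bound:
  obtains C where "C > 0" "\<And>k. norm (gk t k) \<le> C * (1 / norm t) ^ k"
proof -
  have lim: "(\<lambda>k. \<Prod>j=1..k. 1 - z * q ^ j) \<longlonglongrightarrow> ph (z * q)" for z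
  proof -
    have "(\<Prod>j=1..k. 1 - z * q ^ j) = (\<Prod>i<k. 1 - (z * q) * q ^ i)" for k
      by (rule prod.reindex_bij_witness[of _ Suc "\<lambda>j. j - 1"]) (auto simp: power_eq_if)
    moreover have "(\<lambda>n. \<Prod>i<n. 1 - (z * q) * q ^ i) \<longlonglongrightarrow> ph (z * q)"
      unfolding ph_def using convergent_prod_LIMSEQ[OF convergent_ph[of "z * q"]]
      by (simp add: LIMSEQ_lessThan_iff_atMost)
    ultimately show ?thesis by simp
  qed
  have "(\<lambda>k. (\<Prod>j=1..k. 1 - t\<^sup>2 * q ^ j) / (\<Prod>j=1..k. 1 - q ^ j)) \<longlonglongrightarrow> ph (t\<^sup>2 * q) / ph q"
    using lim[of 1] by (intro tendsto_divide lim) auto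
  then have "Bseq (\<lambda>k. \<Prod>j=1..k. (1 - t\<^sup>2 * q ^ j) / (1 - q ^ j))"
    unfolding prod_dividef by (intro convergent_imp_Bseq convergentI)
  then obtain C where C: "C > 0" "\<And>k. norm (\<Prod>j=1..k. (1 - t\<^sup>2 * q ^ j) / (1 - q ^ j)) \<le> C"
    by (auto elim: BseqE)
  have "norm (gk t k) \<le> C * (1 / norm t) ^ k" for k
    using C(2)[of k] unfolding gk_def norm_divide norm_power power_one_over
    by (simp add: divide_right_mono divide_inverse mult_right_mono)
  then show thesis by (rule that[OF C(1)])
qed

text \<open>The q-binomial theorem. The recurrence of \<open>gk\<close> gives the functional
  equation \<open>step\<close> between the values at q y and y; iterating it moves the argument to
  0, where the sum is continuous with value 1.\<close>

lemma q_binomial_aux: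
  assumes t: "t \<noteq> 0" and x: "norm x < norm t"
  shows "summable (\<lambda>k. gk t k * x ^ k)" (is ?A)
    and "suminf (\<lambda>k. gk t k * x ^ k) * ph (x / t) = ph (t * q * x)" (is ?B)
proof -
  obtain C where C: "C > 0" "\<And>k. norm (gk t k) \<le> C * (1 / norm t) ^ k"
    by (rule gk_bound) (rule that)
  have summ: "summable (\<lambda>k. gk t k * y ^ k)" if "norm y < norm t" for y
  proof (rule summable_comparison_test')
    show "summable (\<lambda>k. C * (norm y / norm t) ^ k)"
      using that by (intro summable_mult summable_geometric) (auto simp: t)
    show "norm (gk t k * y ^ k) \<le> C * (norm y / norm t) ^ k" if "k \<ge> 0" for k
      using mult_right_mono[OF C(2)[of k], of "norm y ^ k"]
      by (simp add: norm_mult norm_power power_divide)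
  qed
  show ?A by (rule summ[OF x])
  define S where "S = (\<lambda>y. suminf (\<lambda>k. gk t k * y ^ k))"
  have qy: "norm (q * y) < norm t" if "norm y < norm t" for y
    using that norm_q mult_right_mono[of "norm q" 1 "norm y"] by (simp add: norm_mult)
  have step: "S (q * y) * (1 - t * q * y) = S y * (1 - y / t)" if y: "norm y < norm t" for y
  proof -
    have head: "S z = 1 + suminf (\<lambda>k. gk t (Suc k) * z ^ Suc k)" if "norm z < norm t" for z
      using suminf_split_head[OF summ[OF that]] by (simp add: S_def gk_def)
    have summ': "summable (\<lambda>k. gk t (Suc k) * z ^ Suc k)" if "norm z < norm t" for z
      using summ[OF that] by (subst summable_Suc_iff)
    have "S (q * y) - S y = suminf (\<lambda>k. gk t (Suc k) * (q * y) ^ Suc k - gk t (Suc k) * y ^ Suc k)"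
      unfolding head[OF y] head[OF qy[OF y]]
      by (subst suminf_diff[symmetric]) (use y qy summ' in auto)
    also have "\<dots> = suminf (\<lambda>k. t * q * y * (gk t k * (q * y) ^ k) - y / t * (gk t k * y ^ k))"
    proof (intro suminf_cong)
      fix k
      have nz: "1 - q ^ Suc k \<noteq> 0" by (metis q_power_Suc_neq_1(1) right_minus_eq)
      have "gk t (Suc k) * (q ^ Suc k - 1) = gk t k / t * (t\<^sup>2 * q ^ Suc k - 1)"
        unfolding gk_Suc using nz t by (simp add: divide_simps) (simp add: algebra_simps)
      then have "gk t (Suc k) * (q ^ Suc k - 1) * y ^ Suc k = gk t k / t * (t\<^sup>2 * q ^ Suc k - 1) * y ^ Suc k"
        by simp
      then show "gk t (Suc k) * (q * y) ^ Suc k - gk t (Suc k) * y ^ Suc k =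
          t * q * y * (gk t k * (q * y) ^ k) - y / t * (gk t k * y ^ k)"
        using t by (simp add: power_mult_distrib algebra_simps power2_eq_square)
    qed
    also have "\<dots> = t * q * y * S (q * y) - y / t * S y"
      unfolding S_def using summ[OF y] summ[OF qy[OF y]]
      by (simp only: suminf_diff[symmetric] suminf_mult[symmetric] summable_mult)
    finally show ?thesis by (simp add: algebra_simps)
  qed
  have iter: "S x * (\<Prod>i<n. 1 - x / t * q ^ i) = S (q ^ n * x) * (\<Prod>i<n. 1 - t * q * x * q ^ i)
      \<and> norm (q ^ n * x) < norm t" for n
  proof (induction n)
    case 0 show ?case using x by simp
  next
    case (Suc n)
    define y where "y = q ^ n * x"
    define A where "A = (\<Prod>i<n. 1 - x / t * q ^ i)"
    define B where "B = (\<Prod>i<n. 1 - t * q * x * q ^ i)"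
    have IH: "S x * A = S y * B" "norm y < norm t" using Suc by (simp_all add: y_def A_def B_def)
    have "S x * (A * (1 - y / t)) = S y * (1 - y / t) * B" using IH(1) by (simp add: mult_ac)
    also have "\<dots> = S (q * y) * (B * (1 - t * q * y))" using step[OF IH(2)] by (simp add: mult_ac)
    finally show ?case using qy[OF IH(2)] by (simp add: A_def B_def y_def mult_ac)
  qed
  have lim: "(\<lambda>n. \<Prod>i<n. 1 - z * q ^ i) \<longlonglongrightarrow> ph z" for z
    unfolding ph_def using convergent_prod_LIMSEQ[OF convergent_ph[of "z"]]
    by (simp add: LIMSEQ_lessThan_iff_atMost)
  have "isCont S 0"
  proof -
    define K where "K = complex_of_real (norm t / 2)"
    have "isCont (\<lambda>y. suminf (\<lambda>k. gk t k * y ^ k)) 0"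
    proof (rule isCont_powser)
      show "summable (\<lambda>k. gk t k * K ^ k)" by (rule summ) (use t in \<open>simp add: K_def\<close>)
    qed (use t in \<open>simp add: K_def\<close>)
    then show ?thesis by (simp only: S_def)
  qed
  moreover have "(\<lambda>n. q ^ n * x) \<longlonglongrightarrow> 0"
    using norm_q by (intro tendsto_mult_left_zero LIMSEQ_power_zero)
  ultimately have "(\<lambda>n. S (q ^ n * x)) \<longlonglongrightarrow> S 0"
    by (rule isCont_tendsto_compose)
  moreover have "S 0 = 1" using powser_zero[of "gk t"] by (simp add: S_def gk_def)
  ultimately have lim1: "(\<lambda>n. S (q ^ n * x) * (\<Prod>i<n. 1 - t * q * x * q ^ i)) \<longlonglongrightarrow> 1 * ph (t * q * x)"
    by (intro tendsto_mult lim) simp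
  have "(\<lambda>n. S x * (\<Prod>i<n. 1 - x / t * q ^ i)) \<longlonglongrightarrow> S x * ph (x / t)"
    by (intro tendsto_mult lim tendsto_const)
  also have "(\<lambda>n. S x * (\<Prod>i<n. 1 - x / t * q ^ i)) = (\<lambda>n. S (q ^ n * x) * (\<Prod>i<n. 1 - t * q * x * q ^ i))"
    using iter by (rule_tac ext) blast
  finally show ?B using LIMSEQ_unique[OF lim1] unfolding S_def by simp
qed

text \<open>With x = q^n the q-binomial theorem turns the closed form of c(n) into rho0 t^n times a
  power series in x. Cutting the series after K terms costs O(x^K), and since |x| <= 1 < |t| the
  constant is the same for all n.\<close>

lemma cc_nat_asymptotics:
  assumes t: "norm t > 1"
  obtains C where "C > 0"
    "\<And>n. norm (cc t (int n) - (\<Sum>k<K. Rk t k * (t * q ^ k) ^ n)) \<le> C * norm (t * q ^ K) ^ n"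
proof -
  have t0: "t \<noteq> 0" using t by auto
  obtain C where C: "C > 0" "\<And>k. norm (gk t k) \<le> C * (1 / norm t) ^ k"
    by (rule gk_bound) (rule that)
  define B where "B = norm (rho0 q t) * (C * (1 / norm t) ^ K / (1 - 1 / norm t)) + 1"
  have "0 \<le> C * (1 / norm t) ^ K / (1 - 1 / norm t)"
    using C(1) t by (intro divide_nonneg_nonneg mult_nonneg_nonneg) (simp_all add: divide_le_eq)
  then have "B > 0" unfolding B_def by (intro add_nonneg_pos mult_nonneg_nonneg) auto
  moreover have "norm (cc t (int n) - (\<Sum>k<K. Rk t k * (t * q ^ k) ^ n)) \<le> B * norm (t * q ^ K) ^ n" for n
  proof -
    define x where "x = q ^ n"
    have x1: "norm x \<le> 1" using norm_q by (simp add: x_def norm_power power_le_one)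
    then have x: "norm x < norm t" using t by simp
    define S where "S = suminf (\<lambda>k. gk t k * x ^ k)"
    have "cc t (int n) = rho0 q t * t ^ n * S"
    proof -
      have nz: "ph (x / t) \<noteq> 0" using x t0 by (intro ph_nonzero) (simp add: norm_divide)
      have "(\<Prod>i<n. t - q ^ i) = (\<Prod>i<n. t * (1 - 1 / t * q ^ i))"
        using t0 by (simp add: right_diff_distrib)
      then have "(\<Prod>i<n. t - q ^ i) * ph (x / t) = t ^ n * ph (1 / t)"
        using ph_split[of "1 / t" n] by (simp add: prod.distrib x_def)
      moreover have "ph (t * q ^ (n + 1)) = S * ph (x / t)"
        using q_binomial_aux(2)[OF t0 x] by (simp add: S_def x_def mult_ac)
      ultimately have "ch t n = ph (t * q) * S * (t ^ n * ph (1 / t))"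
        unfolding ch_def by (simp add: mult_ac)
      then show ?thesis by (simp add: cc_def cf_def rho0_eq)
    qed
    moreover have "(\<Sum>k<K. Rk t k * (t * q ^ k) ^ n) = rho0 q t * t ^ n * (\<Sum>k<K. gk t k * x ^ k)"
    proof -
      have "(q ^ k) ^ n = (q ^ n) ^ k" for k by (metis mult.commute power_mult)
      then show ?thesis by (simp add: Rk_def x_def sum_distrib_left power_mult_distrib mult_ac)
    qed
    ultimately have eq: "cc t (int n) - (\<Sum>k<K. Rk t k * (t * q ^ k) ^ n) =
        rho0 q t * t ^ n * (S - (\<Sum>k<K. gk t k * x ^ k))"
      by (simp add: algebra_simps)
    have "norm (S - (\<Sum>k<K. gk t k * x ^ k)) = norm (suminf (\<lambda>k. gk t (k + K) * x ^ (k + K)))"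
      unfolding S_def using suminf_minus_initial_segment[OF q_binomial_aux(1)[OF t0 x], of K] by simp
    also have "\<dots> \<le> suminf (\<lambda>k. C * (1 / norm t) ^ K * norm x ^ K * (1 / norm t) ^ k)"
    proof (rule norm_suminf_le)
      show "norm (gk t (k + K) * x ^ (k + K)) \<le> C * (1 / norm t) ^ K * norm x ^ K * (1 / norm t) ^ k" for k
      proof -
        have "norm (gk t (k + K)) * norm x ^ (k + K) \<le> (C * (1 / norm t) ^ (k + K)) * norm x ^ K"
          by (intro mult_mono C power_decreasing) (use x1 C in auto)
        then show ?thesis by (simp add: norm_mult norm_power power_add mult_ac)
      qed
      show "summable (\<lambda>k. C * (1 / norm t) ^ K * norm x ^ K * (1 / norm t) ^ k)"
        using t by (intro summable_mult summable_geometric) (simp add: divide_less_eq)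
    qed
    also have "\<dots> = C * (1 / norm t) ^ K / (1 - 1 / norm t) * norm x ^ K"
    proof -
      have "norm (1 / norm t) < 1" using t by (simp add: divide_less_eq)
      then show ?thesis by (simp add: suminf_mult suminf_geometric summable_geometric)
    qed
    finally have "norm (cc t (int n) - (\<Sum>k<K. Rk t k * (t * q ^ k) ^ n)) \<le>
        norm (rho0 q t) * norm t ^ n * (C * (1 / norm t) ^ K / (1 - 1 / norm t) * norm x ^ K)"
      unfolding eq norm_mult norm_power by (intro mult_left_mono) auto
    also have "\<dots> = norm (rho0 q t) * (C * (1 / norm t) ^ K / (1 - 1 / norm t)) * norm (t * q ^ K) ^ n"
    proof -
      have "(norm q ^ n) ^ K = (norm q ^ K) ^ n" by (metis mult.commute power_mult)
      then have "norm (t * q ^ K) ^ n = norm t ^ n * norm x ^ K"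
        by (simp add: x_def norm_mult norm_power power_mult_distrib)
      then show ?thesis by simp
    qed
    also have "\<dots> \<le> B * norm (t * q ^ K) ^ n"
      unfolding B_def by (intro mult_right_mono) auto
    finally show ?thesis .
  qed
  ultimately show thesis by (rule that)
qed

text \<open>The first K exponentials govern n -> +infinity, the last L govern n -> -infinity; the
  latter carry \<open>q ^ Suc k\<close> because c(-n) = q^n c(n). All of them are subtracted at
  every n. If K and L count the poles that lie on the wrong side of a circle about 0, these are the
  Laurent coefficients of \<open>dl\<close> on that circle.\<close>

definition UU :: "nat \<Rightarrow> nat \<Rightarrow> complex \<Rightarrow> int \<Rightarrow> complex" where
  "UU K L t n = cc t n - (\<Sum>k<K. Rk t k * (t * q ^ k) powi n) - (\<Sum>k<L. Rk t k * (t * q ^ Suc k) powi (- n))"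

lemma regsum_UU:
  assumes "t \<noteq> 0" "Z \<noteq> 0" "\<And>i. t * Z * q ^ i \<noteq> 1" "\<And>i. t * q ^ Suc i \<noteq> Z"
    "\<And>i. t\<^sup>2 * q ^ Suc i \<noteq> 1"
  shows "regsum (\<lambda>n. UU K L t n * Z powi n) (dl t Z)"
proof -
  have "regsum (\<lambda>n. cc t n * Z powi n - (\<Sum>k<K. Rk t k * (t * q ^ k * Z) powi n)
      - (\<Sum>k<L. Rk t k * (Z / (t * q ^ Suc k)) powi n)) (dl t Z - (\<Sum>k<K. Rk t k * 0) - (\<Sum>k<L. Rk t k * 0))"
    using assms
    by (intro regsum_diff ramanujan_regsum regsum_sum regsum_cmult regsum_exponential) (auto simp: mult_ac)
  also have "(\<lambda>n. cc t n * Z powi n - (\<Sum>k<K. Rk t k * (t * q ^ k * Z) powi n)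
      - (\<Sum>k<L. Rk t k * (Z / (t * q ^ Suc k)) powi n)) = (\<lambda>n. UU K L t n * Z powi n)"
  proof
    fix n
    have "(Z / (t * q ^ Suc k)) powi n = (t * q ^ Suc k) powi (- n) * Z powi n" for k
      by (simp only: divide_inverse power_int_mult_distrib power_int_inverse power_int_minus mult.commute)
    then show "cc t n * Z powi n - (\<Sum>k<K. Rk t k * (t * q ^ k * Z) powi n)
      - (\<Sum>k<L. Rk t k * (Z / (t * q ^ Suc k)) powi n) = UU K L t n * Z powi n"
      by (simp only: UU_def left_diff_distrib sum_distrib_right power_int_mult_distrib mult.assoc)
  qed
  finally show ?thesis by simp
qed

text \<open>On each half line one group of exponentials cancels the growth of c(n) and the other
  group decays. The value then comes for free: the removed exponentials have regularised sum 0, and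
  a convergent sum is a regularised one.\<close>

lemma UU_has_sum:
  assumes t: "norm t > 1" and p: "p \<noteq> 0" and K: "\<And>k. k < K \<Longrightarrow> norm (t * q ^ k * p) > 1"
      "norm (t * q ^ K * p) < 1"
    and L: "\<And>k. k < L \<Longrightarrow> norm (t * q ^ Suc k) > norm p" "norm (t * q ^ Suc L) < norm p"
    and t2: "\<And>i. t\<^sup>2 * q ^ Suc i \<noteq> 1"
  shows "((\<lambda>n. UU K L t n * p powi n) has_sum dl t p) UNIV"
proof -
  have t0: "t \<noteq> 0" using t by auto
  have qle: "norm q ^ m \<le> norm q ^ n" if "n \<le> m" for m n
    using that norm_q by (intro power_decreasing) auto
  have reg: "regsum (\<lambda>n. UU K L t n * p powi n) (dl t p)"
  proof (rule regsum_UU[OF t0 p _ _ t2])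
    fix i
    show "t * p * q ^ i \<noteq> 1"
    proof (cases "i < K")
      case True
      have "norm (t * p * q ^ i) > 1" using K(1)[OF True] by (simp add: mult_ac)
      then show ?thesis by (metis less_irrefl norm_one)
    next
      case False
      have "norm t * norm p * norm q ^ i \<le> norm t * norm p * norm q ^ K"
        by (intro mult_left_mono qle) (use False in auto)
      then have "norm (t * p * q ^ i) < 1" using K(2) by (simp add: norm_mult norm_power mult_ac)
      then show ?thesis by (metis less_irrefl norm_one)
    qed
    show "t * q ^ Suc i \<noteq> p"
    proof (cases "i < L")
      case True
      then show ?thesis using L(1)[OF True] by auto
    next
      case False
      have "norm t * norm q ^ Suc i \<le> norm t * norm q ^ Suc L"
        by (intro mult_left_mono qle) (use False in auto)
      then show ?thesis using L(2) by (auto simp: norm_mult norm_power)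
    qed
  qed
  obtain C where C: "C > 0"
    "\<And>n. norm (cc t (int n) - (\<Sum>k<K. Rk t k * (t * q ^ k) ^ n)) \<le> C * norm (t * q ^ K) ^ n"
    using t by (rule cc_nat_asymptotics) (rule that)
  obtain D where D: "D > 0"
    "\<And>n. norm (cc t (int n) - (\<Sum>k<L. Rk t k * (t * q ^ k) ^ n)) \<le> D * norm (t * q ^ L) ^ n"
    using t by (rule cc_nat_asymptotics) (rule that)
  have "(\<lambda>n. UU K L t n * p powi n) summable_on UNIV"
  proof (rule summable_on_int_halves)
    define b where "b = (\<lambda>n. C * norm (t * q ^ K * p) ^ n + (\<Sum>k<L. norm (Rk t k) * norm (p / (t * q ^ Suc k)) ^ n))"
    have "summable b" unfolding b_def
      using K L t0 p by (intro summable_add summable_mult summable_sum summable_geometric)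
        (auto simp: norm_divide)
    moreover have "norm (UU K L t (int n) * p powi int n) \<le> b n" for n
    proof -
      have "norm (UU K L t (int n)) \<le> C * norm (t * q ^ K) ^ n +
          (\<Sum>k<L. norm (Rk t k) * norm (1 / (t * q ^ Suc k)) ^ n)"
      proof -
        have "norm (\<Sum>k<L. Rk t k * (t * q ^ Suc k) powi (- int n)) \<le>
            (\<Sum>k<L. norm (Rk t k) * norm (1 / (t * q ^ Suc k)) ^ n)"
          by (intro order_trans[OF norm_sum] sum_mono)
            (simp add: norm_mult norm_power power_int_minus norm_inverse norm_divide divide_inverse power_inverse power_mult_distrib)
        moreover have "UU K L t (int n) = (cc t (int n) - (\<Sum>k<K. Rk t k * (t * q ^ k) ^ n)) -
            (\<Sum>k<L. Rk t k * (t * q ^ Suc k) powi (- int n))"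
          by (simp add: UU_def)
        ultimately show ?thesis using C(2)[of n] norm_triangle_ineq4 by (smt (verit))
      qed
      then have "norm (UU K L t (int n)) * norm p ^ n \<le> (C * norm (t * q ^ K) ^ n +
          (\<Sum>k<L. norm (Rk t k) * norm (1 / (t * q ^ Suc k)) ^ n)) * norm p ^ n"
        by (intro mult_right_mono) auto
      also have "\<dots> = b n"
        unfolding b_def by (simp add: distrib_right sum_distrib_right norm_mult norm_divide power_mult_distrib power_divide)
      finally show ?thesis by (simp add: norm_mult norm_power)
    qed
    ultimately show "summable (\<lambda>n. norm (UU K L t (int n) * p powi int n))"
      by (rule_tac summable_comparison_test'[of b 0]) auto
    define c where "c = (\<lambda>n. D * norm (t * q ^ Suc L / p) ^ n + (\<Sum>k<K. norm (Rk t k) * norm (1 / (t * q ^ k * p)) ^ n))"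
    have "summable c" unfolding c_def
      using K L t0 p by (intro summable_add summable_mult summable_sum summable_geometric)
        (auto simp: norm_divide)
    moreover have "norm (UU K L t (- int n) * p powi (- int n)) \<le> c n" for n
    proof -
      have "norm (UU K L t (- int n)) \<le> D * norm (t * q ^ Suc L) ^ n +
          (\<Sum>k<K. norm (Rk t k) * norm (1 / (t * q ^ k)) ^ n)"
      proof -
        have 1: "norm (\<Sum>k<K. Rk t k * (t * q ^ k) powi (- int n)) \<le>
            (\<Sum>k<K. norm (Rk t k) * norm (1 / (t * q ^ k)) ^ n)"
          by (intro order_trans[OF norm_sum] sum_mono)
            (simp add: norm_mult norm_power power_int_minus norm_inverse norm_divide divide_inverse power_inverse power_mult_distrib)
        \<comment> \<open>The reflection reduces the asymptotics at -infinity to those at +infinity;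
          the factor q^n raises t q^k to t q^(k+1).\<close>
        have "cc t (- int n) - (\<Sum>k<L. Rk t k * (t * q ^ Suc k) ^ n) =
            q ^ n * (cc t (int n) - (\<Sum>k<L. Rk t k * (t * q ^ k) ^ n))"
          unfolding cc_uminus by (simp add: right_diff_distrib sum_distrib_left power_mult_distrib mult_ac)
        then have "norm (cc t (- int n) - (\<Sum>k<L. Rk t k * (t * q ^ Suc k) ^ n)) \<le>
            norm q ^ n * (D * norm (t * q ^ L) ^ n)"
          using D(2)[of n] by (simp add: norm_mult norm_power mult_left_mono)
        also have "\<dots> = D * norm (t * q ^ Suc L) ^ n"
          by (simp add: norm_mult norm_power power_mult_distrib mult_ac)
        finally have 2: "norm (cc t (- int n) - (\<Sum>k<L. Rk t k * (t * q ^ Suc k) ^ n)) \<le> D * norm (t * q ^ Suc L) ^ n" .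
        have "UU K L t (- int n) = (cc t (- int n) - (\<Sum>k<L. Rk t k * (t * q ^ Suc k) ^ n)) -
            (\<Sum>k<K. Rk t k * (t * q ^ k) powi (- int n))"
          by (simp add: UU_def)
        then show ?thesis using 1 2 norm_triangle_ineq4 by (smt (verit))
      qed
      then have "norm (UU K L t (- int n)) * (1 / norm p) ^ n \<le> (D * norm (t * q ^ Suc L) ^ n +
          (\<Sum>k<K. norm (Rk t k) * norm (1 / (t * q ^ k)) ^ n)) * (1 / norm p) ^ n"
        by (intro mult_right_mono) auto
      also have "\<dots> = c n"
        unfolding c_def by (simp add: add_divide_distrib sum_divide_distrib norm_mult norm_divide power_mult_distrib power_divide)
      finally show ?thesis
        by (simp add: norm_mult norm_power power_int_minus norm_inverse power_one_over divide_inverse power_inverse)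
    qed
    ultimately show "summable (\<lambda>n. norm (UU K L t (- int n) * p powi (- int n)))"
      by (rule_tac summable_comparison_test'[of c 0]) auto
  qed
  then obtain S where S: "((\<lambda>n. UU K L t n * p powi n) has_sum S) UNIV"
    by (auto simp: summable_on_def)
  then have "S = dl t p" using regsum_unique[OF regsum_has_sum reg] by blast
  then show ?thesis using S by simp
qed

end


section \<open>Mean values over the unit circle\<close>

text \<open>While y runs along \<open>Ppath a\<close>, the point q^y runs once round the unit circle
  at constant speed; this is the mean of g over that circle.\<close>

definition cmean :: "real \<Rightarrow> (complex \<Rightarrow> complex) \<Rightarrow> complex" where
  "cmean a g = contour_integral (Ppath a) (\<lambda>y. g (qpar a powr y)) / (2 * of_real pi * \<i> * of_real a)"

locale qcircle =
  fixes a :: real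
  assumes a_pos: "a > 0"
begin

lemma qpar_powr: "qpar a powr y = exp (- y / of_real a)"
proof -
  have "Ln (qpar a) = of_real (- 1 / a)"
    unfolding qpar_def by (subst Ln_of_real) auto
  then show ?thesis by (simp add: powr_def qpar_def)
qed

sublocale qbase "qpar a"
  by unfold_locales (use a_pos in \<open>auto simp: qpar_def norm_divide\<close>)

lemma Ppath_norm:
  assumes "y \<in> path_image (Ppath a)"
  shows "norm (qpar a powr y) = 1"
proof -
  obtain u where "y = (1 - u) *\<^sub>R (- (\<i> * of_real (pi * a))) + u *\<^sub>R (\<i> * of_real (pi * a))"
    using assms by (auto simp: Ppath_def closed_segment_def)
  then have "Re (- y / of_real a) = 0" by (simp add: Re_divide_of_real)
  then show ?thesis by (simp add: qpar_powr)
qed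

lemma contour_integrable_Ppath:
  assumes "continuous_on (sphere 0 1) g"
  shows "(\<lambda>y. g (qpar a powr y)) contour_integrable_on (Ppath a)"
proof -
  have "continuous_on (path_image (Ppath a)) (\<lambda>y. g (qpar a powr y))"
  proof (rule continuous_on_compose2[OF assms])
    show "continuous_on (path_image (Ppath a)) ((powr) (qpar a))"
      unfolding qpar_powr by (intro continuous_intros) (use a_pos in auto)
    show "(powr) (qpar a) ` path_image (Ppath a) \<subseteq> sphere 0 1"
      using Ppath_norm by auto
  qed
  then show ?thesis unfolding Ppath_def
    by (intro contour_integrable_continuous_linepath) simp
qed

lemma contour_integral_cmean:
  "contour_integral (Ppath a) (\<lambda>y. g (qpar a powr y)) = 2 * of_real pi * \<i> * of_real a * cmean a g"
  using a_pos by (simp add: cmean_def)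

lemma contour_integral_Ppath_cong:
  assumes "\<And>y. norm (qpar a powr y) = 1 \<Longrightarrow> f y = g y"
  shows "contour_integral (Ppath a) f = contour_integral (Ppath a) g"
  by (rule contour_integral_eq) (use assms Ppath_norm in auto)

lemma cmean_cong:
  assumes "\<And>Z. norm Z = 1 \<Longrightarrow> g Z = h Z"
  shows "cmean a g = cmean a h"
  unfolding cmean_def by (intro arg_cong2[where f = "(/)"] contour_integral_Ppath_cong assms refl)

lemma cmean_powi: "cmean a (\<lambda>Z. Z powi n) = (if n = 0 then 1 else 0)"
proof (cases "n = 0")
  case True
  then show ?thesis using a_pos by (simp add: cmean_def Ppath_def)
next
  case False
  define F where "F = (\<lambda>y. - of_real a / of_int n * exp (- of_int n * y / complex_of_real a))"
  have "((\<lambda>y. exp (- of_int n * y / of_real a)) has_contour_integral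
      (F (pathfinish (Ppath a)) - F (pathstart (Ppath a)))) (Ppath a)"
  proof (rule contour_integral_primitive[of UNIV])
    show "(F has_field_derivative exp (- of_int n * x / of_real a)) (at x within UNIV)" for x
      unfolding F_def by (rule derivative_eq_intros refl | use a_pos False in simp)+
  qed (auto simp: Ppath_def)
  moreover have "F (pathfinish (Ppath a)) = F (pathstart (Ppath a))"
  proof -
    have "exp (- (\<i> * of_real pi * of_int n)) = exp (\<i> * of_real pi * of_int n)"
      unfolding exp_eq by (intro exI[of _ "- n"]) (simp add: algebra_simps)
    then show ?thesis using a_pos by (simp add: F_def Ppath_def mult_ac)
  qed
  ultimately have "((\<lambda>y. exp (- of_int n * y / of_real a)) has_contour_integral 0) (Ppath a)"
    by simp
  moreover have "exp (- of_int n * y / of_real a) = (qpar a powr y) powi n" for y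
    unfolding qpar_powr by (simp add: exp_power_int)
  ultimately have "((\<lambda>y. (qpar a powr y) powi n) has_contour_integral 0) (Ppath a)"
    by (simp only:)
  then show ?thesis using False by (simp add: cmean_def contour_integral_unique)
qed

lemma cmean_add:
  assumes "continuous_on (sphere 0 1) g" "continuous_on (sphere 0 1) h"
  shows "cmean a (\<lambda>Z. g Z + h Z) = cmean a g + cmean a h"
  unfolding cmean_def
  by (simp add: contour_integral_add contour_integrable_Ppath assms add_divide_distrib)

lemma cmean_sum:
  assumes "\<And>i. i \<in> I \<Longrightarrow> continuous_on (sphere 0 1) (g i)"
  shows "cmean a (\<lambda>Z. \<Sum>i\<in>I. g i Z) = (\<Sum>i\<in>I. cmean a (g i))"
  using assms
proof (induction I rule: infinite_finite_induct)
  case (insert i I)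
  then show ?case by (simp add: cmean_add continuous_on_sum)
qed (simp_all add: cmean_def)

lemma cmean_cmult:
  assumes "continuous_on (sphere 0 1) g"
  shows "cmean a (\<lambda>Z. c * g Z) = c * cmean a g"
  using contour_integral_lmul[OF contour_integrable_Ppath[OF assms], of c] by (simp add: cmean_def)

lemma cmean_uniform_limit:
  assumes "eventually (\<lambda>n. continuous_on (sphere 0 1) (f n)) F"
    and ul: "uniform_limit (sphere 0 1) f g F" and F: "F \<noteq> bot"
  shows "((\<lambda>n. cmean a (f n)) \<longlongrightarrow> cmean a g) F"
proof -
  have "((\<lambda>n. contour_integral (Ppath a) (\<lambda>y. f n (qpar a powr y))) \<longlongrightarrow>
      contour_integral (Ppath a) (\<lambda>y. g (qpar a powr y))) F"
  proof (rule contour_integral_uniform_limit(2))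
    show "\<forall>\<^sub>F n in F. (\<lambda>y. f n (qpar a powr y)) contour_integrable_on Ppath a"
      using assms(1) by (rule eventually_mono) (rule contour_integrable_Ppath)
    show "uniform_limit (path_image (Ppath a)) (\<lambda>n y. f n (qpar a powr y)) (\<lambda>y. g (qpar a powr y)) F"
      by (rule uniform_limit_compose'[OF ul]) (use Ppath_norm in auto)
    show "norm (vector_derivative (Ppath a) (at t)) \<le> norm (\<i> * of_real (pi * a) - - (\<i> * of_real (pi * a)))"
      if "t \<in> {0..1}" for t
      unfolding Ppath_def vector_derivative_linepath_at ..
  qed (use F in \<open>auto simp: Ppath_def\<close>)
  then show ?thesis unfolding cmean_def
    by (intro tendsto_divide tendsto_const) (use a_pos in auto)
qed

text \<open>Absolute summability gives uniform convergence on the unit circle. The index set and the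
  exponents are arbitrary, because this is needed both for Laurent series and for sums over families
  of affine roots.\<close>

lemma cmean_infsum:
  fixes A :: "'b \<Rightarrow> complex" and \<nu> :: "'b \<Rightarrow> int"
  assumes A: "(\<lambda>e. norm (A e)) summable_on E" and h: "continuous_on (sphere 0 1) h"
  shows "((\<lambda>e. A e * cmean a (\<lambda>Z. h Z * Z powi \<nu> e)) has_sum
      cmean a (\<lambda>Z. h Z * (\<Sum>\<^sub>\<infinity>e\<in>E. A e * Z powi \<nu> e))) E"
    and "continuous_on (sphere 0 1) (\<lambda>Z. \<Sum>\<^sub>\<infinity>e\<in>E. A e * Z powi \<nu> e)"
proof -
  have pw: "continuous_on (sphere 0 1) (\<lambda>Z::complex. Z powi n)" for n
    by (intro continuous_intros) auto
  have ul0: "uniform_limit (sphere 0 1) (\<lambda>X Z. \<Sum>e\<in>X. A e * Z powi \<nu> e)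
      (\<lambda>Z. \<Sum>\<^sub>\<infinity>e\<in>E. A e * Z powi \<nu> e) (finite_subsets_at_top E)"
    by (rule Weierstrass_m_test_general[OF _ A]) (auto simp: norm_mult norm_power_int)
  show cont: "continuous_on (sphere 0 1) (\<lambda>Z. \<Sum>\<^sub>\<infinity>e\<in>E. A e * Z powi \<nu> e)"
    by (rule uniform_limit_theorem[OF _ ul0])
       (auto intro!: always_eventually continuous_intros pw)
  have bdd: "bounded (h ` sphere 0 1)"
    by (intro compact_imp_bounded compact_continuous_image h compact_sphere)
  have bdd2: "bounded ((\<lambda>Z. \<Sum>\<^sub>\<infinity>e\<in>E. A e * Z powi \<nu> e) ` sphere 0 1)"
    by (intro compact_imp_bounded compact_continuous_image cont compact_sphere)
  have "uniform_limit (sphere 0 1) (\<lambda>X Z. h Z * (\<Sum>e\<in>X. A e * Z powi \<nu> e))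
      (\<lambda>Z. h Z * (\<Sum>\<^sub>\<infinity>e\<in>E. A e * Z powi \<nu> e)) (finite_subsets_at_top E)"
    by (rule uniform_lim_mult[OF uniform_limit_const ul0 bdd bdd2])
  then have "((\<lambda>X. cmean a (\<lambda>Z. h Z * (\<Sum>e\<in>X. A e * Z powi \<nu> e))) \<longlongrightarrow>
      cmean a (\<lambda>Z. h Z * (\<Sum>\<^sub>\<infinity>e\<in>E. A e * Z powi \<nu> e))) (finite_subsets_at_top E)"
    by (intro cmean_uniform_limit) (auto intro!: always_eventually continuous_intros pw h)
  moreover have "cmean a (\<lambda>Z. h Z * (\<Sum>e\<in>X. A e * Z powi \<nu> e)) =
      (\<Sum>e\<in>X. A e * cmean a (\<lambda>Z. h Z * Z powi \<nu> e))" for X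
  proof -
    have "cmean a (\<lambda>Z. h Z * (\<Sum>e\<in>X. A e * Z powi \<nu> e)) =
        cmean a (\<lambda>Z. \<Sum>e\<in>X. A e * (h Z * Z powi \<nu> e))"
      by (simp add: sum_distrib_left mult_ac)
    also have "\<dots> = (\<Sum>e\<in>X. cmean a (\<lambda>Z. A e * (h Z * Z powi \<nu> e)))"
      by (intro cmean_sum continuous_on_mult continuous_on_const h pw)
    also have "\<dots> = (\<Sum>e\<in>X. A e * cmean a (\<lambda>Z. h Z * Z powi \<nu> e))"
      by (intro sum.cong refl cmean_cmult continuous_on_mult h pw)
    finally show ?thesis .
  qed
  ultimately show "((\<lambda>e. A e * cmean a (\<lambda>Z. h Z * Z powi \<nu> e)) has_sum
      cmean a (\<lambda>Z. h Z * (\<Sum>\<^sub>\<infinity>e\<in>E. A e * Z powi \<nu> e))) E"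
    by (simp add: has_sum_def)
qed

text \<open>The convolution theorem for Laurent series on the unit circle: the means of Z^(-j) g Z^n
  recover the coefficients A (j - n), against which the series of h is integrated.\<close>

lemma cmean_product:
  assumes A: "\<And>Z. norm Z = 1 \<Longrightarrow> ((\<lambda>n. A n * Z powi n) has_sum g Z) UNIV"
    and B: "\<And>Z. norm Z = 1 \<Longrightarrow> ((\<lambda>n. B n * Z powi n) has_sum h Z) UNIV"
  shows "((\<lambda>n. A (j - n) * B n) has_sum cmean a (\<lambda>Z. Z powi (- j) * (g Z * h Z))) UNIV"
    and "continuous_on (sphere 0 1) g" and "(\<lambda>n. norm (A n)) summable_on UNIV"
proof -
  have summ: "(\<lambda>n. norm (C n)) summable_on UNIV"
    if "\<And>Z. norm Z = 1 \<Longrightarrow> ((\<lambda>n. C n * Z powi n) has_sum k Z) UNIV" for C :: "int \<Rightarrow> complex" and k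
  proof -
    \<comment> \<open>At Z = 1 the series is a plain unordered sum, and for complex numbers
      unordered summability is already absolute.\<close>
    have "C summable_on UNIV" using that[of 1] by (auto simp: summable_on_def)
    then show ?thesis by (simp only: summable_on_iff_abs_summable_on_complex)
  qed
  have sA: "(\<lambda>n. norm (A n)) summable_on UNIV" by (rule summ) (rule A)
  have sB: "(\<lambda>n. norm (B n)) summable_on UNIV" by (rule summ) (rule B)
  show "(\<lambda>n. norm (A n)) summable_on UNIV" by (rule sA)
  have gZ: "g Z = (\<Sum>\<^sub>\<infinity>n. A n * Z powi n)" and hZ: "h Z = (\<Sum>\<^sub>\<infinity>n. B n * Z powi n)"
    if "norm Z = 1" for Z
    using A[OF that] B[OF that] by (simp_all add: infsumI)
  have pw: "continuous_on (sphere 0 1) (\<lambda>Z::complex. Z powi n)" for n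
    by (intro continuous_intros) auto
  show cg: "continuous_on (sphere 0 1) g"
    using cmean_infsum(2)[OF sA pw, of "\<lambda>n. n"] by (rule continuous_on_eq) (auto simp: gZ)
  have coeff: "cmean a (\<lambda>Z. Z powi (- j) * g Z * Z powi n) = A (j - n)" for n
  proof -
    have "((\<lambda>m. A m * cmean a (\<lambda>Z. Z powi (n - j) * Z powi m)) has_sum
      cmean a (\<lambda>Z. Z powi (n - j) * (\<Sum>\<^sub>\<infinity>m. A m * Z powi m))) UNIV"
      by (rule cmean_infsum(1)[OF sA pw])
    also have "cmean a (\<lambda>Z. Z powi (n - j) * (\<Sum>\<^sub>\<infinity>m. A m * Z powi m)) =
        cmean a (\<lambda>Z. Z powi (- j) * g Z * Z powi n)"
    proof (rule cmean_cong)
      fix Z :: complex assume Z: "norm Z = 1"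
      then have "Z \<noteq> 0" by auto
      then show "Z powi (n - j) * (\<Sum>\<^sub>\<infinity>m. A m * Z powi m) = Z powi (- j) * g Z * Z powi n"
        by (simp add: gZ[OF Z] power_int_diff power_int_minus divide_inverse mult_ac)
    qed
    also have "(\<lambda>m. A m * cmean a (\<lambda>Z. Z powi (n - j) * Z powi m)) =
        (\<lambda>m. if m = j - n then A m else 0)"
    proof
      fix m
      have "cmean a (\<lambda>Z. Z powi (n - j) * Z powi m) = cmean a (\<lambda>Z. Z powi (n - j + m))"
        by (rule cmean_cong, subst power_int_add) auto
      then show "A m * cmean a (\<lambda>Z. Z powi (n - j) * Z powi m) = (if m = j - n then A m else 0)"
        by (auto simp: cmean_powi)
    qed
    finally have "((\<lambda>m. if m = j - n then A m else 0) has_sum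
        cmean a (\<lambda>Z. Z powi (- j) * g Z * Z powi n)) UNIV" .
    moreover have "((\<lambda>m. if m = j - n then A m else 0) has_sum A (j - n)) UNIV"
      by (rule has_sum_finite_neutralI[of "{j - n}"]) (auto split: if_splits)
    ultimately show ?thesis using has_sum_unique by blast
  qed
  have "((\<lambda>n. B n * cmean a (\<lambda>Z. Z powi (- j) * g Z * Z powi n)) has_sum
      cmean a (\<lambda>Z. Z powi (- j) * g Z * (\<Sum>\<^sub>\<infinity>n. B n * Z powi n))) UNIV"
    by (rule cmean_infsum(1)[OF sB continuous_on_mult[OF pw cg]])
  also have "cmean a (\<lambda>Z. Z powi (- j) * g Z * (\<Sum>\<^sub>\<infinity>n. B n * Z powi n)) =
      cmean a (\<lambda>Z. Z powi (- j) * (g Z * h Z))"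
    by (rule cmean_cong) (simp add: hZ mult_ac)
  finally show "((\<lambda>n. A (j - n) * B n) has_sum cmean a (\<lambda>Z. Z powi (- j) * (g Z * h Z))) UNIV"
    unfolding coeff by (simp only: mult.commute)
qed

text \<open>The term of index s in the factor belonging to X Y contributes s to both exponents, so
  the factors of X and of Y have to supply i - s and j - s. The inner mean is one convolution, the
  outer mean a second one.\<close>

lemma cmean_cmean_mu:
  assumes A: "\<And>Z. norm Z = 1 \<Longrightarrow> ((\<lambda>n. A n * Z powi n) has_sum dl t Z) UNIV"
  shows "((\<lambda>s. A (j - s) * (A (i - s) * A s)) has_sum
     cmean a (\<lambda>Y. cmean a (\<lambda>X. X powi (- i) * Y powi (- j) * mu (qpar a) t X Y))) UNIV"
    and "continuous_on (sphere 0 1) (\<lambda>Y. cmean a (\<lambda>X. X powi (- i) * Y powi (- j) * mu (qpar a) t X Y))"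
    and "norm Y = 1 \<Longrightarrow> continuous_on (sphere 0 1) (\<lambda>X. X powi (- i) * Y powi (- j) * mu (qpar a) t X Y)"
proof -
  define k where "k = (\<lambda>Y. cmean a (\<lambda>X. X powi (- i) * (dl t X * dl t (X * Y))))"
  have pw: "continuous_on (sphere 0 1) (\<lambda>Z::complex. Z powi n)" for n
    by (intro continuous_intros) auto
  have BY: "((\<lambda>n. A n * Y powi n * Z powi n) has_sum dl t (Z * Y)) UNIV" if "norm Y = 1" "norm Z = 1" for Y Z
    using A[of "Z * Y"] that by (simp add: norm_mult power_int_mult_distrib mult_ac)
  have cg: "continuous_on (sphere 0 1) (dl t)" by (rule cmean_product(2)[OF A A])
  have cgY: "continuous_on (sphere 0 1) (\<lambda>Z. dl t (Z * Y))" if "norm Y = 1" for Y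
    by (rule cmean_product(2)[OF BY[OF that] A])
  have k: "((\<lambda>s. A (i - s) * A s * Y powi s) has_sum k Y) UNIV" if "norm Y = 1" for Y
    using cmean_product(1)[OF A BY[OF that], of i] by (simp add: k_def mult_ac)
  have ck: "continuous_on (sphere 0 1) k" by (rule cmean_product(2)[OF k A])
  have inner: "cmean a (\<lambda>X. X powi (- i) * Y powi (- j) * mu (qpar a) t X Y) =
      Y powi (- j) * (dl t Y * k Y)" if "norm Y = 1" for Y
  proof -
    have "cmean a (\<lambda>X. X powi (- i) * Y powi (- j) * mu (qpar a) t X Y) =
        cmean a (\<lambda>X. (Y powi (- j) * dl t Y) * (X powi (- i) * (dl t X * dl t (X * Y))))"
      by (rule cmean_cong) (simp add: mu_def mu_factor_eq mult_ac)
    also have "\<dots> = (Y powi (- j) * dl t Y) * k Y"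
      unfolding k_def by (intro cmean_cmult continuous_on_mult pw cg cgY that)
    finally show ?thesis by (simp add: mult_ac)
  qed
  show "((\<lambda>s. A (j - s) * (A (i - s) * A s)) has_sum
     cmean a (\<lambda>Y. cmean a (\<lambda>X. X powi (- i) * Y powi (- j) * mu (qpar a) t X Y))) UNIV"
    using cmean_product(1)[OF A k, of j] cmean_cong[OF inner] by simp
  have "continuous_on (sphere 0 1) (\<lambda>Y. Y powi (- j) * (dl t Y * k Y))"
    by (intro continuous_on_mult pw cg ck)
  then show "continuous_on (sphere 0 1) (\<lambda>Y. cmean a (\<lambda>X. X powi (- i) * Y powi (- j) * mu (qpar a) t X Y))"
    by (rule continuous_on_eq) (simp add: inner)
  show "continuous_on (sphere 0 1) (\<lambda>X. X powi (- i) * Y powi (- j) * mu (qpar a) t X Y)" if "norm Y = 1"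
    unfolding mu_def mu_factor_eq by (intro continuous_on_mult continuous_on_const pw cg cgY that)
qed

end


section \<open>The constant term series as a Fourier coefficient\<close>

definition fam_prod :: "('r \<Rightarrow> nat \<Rightarrow> 'c) \<Rightarrow> ('r \<Rightarrow>\<^sub>0 nat) \<Rightarrow> 'c::comm_monoid_mult" where
  "fam_prod F e = (\<Prod>r\<in>Poly_Mapping.keys e. F r (Poly_Mapping.lookup e r))"

lemma keys_subset_iff: "Poly_Mapping.keys e \<subseteq> B \<longleftrightarrow> (\<forall>s. s \<notin> B \<longrightarrow> Poly_Mapping.lookup e s = 0)"
  by (metis in_keys_iff subset_iff)

lemma fam_prod_superset:
  assumes "finite B" "Poly_Mapping.keys e \<subseteq> B" "\<And>r. r \<in> B \<Longrightarrow> F r 0 = 1"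
  shows "fam_prod F e = (\<Prod>r\<in>B. F r (Poly_Mapping.lookup e r))"
  unfolding fam_prod_def using assms
  by (intro prod.mono_neutral_left) (auto simp: in_keys_iff)

text \<open>Multiplying out one factor at a time. The scalar type is left general because absolute
  convergence is later obtained from the same expansion with the real factors
  \<open>norm (F r n)\<close>.\<close>

lemma fam_prod_has_sum_finite:
  fixes F :: "'r \<Rightarrow> nat \<Rightarrow> 'c::{real_normed_field, banach}"
  assumes "finite B" "\<And>r. r \<in> B \<Longrightarrow> F r 0 = 1" "\<And>r. r \<in> B \<Longrightarrow> (\<lambda>n. norm (F r n)) summable_on UNIV"
  shows "(\<lambda>e. norm (fam_prod F e)) summable_on {e. Poly_Mapping.keys e \<subseteq> B} \<and>
     (fam_prod F has_sum (\<Prod>r\<in>B. \<Sum>\<^sub>\<infinity>n. F r n)) {e. Poly_Mapping.keys e \<subseteq> B}"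
  using assms
proof (induction B rule: finite_induct)
  case empty
  have "{e :: 'r \<Rightarrow>\<^sub>0 nat. Poly_Mapping.keys e \<subseteq> {}} = {0}" by auto
  then show ?case by (auto simp: fam_prod_def intro!: has_sum_finiteI)
next
  case (insert r B)
  define E where "E = {e :: 'r \<Rightarrow>\<^sub>0 nat. Poly_Mapping.keys e \<subseteq> B}"
  have IH: "(\<lambda>e. norm (fam_prod F e)) summable_on E" "(fam_prod F has_sum (\<Prod>r\<in>B. \<Sum>\<^sub>\<infinity>n. F r n)) E"
    using insert by (auto simp: E_def)
  \<comment> \<open>A family on \<open>insert r B\<close> is a family on \<open>B\<close> together
    with the exponent at r. \<open>Poly_Mapping.update\<close> sets this exponent, and setting it to
    0 is the way back.\<close>
  define T where "T = (\<lambda>(e :: 'r \<Rightarrow>\<^sub>0 nat, n :: nat). Poly_Mapping.update r n e)"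
  have bij: "bij_betw T (E \<times> UNIV) {e. Poly_Mapping.keys e \<subseteq> insert r B}"
  proof (rule bij_betwI[where g = "\<lambda>e. (Poly_Mapping.update r 0 e, Poly_Mapping.lookup e r)"])
    show "T \<in> E \<times> UNIV \<rightarrow> {e. Poly_Mapping.keys e \<subseteq> insert r B}"
      by (auto simp: T_def E_def keys_subset_iff lookup_update)
    show "(\<lambda>e. (Poly_Mapping.update r 0 e, Poly_Mapping.lookup e r)) \<in>
        {e. Poly_Mapping.keys e \<subseteq> insert r B} \<rightarrow> E \<times> UNIV"
      by (auto simp: E_def keys_subset_iff lookup_update)
    show "(Poly_Mapping.update r 0 (T x), Poly_Mapping.lookup (T x) r) = x" if x: "x \<in> E \<times> UNIV" for x
    proof -
      have "Poly_Mapping.lookup (fst x) r = 0"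
        using x insert.hyps(2) by (auto simp: E_def keys_subset_iff)
      then have "Poly_Mapping.update r 0 (T x) = fst x"
        by (intro poly_mapping_eqI) (auto simp: T_def lookup_update split: prod.splits)
      then show ?thesis by (auto simp: T_def lookup_update split: prod.splits)
    qed
    show "T (Poly_Mapping.update r 0 y, Poly_Mapping.lookup y r) = y" for y
      by (auto simp: T_def lookup_update intro!: poly_mapping_eqI)
  qed
  have T: "fam_prod F (T (e, n)) = fam_prod F e * F r n" if "e \<in> E" for e n
  proof -
    have "fam_prod F (T (e, n)) = (\<Prod>s\<in>insert r B. F s (Poly_Mapping.lookup (T (e, n)) s))"
      using insert that by (intro fam_prod_superset)
        (auto simp: T_def E_def keys_subset_iff lookup_update)
    also have "\<dots> = F r n * (\<Prod>s\<in>B. F s (Poly_Mapping.lookup (T (e, n)) s))"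
      using insert.hyps by (simp add: T_def lookup_update)
    also have "(\<Prod>s\<in>B. F s (Poly_Mapping.lookup (T (e, n)) s)) = (\<Prod>s\<in>B. F s (Poly_Mapping.lookup e s))"
      using insert.hyps by (intro prod.cong) (auto simp: T_def lookup_update)
    also have "\<dots> = fam_prod F e"
      using insert that by (intro fam_prod_superset[symmetric]) (auto simp: E_def)
    finally show ?thesis by (simp add: mult.commute)
  qed
  have nr: "(\<lambda>n. norm (F r n)) summable_on UNIV" using insert.prems by simp
  have abs: "(\<lambda>x. norm (fam_prod F (T x))) summable_on (E \<times> UNIV)"
  proof (subst Infinite_Sum.abs_summable_on_Sigma_iff, intro conjI ballI)
    fix e assume "e \<in> E"
    then show "(\<lambda>n. norm (fam_prod F (T (e, n)))) summable_on UNIV"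
      by (simp add: T norm_mult summable_on_cmult_right nr)
  next
    have "(\<lambda>e. norm (\<Sum>\<^sub>\<infinity>n. norm (fam_prod F (T (e, n))))) summable_on E \<longleftrightarrow>
      (\<lambda>e. norm (fam_prod F e) * (\<Sum>\<^sub>\<infinity>n. norm (F r n))) summable_on E"
    proof (rule summable_on_cong)
      fix e assume "e \<in> E"
      then show "norm (\<Sum>\<^sub>\<infinity>n. norm (fam_prod F (T (e, n)))) = norm (fam_prod F e) * (\<Sum>\<^sub>\<infinity>n. norm (F r n))"
        by (simp add: T norm_mult infsum_cmult_right' infsum_nonneg)
    qed
    then show "(\<lambda>e. norm (\<Sum>\<^sub>\<infinity>n. norm (fam_prod F (T (e, n))))) summable_on E"
      using IH(1) by (simp add: summable_on_cmult_left)
  qed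
  have "((\<lambda>x. fam_prod F (T x)) has_sum (\<Prod>r\<in>B. \<Sum>\<^sub>\<infinity>n. F r n) * (\<Sum>\<^sub>\<infinity>n. F r n)) (E \<times> UNIV)"
  proof (rule has_sum_SigmaI)
    fix e assume "e \<in> E"
    then show "((\<lambda>n. fam_prod F (T (e, n))) has_sum fam_prod F e * (\<Sum>\<^sub>\<infinity>n. F r n)) UNIV"
      unfolding T[OF \<open>e \<in> E\<close>]
      by (intro has_sum_cmult_right has_sum_infsum abs_summable_summable[OF nr])
  next
    show "((\<lambda>e. fam_prod F e * (\<Sum>\<^sub>\<infinity>n. F r n)) has_sum (\<Prod>r\<in>B. \<Sum>\<^sub>\<infinity>n. F r n) * (\<Sum>\<^sub>\<infinity>n. F r n)) E"
      by (rule has_sum_cmult_left[OF IH(2)])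
    show "(\<lambda>x. fam_prod F (T x)) summable_on (E \<times> UNIV)"
      by (rule abs_summable_summable[OF abs])
  qed
  then have "(fam_prod F has_sum (\<Prod>r\<in>insert r B. \<Sum>\<^sub>\<infinity>n. F r n)) {e. Poly_Mapping.keys e \<subseteq> insert r B}"
    using has_sum_reindex_bij_betw[OF bij, of "fam_prod F"] insert.hyps by (simp add: mult.commute)
  moreover have "(\<lambda>e. norm (fam_prod F e)) summable_on {e. Poly_Mapping.keys e \<subseteq> insert r B}"
    using summable_on_reindex_bij_betw[OF bij, of "\<lambda>e. norm (fam_prod F e)"] abs by simp
  ultimately show ?case by blast
qed

text \<open>A finite set of families involves finitely many indices, so it lies in some
  \<open>E N\<close> and its norms add up to at most K. Being absolutely summable, the sum over all
  families is the limit of the finite products.\<close>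

lemma fam_prod_limit:
  fixes F :: "'r \<Rightarrow> nat \<Rightarrow> complex"
  assumes fin: "\<And>N. finite (B N)" and inc: "incseq B" and A: "(\<Union>N. B N) = A"
    and F0: "\<And>r. r \<in> A \<Longrightarrow> F r 0 = 1" and Fs: "\<And>r. r \<in> A \<Longrightarrow> (\<lambda>n. norm (F r n)) summable_on UNIV"
    and K: "\<And>N. (\<Prod>r\<in>B N. \<Sum>\<^sub>\<infinity>n. norm (F r n)) \<le> K"
  shows "(\<lambda>e. norm (fam_prod F e)) summable_on {e. Poly_Mapping.keys e \<subseteq> A}"
    and "(\<lambda>N. \<Prod>r\<in>B N. \<Sum>\<^sub>\<infinity>n. F r n) \<longlonglongrightarrow> (\<Sum>\<^sub>\<infinity>e\<in>{e. Poly_Mapping.keys e \<subseteq> A}. fam_prod F e)"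
proof -
  define E where "E = (\<lambda>N. {e :: 'r \<Rightarrow>\<^sub>0 nat. Poly_Mapping.keys e \<subseteq> B N})"
  define EA where "EA = {e :: 'r \<Rightarrow>\<^sub>0 nat. Poly_Mapping.keys e \<subseteq> A}"
  have EN: "E N \<subseteq> EA" for N using A by (auto simp: E_def EA_def)
  have mono: "E M \<subseteq> E N" if "M \<le> N" for M N
    using inc that by (auto simp: E_def incseq_def)
  have ex1: "\<exists>N. Z \<subseteq> B N" if "finite Z" "Z \<subseteq> A" for Z
    using that
  proof (induction Z rule: finite_induct)
    case (insert z Z)
    then obtain N where "Z \<subseteq> B N" by auto
    moreover obtain M where "z \<in> B M" using insert.prems A by auto
    moreover have "B N \<subseteq> B (max M N)" "B M \<subseteq> B (max M N)" using inc by (auto simp: incseq_def)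
    ultimately show ?case by blast
  qed auto
  have ex: "\<exists>N. X \<subseteq> E N" if "finite X" "X \<subseteq> EA" for X
  proof -
    have "\<exists>N. (\<Union>e\<in>X. Poly_Mapping.keys e) \<subseteq> B N"
      using that by (intro ex1) (auto simp: EA_def)
    then show ?thesis by (auto simp: E_def)
  qed
  have F0': "F r 0 = 1" "(\<lambda>n. norm (F r n)) summable_on UNIV" if "r \<in> B N" for r N
    using that A F0[of r] Fs[of r] by auto
  have fs: "(fam_prod F has_sum (\<Prod>r\<in>B N. \<Sum>\<^sub>\<infinity>n. F r n)) (E N)" for N
    unfolding E_def by (intro conjunct2[OF fam_prod_has_sum_finite] fin) (auto intro: F0')
  have ns: "((\<lambda>e. norm (fam_prod F e)) has_sum (\<Prod>r\<in>B N. \<Sum>\<^sub>\<infinity>n. norm (F r n))) (E N)" for N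
  proof -
    have "(fam_prod (\<lambda>r n. norm (F r n)) has_sum (\<Prod>r\<in>B N. \<Sum>\<^sub>\<infinity>n. norm (F r n))) (E N)"
      unfolding E_def by (intro conjunct2[OF fam_prod_has_sum_finite] fin) (auto simp: F0')
    then show ?thesis by (simp add: fam_prod_def[abs_def] prod_norm)
  qed
  have "(\<lambda>e. norm (fam_prod F e)) summable_on EA"
  proof (rule nonneg_bdd_above_summable_on)
    show "bdd_above (sum (\<lambda>e. norm (fam_prod F e)) ` {X. X \<subseteq> EA \<and> finite X})"
    proof (rule bdd_aboveI2)
      fix X assume "X \<in> {X. X \<subseteq> EA \<and> finite X}"
      then have X: "finite X" "X \<subseteq> EA" by auto
      then obtain N where N: "X \<subseteq> E N" using ex by meson
      have "(\<Sum>e\<in>X. norm (fam_prod F e)) \<le> (\<Prod>r\<in>B N. \<Sum>\<^sub>\<infinity>n. norm (F r n))"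
        using N X by (intro finite_sum_le_has_sum[OF ns]) auto
      also note K
      finally show "(\<Sum>e\<in>X. norm (fam_prod F e)) \<le> K" .
    qed
  qed auto
  then show summ: "(\<lambda>e. norm (fam_prod F e)) summable_on {e. Poly_Mapping.keys e \<subseteq> A}"
    by (simp add: EA_def)
  define S where "S = (\<Sum>\<^sub>\<infinity>e\<in>EA. fam_prod F e)"
  have S: "(fam_prod F has_sum S) EA"
    unfolding S_def EA_def by (rule has_sum_infsum, rule abs_summable_summable, rule summ)
  have "(\<lambda>N. \<Prod>r\<in>B N. \<Sum>\<^sub>\<infinity>n. F r n) \<longlonglongrightarrow> S"
  proof (rule metric_LIMSEQ_I)
    fix \<epsilon> :: real assume "\<epsilon> > 0"
    then have "eventually (\<lambda>X. dist (sum (fam_prod F) X) S < \<epsilon> / 2) (finite_subsets_at_top EA)"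
      using S unfolding has_sum_def by (intro tendstoD) auto
    then obtain X0 where X0: "finite X0" "X0 \<subseteq> EA"
      "\<forall>X. finite X \<and> X0 \<subseteq> X \<and> X \<subseteq> EA \<longrightarrow> dist (sum (fam_prod F) X) S < \<epsilon> / 2"
      unfolding eventually_finite_subsets_at_top by (elim exE conjE) (rule that)
    obtain N0 where N0: "X0 \<subseteq> E N0" using ex[OF X0(1,2)] by blast
    have "dist (\<Prod>r\<in>B N. \<Sum>\<^sub>\<infinity>n. F r n) S < \<epsilon>" if "N \<ge> N0" for N
    proof -
      \<comment> \<open>The product over \<open>B N\<close> is itself a limit of finite sums
        containing \<open>X0\<close>, each within \<epsilon>/2 of S; the closed bound passes to the
        limit.\<close>
      have "dist (\<Prod>r\<in>B N. \<Sum>\<^sub>\<infinity>n. F r n) S \<le> \<epsilon> / 2"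
      proof (rule tendsto_upperbound)
        have "(sum (fam_prod F) \<longlongrightarrow> (\<Prod>r\<in>B N. \<Sum>\<^sub>\<infinity>n. F r n)) (finite_subsets_at_top (E N))"
          using fs[of N] unfolding has_sum_def .
        then show "((\<lambda>X. dist (sum (fam_prod F) X) S) \<longlongrightarrow>
            dist (\<Prod>r\<in>B N. \<Sum>\<^sub>\<infinity>n. F r n) S) (finite_subsets_at_top (E N))"
          by (intro tendsto_dist tendsto_const)
        show "\<forall>\<^sub>F X in finite_subsets_at_top (E N). dist (sum (fam_prod F) X) S \<le> \<epsilon> / 2"
          unfolding eventually_finite_subsets_at_top
        proof (intro exI[of _ X0] conjI allI impI)
          show "X0 \<subseteq> E N" using N0 mono[OF that] by blast
          fix X assume X: "finite X \<and> X0 \<subseteq> X \<and> X \<subseteq> E N"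
          then have "X \<subseteq> EA" using EN by blast
          then show "dist (sum (fam_prod F) X) S \<le> \<epsilon> / 2" using X0(3) X by (simp add: less_imp_le)
        qed (rule X0)
      qed simp
      then show ?thesis using \<open>\<epsilon> > 0\<close> by simp
    qed
    then show "\<exists>no. \<forall>n\<ge>no. dist (\<Prod>r\<in>B n. \<Sum>\<^sub>\<infinity>n. F r n) S < \<epsilon>" by blast
  qed
  then show "(\<lambda>N. \<Prod>r\<in>B N. \<Sum>\<^sub>\<infinity>n. F r n) \<longlonglongrightarrow> (\<Sum>\<^sub>\<infinity>e\<in>{e. Poly_Mapping.keys e \<subseteq> A}. fam_prod F e)"
    by (simp add: S_def EA_def)
qed


lemma prod_powi_eq:
  fixes X :: complex
  assumes "X \<noteq> 0" "finite S"
  shows "(\<Prod>r\<in>S. X powi f r) = X powi (\<Sum>r\<in>S. f r)"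
  using assms(2) by (induction S rule: finite_induct) (auto simp: power_int_add assms(1))

lemma factor_coeff_has_sum:
  assumes "norm (t * W) < 1"
  shows "((\<lambda>n. factor_coeff t n * W ^ n) has_sum (1 - W) / (1 - t * W)) UNIV"
    and "(\<lambda>n. norm (factor_coeff t n * W ^ n)) summable_on UNIV"
proof -
  have geo: "(\<lambda>n. (t * W) ^ n) sums (1 / (1 - t * W))" by (rule geometric_sums[OF assms])
  define v where "v = (\<lambda>n. if n = 0 then 0 else W * (t * W) ^ (n - 1))"
  have v_Suc: "(\<lambda>n. v (Suc n)) = (\<lambda>n. W * (t * W) ^ n)" and v0: "v 0 = 0"
    by (simp_all add: v_def)
  have v_sums: "v sums (W * (1 / (1 - t * W)))"
    using sums_Suc[of v "W * (1 / (1 - t * W))"] sums_mult[OF geo, of W] unfolding v_Suc v0 by simp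
  have eq: "factor_coeff t n * W ^ n = (t * W) ^ n - v n" for n
  proof (cases n)
    case (Suc m)
    then show ?thesis by (simp add: v_def factor_coeff_def power_mult_distrib algebra_simps)
  qed (simp add: v_def factor_coeff_def)
  have val: "(1 - W) / (1 - t * W) = 1 / (1 - t * W) - W * (1 / (1 - t * W))"
    by (simp add: diff_divide_distrib)
  have s: "(\<lambda>n. factor_coeff t n * W ^ n) sums ((1 - W) / (1 - t * W))"
    unfolding eq val by (rule sums_diff[OF geo v_sums])
  have ns: "summable (\<lambda>n. norm (factor_coeff t n * W ^ n))"
  proof -
    have g: "summable (\<lambda>n. norm (t * W) ^ n)" by (rule summable_geometric) (simp add: assms)
    moreover have "summable (\<lambda>n. norm (v n))"
    proof -
      have "(\<lambda>n. norm (v (Suc n))) = (\<lambda>n. norm W * norm (t * W) ^ n)"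
        by (simp add: v_def norm_mult norm_power)
      then have "summable (\<lambda>n. norm (v (Suc n)))"
        using summable_mult[OF g, of "norm W"] by (simp only:)
      then show ?thesis using summable_Suc_iff[of "\<lambda>n. norm (v n)"] by blast
    qed
    ultimately have "summable (\<lambda>n. norm (t * W) ^ n + norm (v n))"
      by (rule summable_add)
    moreover have "norm (norm (factor_coeff t n * W ^ n)) \<le> norm (t * W) ^ n + norm (v n)" for n
      unfolding eq using norm_triangle_ineq4[of "(t * W) ^ n" "v n"] by (simp add: norm_power)
    ultimately show ?thesis by (rule summable_comparison_test'[where N = 0])
  qed
  then show "((\<lambda>n. factor_coeff t n * W ^ n) has_sum (1 - W) / (1 - t * W)) UNIV"
    using s by (rule norm_summable_imp_has_sum)
  show "(\<lambda>n. norm (factor_coeff t n * W ^ n)) summable_on UNIV"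
    using ns by (subst summable_on_UNIV_nonneg_real_iff) auto
qed

text \<open>The exponential form lets the product over many roots be bounded through the sum of the
  norms of their monomials.\<close>

lemma factor_coeff_norm_sum:
  assumes "norm t < 1" "norm W \<le> 1"
  shows "(\<Sum>\<^sub>\<infinity>n. norm (factor_coeff t n * W ^ n)) \<le> exp (norm (t - 1) / (1 - norm t) * norm W)"
proof -
  have tW: "norm (t * W) < 1"
    using assms mult_left_mono[of "norm W" 1 "norm t"] by (simp add: norm_mult)
  have s: "summable (\<lambda>n. norm (factor_coeff t n * W ^ n))"
    using factor_coeff_has_sum(2)[OF tW] by (rule summable_on_imp_summable)
  have "(\<Sum>\<^sub>\<infinity>n. norm (factor_coeff t n * W ^ n)) = suminf (\<lambda>n. norm (factor_coeff t n * W ^ n))"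
    using has_sum_imp_sums[OF has_sum_infsum[OF factor_coeff_has_sum(2)[OF tW]]] by (rule sums_unique)
  also have "\<dots> = 1 + suminf (\<lambda>n. norm (factor_coeff t (Suc n) * W ^ Suc n))"
    using suminf_split_head[OF s] by (simp add: factor_coeff_def)
  also have "suminf (\<lambda>n. norm (factor_coeff t (Suc n) * W ^ Suc n)) \<le>
      suminf (\<lambda>n. norm (t - 1) * norm W * norm t ^ n)"
  proof (rule suminf_le)
    fix n
    have "factor_coeff t (Suc n) = t ^ n * (t - 1)" by (simp add: factor_coeff_def algebra_simps)
    then have "norm (factor_coeff t (Suc n) * W ^ Suc n) = norm t ^ n * norm (t - 1) * norm W * norm W ^ n"
      by (simp add: norm_mult norm_power mult_ac)
    also have "\<dots> \<le> norm t ^ n * norm (t - 1) * norm W * 1"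
      using assms by (intro mult_left_mono power_le_one) auto
    finally show "norm (factor_coeff t (Suc n) * W ^ Suc n) \<le> norm (t - 1) * norm W * norm t ^ n"
      by (simp add: mult_ac)
  next
    show "summable (\<lambda>n. norm (factor_coeff t (Suc n) * W ^ Suc n))"
      using s summable_Suc_iff[of "\<lambda>n. norm (factor_coeff t n * W ^ n)"] by blast
    show "summable (\<lambda>n. norm (t - 1) * norm W * norm t ^ n)"
      using assms by (simp add: summable_geometric summable_mult)
  qed
  also have "\<dots> = norm (t - 1) / (1 - norm t) * norm W"
    using assms by (simp add: suminf_mult suminf_geometric summable_geometric)
  also have "1 + \<dots> \<le> exp \<dots>" by (rule exp_ge_add_one_self)
  finally show ?thesis by simp
qed

section \<open>The expansion of mu over the positive affine roots\<close>

context qcircle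
begin

text \<open>N affine roots in each of the six directions. Products over this set are therefore the
  partial products of \<open>mu\<close>, all cut off at the same N.\<close>

definition root_box :: "nat \<Rightarrow> ((int \<times> int) \<times> nat) set" where
  "root_box N = {(1, 0), (0, 1), (1, 1)} \<times> {..<N} \<union> {(-1, 0), (0, -1), (-1, -1)} \<times> {1..N}"

definition mono_factor :: "complex \<Rightarrow> complex \<Rightarrow> complex \<Rightarrow> (int \<times> int) \<times> nat \<Rightarrow> nat \<Rightarrow> complex" where
  "mono_factor t X Y r n = factor_coeff t n *
     (qpar a ^ snd r * (X powi fst (fst r) * Y powi snd (fst r))) ^ n"

definition wt1 :: "((int \<times> int) \<times> nat \<Rightarrow>\<^sub>0 nat) \<Rightarrow> int" where
  "wt1 e = (\<Sum>r\<in>Poly_Mapping.keys e. int (Poly_Mapping.lookup e r) * fst (fst r))"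

definition wt2 :: "((int \<times> int) \<times> nat \<Rightarrow>\<^sub>0 nat) \<Rightarrow> int" where
  "wt2 e = (\<Sum>r\<in>Poly_Mapping.keys e. int (Poly_Mapping.lookup e r) * snd (fst r))"

lemma fam_prod_mono_factor:
  assumes "X \<noteq> 0" "Y \<noteq> 0"
  shows "fam_prod (mono_factor t X Y) e = fam_prod (mono_factor t 1 1) e * X powi wt1 e * Y powi wt2 e"
proof -
  have "mono_factor t X Y r n = mono_factor t 1 1 r n * X powi (int n * fst (fst r)) * Y powi (int n * snd (fst r))" for r n
  proof -
    have pm: "Z powi (int n * m) = (Z powi m) ^ n" for Z :: complex and m
      unfolding mult.commute[of "int n" m] power_int_mult by simp
    show ?thesis unfolding pm mono_factor_def by (simp add: power_mult_distrib)
  qed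
  then show ?thesis
    by (simp add: fam_prod_def wt1_def wt2_def prod.distrib prod_powi_eq assms)
qed

lemma fam_prod_mono_factor_sum:
  assumes t: "norm t < 1" and X: "norm X = 1" and Y: "norm Y = 1"
  shows "(\<lambda>e. norm (fam_prod (mono_factor t X Y) e)) summable_on {e. Poly_Mapping.keys e \<subseteq> pos_affine_roots}"
    and "(\<Sum>\<^sub>\<infinity>e\<in>{e. Poly_Mapping.keys e \<subseteq> pos_affine_roots}. fam_prod (mono_factor t X Y) e) = mu (qpar a) t X Y"
proof -
  define W where "W = (\<lambda>r :: (int \<times> int) \<times> nat. qpar a ^ snd r * (X powi fst (fst r) * Y powi snd (fst r)))"
  have X0: "X \<noteq> 0" "Y \<noteq> 0" using X Y by auto
  have Wn: "norm (W r) = norm (qpar a) ^ snd r" for r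
    by (simp add: W_def norm_mult norm_power norm_power_int X Y)
  have W1: "norm (W r) \<le> 1" for r unfolding Wn using norm_q by (simp add: power_le_one)
  have tW: "norm (t * W r) < 1" for r
    using t W1[of r] mult_left_mono[of "norm (W r)" 1 "norm t"] by (simp add: norm_mult)
  have mf: "mono_factor t X Y r n = factor_coeff t n * W r ^ n" for r n
    by (simp add: mono_factor_def W_def)
  define D where "D = norm (t - 1) / (1 - norm t)"
  have D: "D \<ge> 0" using t by (simp add: D_def)
  have K: "(\<Prod>r\<in>root_box N. \<Sum>\<^sub>\<infinity>n. norm (mono_factor t X Y r n)) \<le> exp (D * (6 / (1 - norm (qpar a))))" for N
  proof -
    have fin: "finite (root_box N)" by (simp add: root_box_def)
    have "(\<Prod>r\<in>root_box N. \<Sum>\<^sub>\<infinity>n. norm (mono_factor t X Y r n)) \<le> (\<Prod>r\<in>root_box N. exp (D * norm (W r)))"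
      unfolding mf D_def by (intro prod_mono conjI infsum_nonneg factor_coeff_norm_sum t W1) auto
    also have "\<dots> = exp (D * (\<Sum>r\<in>root_box N. norm (W r)))"
      by (simp add: exp_sum[OF fin, symmetric] sum_distrib_left)
    \<comment> \<open>On the torus the monomial of a root has norm |q|^s with s its affine part, so
      each of the six directions contributes at most a full geometric series.\<close>
    also have "\<dots> \<le> exp (D * (6 / (1 - norm (qpar a))))"
    proof -
      have g: "(\<Sum>s\<in>T. norm (qpar a) ^ s) \<le> 1 / (1 - norm (qpar a))" if "finite T" for T
        using sum_le_suminf[of "\<lambda>s. norm (qpar a) ^ s" T] norm_q that
        by (simp add: suminf_geometric summable_geometric)
      have c: "(\<Sum>r\<in>V \<times> T. norm (W r)) = of_nat (card V) * (\<Sum>s\<in>T. norm (qpar a) ^ s)" for V T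
        unfolding Wn sum.cartesian_product' by simp
      have "(\<Sum>r\<in>root_box N. norm (W r)) \<le>
          (\<Sum>r\<in>{(1, 0), (0, 1), (1, 1)} \<times> {..<N}. norm (W r)) +
          (\<Sum>r\<in>{(-1, 0), (0, -1), (-1, -1)} \<times> {1..N}. norm (W r))"
        unfolding root_box_def by (subst sum.union_disjoint) auto
      also have "\<dots> \<le> 3 * (1 / (1 - norm (qpar a))) + 3 * (1 / (1 - norm (qpar a)))"
        unfolding c using g[of "{..<N}"] g[of "{1..N}"] by (intro add_mono) auto
      finally have "(\<Sum>r\<in>root_box N. norm (W r)) \<le> 6 / (1 - norm (qpar a))" by simp
      then have "D * (\<Sum>r\<in>root_box N. norm (W r)) \<le> D * (6 / (1 - norm (qpar a)))"
        using D by (rule mult_left_mono)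
      then show ?thesis by (simp only: exp_le_cancel_iff)
    qed
    finally show ?thesis .
  qed
  have inc: "incseq root_box" by (auto simp: incseq_def root_box_def)
  have un: "(\<Union>N. root_box N) = pos_affine_roots"
  proof
    show "pos_affine_roots \<subseteq> (\<Union>N. root_box N)"
    proof
      fix r assume "r \<in> pos_affine_roots"
      then have "r \<in> root_box (Suc (snd r))" by (auto simp: pos_affine_roots_def root_box_def)
      then show "r \<in> (\<Union>N. root_box N)" by blast
    qed
  qed (auto simp: pos_affine_roots_def root_box_def)
  have fin: "finite (root_box N)" for N by (simp add: root_box_def)
  have F0: "mono_factor t X Y r 0 = 1" for r by (simp add: mf factor_coeff_def)
  have Fs: "(\<lambda>n. norm (mono_factor t X Y r n)) summable_on UNIV" for r
    unfolding mf by (rule factor_coeff_has_sum(2)[OF tW])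
  show "(\<lambda>e. norm (fam_prod (mono_factor t X Y) e)) summable_on {e. Poly_Mapping.keys e \<subseteq> pos_affine_roots}"
    by (rule fam_prod_limit(1)[OF fin inc un F0 Fs K])
  have lim1: "(\<lambda>N. \<Prod>r\<in>root_box N. \<Sum>\<^sub>\<infinity>n. mono_factor t X Y r n) \<longlonglongrightarrow>
      (\<Sum>\<^sub>\<infinity>e\<in>{e. Poly_Mapping.keys e \<subseteq> pos_affine_roots}. fam_prod (mono_factor t X Y) e)"
    by (rule fam_prod_limit(2)[OF fin inc un F0 Fs K])
  define G where "G = (\<lambda>W. (1 - W) / (1 - t * W))"
  have sG: "(\<Sum>\<^sub>\<infinity>n. mono_factor t X Y r n) = G (W r)" for r
    unfolding mf G_def by (rule infsumI[OF factor_coeff_has_sum(1)[OF tW]])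
  define P where "P = (\<lambda>N Z. (\<Prod>i<N. G (Z * qpar a ^ i)) * (\<Prod>i<N. G (qpar a / Z * qpar a ^ i)))"
  have "(\<Prod>r\<in>root_box N. G (W r)) = P N X * P N Y * P N (X * Y)" for N
  proof -
    have sh: "(\<Prod>s\<in>{1..N}. h s) = (\<Prod>i<N. h (Suc i))" for h :: "nat \<Rightarrow> complex"
      by (rule prod.reindex_bij_witness[of _ Suc "\<lambda>j. j - 1"]) auto
    have "(\<Prod>r\<in>root_box N. G (W r)) =
        (\<Prod>r\<in>{(1, 0), (0, 1), (1, 1)} \<times> {..<N}. G (W r)) *
        (\<Prod>r\<in>{(-1, 0), (0, -1), (-1, -1)} \<times> {1..N}. G (W r))"
      unfolding root_box_def by (subst prod.union_disjoint) auto
    also have "\<dots> = (\<Prod>v\<in>{(1, 0), (0, 1), (1, 1)}. \<Prod>s<N. G (W (v, s))) *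
        (\<Prod>v\<in>{(-1, 0), (0, -1), (-1, -1)}. \<Prod>s<N. G (W (v, Suc s)))"
      unfolding prod.cartesian_product' sh ..
    also have "\<dots> = P N X * P N Y * P N (X * Y)"
      by (simp add: P_def W_def power_int_minus divide_inverse mult_ac)
    finally show ?thesis .
  qed
  moreover have "(\<lambda>N. P N Z) \<longlonglongrightarrow> dl t Z" if Z: "norm Z = 1" for Z
  proof -
    have lim: "(\<lambda>N. \<Prod>i<N. 1 - z * qpar a ^ i) \<longlonglongrightarrow> ph z" for z
      unfolding ph_def using convergent_prod_LIMSEQ[OF convergent_ph[of "z"]]
      by (simp add: LIMSEQ_lessThan_iff_atMost)
    have nz: "ph (t * Z) \<noteq> 0" "ph (t * qpar a / Z) \<noteq> 0"
      using t Z norm_q mult_strict_mono[of "norm t" 1 "norm (qpar a)" 1]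
      by (auto intro!: ph_nonzero simp: norm_mult norm_divide)
    have "(\<lambda>N. (\<Prod>i<N. 1 - Z * qpar a ^ i) / (\<Prod>i<N. 1 - t * Z * qpar a ^ i) *
        ((\<Prod>i<N. 1 - qpar a / Z * qpar a ^ i) / (\<Prod>i<N. 1 - t * qpar a / Z * qpar a ^ i)))
        \<longlonglongrightarrow> ph Z / ph (t * Z) * (ph (qpar a / Z) / ph (t * qpar a / Z))"
      using nz by (intro tendsto_mult tendsto_divide lim)
    then show ?thesis by (simp add: P_def G_def dl_def prod_dividef mult_ac)
  qed
  then have "(\<lambda>N. P N X * P N Y * P N (X * Y)) \<longlonglongrightarrow> dl t X * dl t Y * dl t (X * Y)"
    using X Y by (intro tendsto_mult) (auto simp: norm_mult)
  ultimately have lim2: "(\<lambda>N. \<Prod>r\<in>root_box N. G (W r)) \<longlonglongrightarrow> mu (qpar a) t X Y"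
    by (simp add: mu_def mu_factor_eq)
  show "(\<Sum>\<^sub>\<infinity>e\<in>{e. Poly_Mapping.keys e \<subseteq> pos_affine_roots}. fam_prod (mono_factor t X Y) e) = mu (qpar a) t X Y"
    using lim1 lim2 unfolding sG by (rule LIMSEQ_unique)
qed

text \<open>Both sides are the double mean of X^(-i) Y^(-j) mu over the torus. The affine root
  expansion yields the sum over the families of weight (i, j), the Fourier expansions of the three
  factors yield the convolution sum.\<close>

lemma mu_coeff_eq:
  assumes t: "norm t < 1"
  shows "((\<lambda>s. cc t (j - s) * (cc t (i - s) * cc t s)) has_sum mu_coeff (qpar a) t i j) UNIV"
proof -
  define E where "E = {e :: (int \<times> int) \<times> nat \<Rightarrow>\<^sub>0 nat. Poly_Mapping.keys e \<subseteq> pos_affine_roots}"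
  define A where "A = fam_prod (mono_factor t 1 1)"
  have A: "(\<lambda>e. norm (A e)) summable_on E"
    unfolding A_def E_def using fam_prod_mono_factor_sum(1)[OF t, of 1 1] by simp
  have R: "((\<lambda>n. cc t n * Z powi n) has_sum dl t Z) UNIV" if "norm Z = 1" for Z
  proof (rule ramanujan_small)
    show "norm (t * qpar a) < norm Z"
      using t norm_q that mult_strict_mono[of "norm t" 1 "norm (qpar a)" 1] by (simp add: norm_mult)
  qed (use that t in \<open>auto simp: norm_mult\<close>)
  have pw: "continuous_on (sphere 0 1) (\<lambda>Z::complex. Z powi n)" for n
    by (intro continuous_intros) auto
  \<comment> \<open>What the mean over X leaves of the family sum; the mean over Y then imposes the
    second weight.\<close>
  define A1 where "A1 = (\<lambda>e. if wt1 e = i then A e else 0)"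
  have A1: "(\<lambda>e. norm (A1 e)) summable_on E"
    by (rule Infinite_Sum.abs_summable_on_comparison_test'[OF A]) (simp add: A1_def)
  have mean: "cmean a (\<lambda>Z. Z powi (- m) * Z powi n) = (if n = m then 1 else 0)" for m n
  proof -
    have "cmean a (\<lambda>Z. Z powi (- m) * Z powi n) = cmean a (\<lambda>Z. Z powi (n - m))"
      by (rule cmean_cong, subst power_int_add[symmetric]) auto
    then show ?thesis by (simp add: cmean_powi)
  qed
  have inner: "cmean a (\<lambda>X. X powi (- i) * Y powi (- j) * mu (qpar a) t X Y) =
      Y powi (- j) * (\<Sum>\<^sub>\<infinity>e\<in>E. A1 e * Y powi wt2 e)" if Y: "norm Y = 1" for Y
  proof -
    define B where "B = (\<lambda>e. A e * Y powi wt2 e)"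
    have B: "(\<lambda>e. norm (B e)) summable_on E"
      using A by (simp add: B_def norm_mult norm_power_int Y)
    have muX: "mu (qpar a) t X Y = (\<Sum>\<^sub>\<infinity>e\<in>E. B e * X powi wt1 e)" if X: "norm X = 1" for X
    proof -
      have "X \<noteq> 0" "Y \<noteq> 0" using X Y by auto
      then have "fam_prod (mono_factor t X Y) e = B e * X powi wt1 e" for e
        using fam_prod_mono_factor[of X Y t e] by (simp add: A_def B_def mult_ac)
      then show ?thesis using fam_prod_mono_factor_sum(2)[OF t X Y] by (simp add: E_def)
    qed
    have "((\<lambda>e. B e * cmean a (\<lambda>X. X powi (- i) * X powi wt1 e)) has_sum
        cmean a (\<lambda>X. X powi (- i) * (\<Sum>\<^sub>\<infinity>e\<in>E. B e * X powi wt1 e))) E"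
      by (rule cmean_infsum(1)[OF B pw])
    also have "(\<lambda>e. B e * cmean a (\<lambda>X. X powi (- i) * X powi wt1 e)) = (\<lambda>e. A1 e * Y powi wt2 e)"
      unfolding mean by (auto simp: A1_def B_def)
    finally have *: "cmean a (\<lambda>X. X powi (- i) * (\<Sum>\<^sub>\<infinity>e\<in>E. B e * X powi wt1 e)) =
        (\<Sum>\<^sub>\<infinity>e\<in>E. A1 e * Y powi wt2 e)" by (simp add: infsumI)
    have "cmean a (\<lambda>X. X powi (- i) * Y powi (- j) * mu (qpar a) t X Y) =
        cmean a (\<lambda>X. Y powi (- j) * (X powi (- i) * (\<Sum>\<^sub>\<infinity>e\<in>E. B e * X powi wt1 e)))"
      by (rule cmean_cong) (simp add: muX)
    also have "\<dots> = Y powi (- j) * cmean a (\<lambda>X. X powi (- i) * (\<Sum>\<^sub>\<infinity>e\<in>E. B e * X powi wt1 e))"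
      by (intro cmean_cmult continuous_on_mult pw cmean_infsum(2)[OF B pw])
    finally show ?thesis unfolding * .
  qed
  have "((\<lambda>e. A1 e * cmean a (\<lambda>Y. Y powi (- j) * Y powi wt2 e)) has_sum
      cmean a (\<lambda>Y. Y powi (- j) * (\<Sum>\<^sub>\<infinity>e\<in>E. A1 e * Y powi wt2 e))) E"
    by (rule cmean_infsum(1)[OF A1 pw])
  also have "cmean a (\<lambda>Y. Y powi (- j) * (\<Sum>\<^sub>\<infinity>e\<in>E. A1 e * Y powi wt2 e)) =
      cmean a (\<lambda>Y. cmean a (\<lambda>X. X powi (- i) * Y powi (- j) * mu (qpar a) t X Y))"
    by (rule cmean_cong) (simp add: inner)
  finally have hs: "((\<lambda>e. A1 e * cmean a (\<lambda>Y. Y powi (- j) * Y powi wt2 e)) has_sum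
      cmean a (\<lambda>Y. cmean a (\<lambda>X. X powi (- i) * Y powi (- j) * mu (qpar a) t X Y))) E" .
  have "(A has_sum cmean a (\<lambda>Y. cmean a (\<lambda>X. X powi (- i) * Y powi (- j) * mu (qpar a) t X Y)))
      {e \<in> E. wt1 e = i \<and> wt2 e = j}"
  proof (rule has_sum_cong_neutral[THEN iffD1, OF _ _ _ hs])
    show "A1 e * cmean a (\<lambda>Y. Y powi (- j) * Y powi wt2 e) = 0" if "e \<in> E - {e \<in> E. wt1 e = i \<and> wt2 e = j}" for e
      using that unfolding mean by (auto simp: A1_def)
    show "A1 e * cmean a (\<lambda>Y. Y powi (- j) * Y powi wt2 e) = A e" if "e \<in> E \<inter> {e \<in> E. wt1 e = i \<and> wt2 e = j}" for e
      using that unfolding mean by (auto simp: A1_def)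
  qed auto
  moreover have "mu_coeff (qpar a) t i j = (\<Sum>\<^sub>\<infinity>e\<in>{e \<in> E. wt1 e = i \<and> wt2 e = j}. A e)"
    unfolding mu_coeff_def A_def E_def wt1_def wt2_def fam_prod_def mono_factor_def by simp
  ultimately have "mu_coeff (qpar a) t i j =
      cmean a (\<lambda>Y. cmean a (\<lambda>X. X powi (- i) * Y powi (- j) * mu (qpar a) t X Y))"
    by (simp add: infsumI)
  then show ?thesis using cmean_cmean_mu(1)[of "cc t" t j i] R by simp
qed

end


section \<open>Meromorphic continuation\<close>

context qbase
begin

text \<open>
  On sequences \<open>r\<^sup>n \<phi>(q\<^sup>n)\<close> the operator \<open>E - r\<close> acts as the \<open>q\<close>-difference quotient
  \<open>(\<phi>(q x) - \<phi>(x)) / x\<close>, so each root gains a factor \<open>q\<^sup>n\<close>; Schwarz's lemma bounds the quotient.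
\<close>

lemma q_difference_quotient:
  assumes "\<rho> > 0" "K \<ge> 0" and hol: "\<phi> holomorphic_on ball 0 \<rho>"
    and bd: "\<And>x. x \<in> ball 0 \<rho> - {0} \<Longrightarrow> norm (\<phi> x) \<le> K"
  obtains \<psi> where "\<psi> holomorphic_on ball 0 \<rho>" "\<And>x. x \<in> ball 0 \<rho> - {0} \<Longrightarrow> norm (\<psi> x) \<le> (2 * K + 1) / \<rho>"
    "\<And>x. x \<noteq> 0 \<Longrightarrow> \<psi> x = (\<phi> (q * x) - \<phi> x) / x"
proof -
  define h where "h = (\<lambda>x. \<phi> (q * x) - \<phi> x)"
  have qx: "q * x \<in> ball 0 \<rho>" if "x \<in> ball 0 \<rho>" for x
    using that norm_q mult_right_mono[of "norm q" 1 "norm x"] by (simp add: norm_mult)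
  have "(\<lambda>x. \<phi> (q * x)) holomorphic_on ball 0 \<rho>"
    using holomorphic_on_compose_gen[of "\<lambda>x. q * x" "ball 0 \<rho>" \<phi> "ball 0 \<rho>"] hol qx
    by (auto simp: o_def image_subset_iff intro: holomorphic_intros)
  then have hh: "h holomorphic_on ball 0 \<rho>"
    unfolding h_def by (intro holomorphic_intros hol)
  define \<psi> where "\<psi> = (\<lambda>x. if x = 0 then deriv h 0 else h x / x)"
  have 1: "\<psi> holomorphic_on ball 0 \<rho>"
    by (rule pole_theorem_open_0[OF hh, of 0]) (auto simp: \<psi>_def h_def)
  \<comment> \<open>The additional 1 makes the bound strict, and the divisor nonzero, even for K =
    0; Schwarz's lemma needs values strictly inside the unit disc.\<close>
  have hb: "norm (h x) < 2 * K + 1" if "x \<in> ball 0 \<rho>" for x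
  proof (cases "x = 0")
    case False
    then have "norm (\<phi> (q * x)) \<le> K" "norm (\<phi> x) \<le> K" using bd that qx by auto
    then show ?thesis using norm_triangle_ineq4[of "\<phi> (q * x)" "\<phi> x"] by (simp add: h_def)
  qed (use assms in \<open>simp add: h_def\<close>)
  have 2: "norm (\<psi> x) \<le> (2 * K + 1) / \<rho>" if x: "x \<in> ball 0 \<rho> - {0}" for x
  proof -
    define f where "f = (\<lambda>z. h (of_real \<rho> * z) / of_real (2 * K + 1))"
    have sc: "of_real \<rho> * z \<in> ball 0 \<rho>" if "norm z < 1" for z :: complex
      using that assms(1) by (simp add: norm_mult)
    have "(\<lambda>z. h (of_real \<rho> * z)) holomorphic_on ball 0 1"
      using holomorphic_on_compose_gen[of "\<lambda>z. of_real \<rho> * z" "ball 0 1" h "ball 0 \<rho>"] hh sc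
      by (auto simp: o_def image_subset_iff intro: holomorphic_intros)
    then have "f holomorphic_on ball 0 1"
      unfolding f_def using assms(2) by (intro holomorphic_intros) (auto simp flip: of_real_add of_real_mult)
    moreover have "f 0 = 0" by (simp add: f_def h_def)
    moreover have "norm (f z) < 1" if "norm z < 1" for z
      using hb[OF sc[OF that]] assms(2) unfolding f_def norm_divide norm_of_real by simp
    moreover have "norm (x / of_real \<rho>) < 1" using x assms(1) by (simp add: norm_divide)
    ultimately have "norm (f (x / of_real \<rho>)) \<le> norm (x / of_real \<rho>)" by (rule Schwarz_Lemma)
    moreover have "f (x / of_real \<rho>) = h x / of_real (2 * K + 1)" using assms(1) by (simp add: f_def)
    ultimately have "norm (h x) / (2 * K + 1) \<le> norm x / \<rho>"
      using assms by (simp add: norm_divide del: of_real_add of_real_mult)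
    then show ?thesis using x assms unfolding \<psi>_def by (simp add: norm_divide field_simps)
  qed
  show thesis by (rule that[OF 1 2]) (auto simp: \<psi>_def h_def)
qed

text \<open>The roots r, r q, ..., r q^(M-1) lower the rate of a tail from r to r q^M. The constant
  is chosen before r, \<phi>, u and N, so the bound is uniform while t runs through a compact set.
  The bound B enters because each step leaves a factor r q^M behind.\<close>

lemma shift_poly_tail:
  assumes "\<rho> > 0" "K \<ge> 0" "B \<ge> 0"
  shows "\<exists>C\<ge>0. \<forall>r \<phi> u N. norm r \<le> B \<longrightarrow> \<phi> holomorphic_on ball 0 \<rho> \<longrightarrow>
      (\<forall>x\<in>ball 0 \<rho> - {0}. norm (\<phi> x) \<le> K) \<longrightarrow> norm q ^ N < \<rho> \<longrightarrow>
      (\<forall>n\<ge>N. u (int n) = r ^ n * \<phi> (q ^ n)) \<longrightarrow>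
      (\<exists>\<psi>. \<psi> holomorphic_on ball 0 \<rho> \<and> (\<forall>x\<in>ball 0 \<rho> - {0}. norm (\<psi> x) \<le> C) \<and>
         (\<forall>n\<ge>N. shift_poly (map (\<lambda>k. r * q ^ k) [0..<M]) u (int n) = (r * q ^ M) ^ n * \<psi> (q ^ n)))"
proof (induction M)
  case 0
  show ?case by (rule exI[of _ K]) (use assms in auto)
next
  case (Suc M)
  then obtain C where C: "C \<ge> 0" and IH: "\<And>r \<phi> u N. norm r \<le> B \<Longrightarrow> \<phi> holomorphic_on ball 0 \<rho> \<Longrightarrow>
      (\<forall>x\<in>ball 0 \<rho> - {0}. norm (\<phi> x) \<le> K) \<Longrightarrow> norm q ^ N < \<rho> \<Longrightarrow>
      (\<forall>n\<ge>N. u (int n) = r ^ n * \<phi> (q ^ n)) \<Longrightarrow>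
      (\<exists>\<psi>. \<psi> holomorphic_on ball 0 \<rho> \<and> (\<forall>x\<in>ball 0 \<rho> - {0}. norm (\<psi> x) \<le> C) \<and>
         (\<forall>n\<ge>N. shift_poly (map (\<lambda>k. r * q ^ k) [0..<M]) u (int n) = (r * q ^ M) ^ n * \<psi> (q ^ n)))"
    by (elim exE conjE) (rule that, assumption, simp)
  show ?case
  proof (intro exI[of _ "B * ((2 * C + 1) / \<rho>)"] conjI allI impI)
    show "0 \<le> B * ((2 * C + 1) / \<rho>)" using C assms by simp
    fix r \<phi> u N
    assume r: "norm r \<le> B" and *: "\<phi> holomorphic_on ball 0 \<rho>"
      "\<forall>x\<in>ball 0 \<rho> - {0}. norm (\<phi> x) \<le> K" "norm q ^ N < \<rho>"
      "\<forall>n\<ge>N. u (int n) = r ^ n * \<phi> (q ^ n)"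
    obtain \<psi> where psi: "\<psi> holomorphic_on ball 0 \<rho>" "\<forall>x\<in>ball 0 \<rho> - {0}. norm (\<psi> x) \<le> C"
      "\<forall>n\<ge>N. shift_poly (map (\<lambda>k. r * q ^ k) [0..<M]) u (int n) = (r * q ^ M) ^ n * \<psi> (q ^ n)"
      using IH[OF r *] by (elim exE conjE) (rule that)
    obtain w where chi: "w holomorphic_on ball 0 \<rho>"
      "\<And>x. x \<in> ball 0 \<rho> - {0} \<Longrightarrow> norm (w x) \<le> (2 * C + 1) / \<rho>"
      "\<And>x. x \<noteq> 0 \<Longrightarrow> w x = (\<psi> (q * x) - \<psi> x) / x"
      by (rule q_difference_quotient[OF assms(1) C psi(1)]) (use psi(2) in blast)+
    show "\<exists>\<psi>. \<psi> holomorphic_on ball 0 \<rho> \<and> (\<forall>x\<in>ball 0 \<rho> - {0}. norm (\<psi> x) \<le> B * ((2 * C + 1) / \<rho>)) \<and>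
        (\<forall>n\<ge>N. shift_poly (map (\<lambda>k. r * q ^ k) [0..<Suc M]) u (int n) = (r * q ^ Suc M) ^ n * \<psi> (q ^ n))"
    proof (intro exI[of _ "\<lambda>x. r * q ^ M * w x"] conjI ballI allI impI)
      show "(\<lambda>x. r * q ^ M * w x) holomorphic_on ball 0 \<rho>"
        by (intro holomorphic_intros chi(1))
      fix x :: complex assume x: "x \<in> ball 0 \<rho> - {0}"
      have "norm q ^ M \<le> 1" using norm_q by (simp add: power_le_one)
      then have "norm (r * q ^ M) \<le> B * 1"
        unfolding norm_mult norm_power using r assms(3) by (intro mult_mono) auto
      then show "norm (r * q ^ M * w x) \<le> B * ((2 * C + 1) / \<rho>)"
        using chi(2)[OF x] assms(3) unfolding norm_mult[of "r * q ^ M"] by (intro mult_mono) auto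
    next
      fix n assume n: "N \<le> n"
      define v where "v = shift_poly (map (\<lambda>k. r * q ^ k) [0..<M]) u"
      have v: "v (int n) = (r * q ^ M) ^ n * \<psi> (q ^ n)"
        "v (int n + 1) = (r * q ^ M) ^ Suc n * \<psi> (q * q ^ n)"
        using psi(3) n psi(3)[rule_format, of "Suc n"] by (simp_all add: v_def add.commute)
      have "shift_poly (map (\<lambda>k. r * q ^ k) [0..<Suc M]) u (int n) = v (int n + 1) - r * q ^ M * v (int n)"
        by (simp add: shift_poly_append v_def)
      also have "\<dots> = (r * q ^ M) ^ n * (r * q ^ M) * (\<psi> (q * q ^ n) - \<psi> (q ^ n))"
        unfolding v by (simp only: power_Suc right_diff_distrib mult_ac)
      also have "\<psi> (q * q ^ n) - \<psi> (q ^ n) = q ^ n * w (q ^ n)"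
        using chi(3)[of "q ^ n"] by simp
      also have "(r * q ^ M) ^ n * (r * q ^ M) * (q ^ n * w (q ^ n)) =
          (r * q ^ Suc M) ^ n * (r * q ^ M * w (q ^ n))"
        by (simp add: power_mult_distrib mult_ac)
      finally show "shift_poly (map (\<lambda>k. r * q ^ k) [0..<Suc M]) u (int n) =
          (r * q ^ Suc M) ^ n * (r * q ^ M * w (q ^ n))" .
    qed
  qed
qed

end

section \<open>Geometric decay and holomorphy under shift polynomials\<close>

text \<open>Used for the roots that belong to the opposite end: they cannot improve a tail that
  already decays, but they worsen only its constant.\<close>

lemma shift_poly_geometric_right:
  assumes "\<And>r. r \<in> set rs \<Longrightarrow> norm r \<le> B" "0 \<le> B" "0 \<le> C" "0 < l" "l \<le> 1"
    and "\<And>n. n \<ge> N \<Longrightarrow> norm (v (int n)) \<le> C * l ^ n" and "n \<ge> N"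
  shows "norm (shift_poly rs v (int n)) \<le> ((1 + B) / l) ^ length rs * C * l ^ n"
  using assms
proof (induction rs arbitrary: v C)
  case (Cons r rs)
  have st: "norm (v (int m + 1) - r * v (int m)) \<le> ((1 + B) / l * C) * l ^ m" if "m \<ge> N" for m
  proof -
    have "norm (v (int m + 1)) \<le> C * l ^ Suc m" "norm (v (int m)) \<le> C * l ^ m"
      using Cons.prems(6)[of "Suc m"] Cons.prems(6)[of m] that by (simp_all add: add.commute)
    moreover have "norm r * norm (v (int m)) \<le> B * (C * l ^ m)"
      by (intro mult_mono) (use Cons.prems calculation in auto)
    moreover have "C * l ^ Suc m \<le> C * l ^ m"
      using Cons.prems by (intro mult_left_mono power_decreasing) auto
    ultimately have "norm (v (int m + 1) - r * v (int m)) \<le> (1 + B) * (C * l ^ m)"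
      using norm_triangle_ineq4[of "v (int m + 1)" "r * v (int m)"] by (simp add: norm_mult algebra_simps)
    also have "\<dots> \<le> (1 + B) / l * (C * l ^ m)"
    proof (intro mult_right_mono)
      show "1 + B \<le> (1 + B) / l" using Cons.prems(2,4,5) mult_left_le[of l "1 + B"] by (simp add: le_divide_eq)
    qed (use Cons.prems in auto)
    finally show ?thesis by (simp add: mult_ac)
  qed
  have "norm (shift_poly rs (\<lambda>n. v (n + 1) - r * v n) (int n)) \<le> ((1 + B) / l) ^ length rs * ((1 + B) / l * C) * l ^ n"
    by (rule Cons.IH) (use Cons.prems st in auto)
  then show ?case by (simp add: mult_ac)
qed auto

text \<open>On the negative side the shift moves towards the origin, so each root costs one place of
  the range in which the bound is known.\<close>

lemma shift_poly_geometric_left: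
  assumes "\<And>r. r \<in> set rs \<Longrightarrow> norm r \<le> B" "0 \<le> B" "0 \<le> C" "0 < l" "l \<le> 1"
    and "\<And>n. n \<ge> N \<Longrightarrow> norm (v (- int n)) \<le> C * l ^ n" and "n \<ge> N + length rs"
  shows "norm (shift_poly rs v (- int n)) \<le> ((1 + B) / l) ^ length rs * C * l ^ n"
  using assms
proof (induction rs arbitrary: v C N)
  case (Cons r rs)
  have st: "norm (v (- int m + 1) - r * v (- int m)) \<le> ((1 + B) / l * C) * l ^ m" if "m \<ge> Suc N" for m
  proof -
    obtain k where m: "m = Suc k" "k \<ge> N" using \<open>m \<ge> Suc N\<close> by (cases m) auto
    have 1: "norm (v (- int m + 1)) \<le> C * l ^ k" "norm (v (- int m)) \<le> C * l ^ Suc k"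
      using Cons.prems(6)[of k] Cons.prems(6)[of m] m by simp_all
    have "norm r * norm (v (- int m)) \<le> B * (C * l ^ Suc k)"
      by (intro mult_mono 1) (use Cons.prems in auto)
    also have "\<dots> \<le> B * (C * l ^ k)"
      using Cons.prems by (intro mult_left_mono power_decreasing) auto
    finally have "norm (v (- int m + 1) - r * v (- int m)) \<le> (1 + B) * (C * l ^ k)"
      using 1 norm_triangle_ineq4[of "v (- int m + 1)" "r * v (- int m)"] by (simp add: norm_mult algebra_simps)
    also have "\<dots> = ((1 + B) / l * C) * l ^ m" using Cons.prems(4) by (simp add: m)
    finally show ?thesis .
  qed
  have "norm (shift_poly rs (\<lambda>n. v (n + 1) - r * v n) (- int n)) \<le> ((1 + B) / l) ^ length rs * ((1 + B) / l * C) * l ^ n"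
    by (rule Cons.IH[of _ "Suc N"]) (use Cons.prems st in auto)
  then show ?case by (simp add: mult_ac)
qed auto

lemma shift_poly_holomorphic:
  assumes "\<And>f. f \<in> set rs \<Longrightarrow> f holomorphic_on A" "\<And>n. (\<lambda>t. u t n) holomorphic_on A"
  shows "(\<lambda>t. shift_poly (map (\<lambda>f. f t) rs) (u t) n) holomorphic_on A"
  using assms
proof (induction rs arbitrary: u n)
  case (Cons f rs)
  have "(\<lambda>t. shift_poly (map (\<lambda>f. f t) rs) ((\<lambda>t n. u t (n + 1) - f t * u t n) t) n) holomorphic_on A"
    by (rule Cons.IH) (use Cons.prems in \<open>auto intro!: holomorphic_intros\<close>)
  then show ?case by simp
qed auto


section \<open>Both tails of the triple product c(i - n) c(j - n) c(n)\<close>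

context qbase
begin

text \<open>The triple product before normalisation, hence entire in t; all bounds are proved for
  it.\<close>

definition uf :: "int \<Rightarrow> int \<Rightarrow> complex \<Rightarrow> int \<Rightarrow> complex" where
  "uf i j t n = cf t (i - n) * cf t (j - n) * cf t n"

lemma uf_holomorphic: "(\<lambda>t. uf i j t n) holomorphic_on A"
  unfolding uf_def by (intro holomorphic_intros cf_holomorphic)

lemma uf_uminus: "uf i j t (- n) = q powi (- i - j - n) * uf (- i) (- j) t n"
proof -
  have "uf i j t (- n) = cf t (- (- i - n)) * cf t (- (- j - n)) * cf t (- n)"
    by (simp add: uf_def algebra_simps)
  also have "\<dots> = q powi (- i - n) * q powi (- j - n) * q powi n * uf (- i) (- j) t n"
    unfolding cf_uminus by (simp add: uf_def mult_ac)
  also have "q powi (- i - n) * q powi (- j - n) * q powi n = q powi (- i - j - n)"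
    by (simp flip: power_int_add)
  finally show ?thesis .
qed

text \<open>What remains of \<open>ch t m\<close> when t^m is taken out, as a function of x = q^m.
  It is holomorphic in x for |x| < |t|, which makes the Schwarz bound applicable.\<close>

definition chg :: "complex \<Rightarrow> complex \<Rightarrow> complex" where
  "chg t x = ph (t * q) * ph (1 / t) * (ph (t * q * x) / ph (x / t))"

lemma ch_eq_chg:
  assumes "t \<noteq> 0" "norm (q ^ m) < norm t"
  shows "ch t m = t ^ m * chg t (q ^ m)"
proof -
  have nz: "ph (q ^ m / t) \<noteq> 0" using assms by (intro ph_nonzero) (simp add: norm_divide)
  have "(\<Prod>i<m. t - q ^ i) = (\<Prod>i<m. t * (1 - 1 / t * q ^ i))"
    using assms(1) by (simp add: right_diff_distrib)
  then have "(\<Prod>i<m. t - q ^ i) * ph (q ^ m / t) = t ^ m * ph (1 / t)"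
    using ph_split[of "1 / t" m] by (simp add: prod.distrib)
  then have "(\<Prod>i<m. t - q ^ i) = t ^ m * ph (1 / t) / ph (q ^ m / t)"
    using nz by (simp add: field_simps)
  then show ?thesis by (simp add: ch_def chg_def mult_ac)
qed

text \<open>The base t^3 q^2 arises because each of the three factors contributes t^n, and the two
  with reflected index contribute q^n each. For |x| <= \<delta> and |t| >= 2 \<delta> the
  denominator \<open>ph (x / t)\<close> stays away from 0.\<close>

lemma uf_right_tail:
  assumes \<delta>: "\<delta> > 0"
  obtains \<rho> K where "\<rho> > 0" "K \<ge> 0"
    "\<And>t N. 2 * \<delta> \<le> norm t \<Longrightarrow> norm t \<le> T \<Longrightarrow> norm q ^ N < \<rho> \<Longrightarrow> int N \<ge> \<bar>i\<bar> \<Longrightarrow> int N \<ge> \<bar>j\<bar> \<Longrightarrow>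
       \<exists>\<phi>. \<phi> holomorphic_on ball 0 \<rho> \<and> (\<forall>x\<in>ball 0 \<rho> - {0}. norm (\<phi> x) \<le> K) \<and>
         (\<forall>n\<ge>N. uf i j t (int n) = (t ^ 3 * q\<^sup>2) ^ n * \<phi> (q ^ n))"
proof -
  define V where "V = {t :: complex. 2 * \<delta> \<le> norm t} \<inter> cball 0 T"
  have "compact V" unfolding V_def
    by (intro closed_Int_compact closed_Collect_le continuous_intros compact_cball)
  then have cV: "compact (V \<times> (cball 0 \<delta> :: complex set))" by (intro compact_Times compact_cball)
  have V0: "t \<noteq> 0" if "t \<in> V" for t using that \<delta> by (auto simp: V_def)
  have nz: "ph (x / t) \<noteq> 0" if "t \<in> V" "x \<in> cball 0 \<delta>" for x t
    using that \<delta> by (intro ph_nonzero) (auto simp: V_def norm_divide divide_less_eq)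
  have "continuous_on (V \<times> cball 0 \<delta>) (\<lambda>z. chg (fst z) (snd z))"
    unfolding chg_def by (intro continuous_intros) (use V0 nz in auto)
  then have "bounded ((\<lambda>z. chg (fst z) (snd z)) ` (V \<times> cball 0 \<delta>))"
    by (intro compact_imp_bounded compact_continuous_image cV)
  then obtain K0 where K0: "K0 > 0" "\<And>t x. t \<in> V \<Longrightarrow> x \<in> cball 0 \<delta> \<Longrightarrow> norm (chg t x) \<le> K0"
    unfolding bounded_pos by force
  have "continuous_on V (\<lambda>t. (t * q) powi (- i - j))"
    by (intro continuous_intros) (use V0 in auto)
  then have "bounded ((\<lambda>t. (t * q) powi (- i - j)) ` V)"
    using \<open>compact V\<close> by (intro compact_imp_bounded compact_continuous_image)
  then obtain K1 where K1: "K1 > 0" "\<And>t. t \<in> V \<Longrightarrow> norm ((t * q) powi (- i - j)) \<le> K1"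
    unfolding bounded_pos by force
  \<comment> \<open>The three factors are evaluated at x, q^(-i) x and q^(-j) x; this radius keeps
    all of them inside the disc of radius \<delta>.\<close>
  define \<rho> where "\<rho> = \<delta> * norm q ^ (nat \<bar>i\<bar> + nat \<bar>j\<bar>)"
  have \<rho>: "\<rho> > 0" unfolding \<rho>_def using \<delta> norm_q_pos by (intro mult_pos_pos zero_less_power)
  have sh: "norm (q powi m * x) < \<delta>" if "norm x < \<rho>" "m = 0 \<or> m = - i \<or> m = - j" for m x
  proof -
    have "norm (q powi m) * norm q ^ (nat \<bar>i\<bar> + nat \<bar>j\<bar>) = norm q powi (m + (\<bar>i\<bar> + \<bar>j\<bar>))"
    proof -
      have "norm q ^ (nat \<bar>i\<bar> + nat \<bar>j\<bar>) = norm q powi (\<bar>i\<bar> + \<bar>j\<bar>)"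
        by (simp add: power_int_def nat_add_distrib)
      then show ?thesis
        using power_int_add[of "norm q" m "\<bar>i\<bar> + \<bar>j\<bar>"] norm_q_pos by (simp add: norm_power_int)
    qed
    also have "\<dots> \<le> 1"
      using that norm_q norm_q_pos by (auto simp: power_int_def intro!: power_le_one)
    finally have le: "norm (q powi m) * norm q ^ (nat \<bar>i\<bar> + nat \<bar>j\<bar>) \<le> 1" .
    have "norm (q powi m * x) < norm (q powi m) * \<rho>"
      unfolding norm_mult using that(1) by (intro mult_strict_left_mono) auto
    also have "\<dots> = \<delta> * (norm (q powi m) * norm q ^ (nat \<bar>i\<bar> + nat \<bar>j\<bar>))"
      by (simp add: \<rho>_def mult_ac)
    also have "\<dots> \<le> \<delta> * 1" using \<delta> le by (intro mult_left_mono) auto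
    finally show ?thesis by simp
  qed
  show thesis
  proof (rule that[OF \<rho>])
    show "0 \<le> K1 * (K0 * K0 * K0)" using K0 K1 by simp
    fix t :: complex and N assume t: "2 * \<delta> \<le> norm t" "norm t \<le> T" and N: "norm q ^ N < \<rho>" "\<bar>i\<bar> \<le> int N" "\<bar>j\<bar> \<le> int N"
    have tV: "t \<in> V" using t by (simp add: V_def)
    have t0: "t \<noteq> 0" by (rule V0[OF tV])
    define \<phi> where "\<phi> = (\<lambda>x. (t * q) powi (- i - j) *
        (chg t (q powi (- i) * x) * chg t (q powi (- j) * x) * chg t (q powi 0 * x)))"
    have chol: "(\<lambda>x. chg t (q powi m * x)) holomorphic_on ball 0 \<rho>" if "m = 0 \<or> m = - i \<or> m = - j" for m
      unfolding chg_def
    proof (intro holomorphic_intros)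
      fix x :: complex assume "x \<in> ball 0 \<rho>"
      then have "q powi m * x \<in> cball 0 \<delta>" using sh[of x m] that by auto
      then show "ph (q powi m * x / t) \<noteq> 0" by (rule nz[OF tV])
    qed (use t0 in auto)
    have cb: "norm (chg t (q powi m * x)) \<le> K0" if "norm x < \<rho>" "m = 0 \<or> m = - i \<or> m = - j" for m x
      using sh[OF that] by (intro K0 tV) auto
    have "\<phi> holomorphic_on ball 0 \<rho>"
      unfolding \<phi>_def by (intro holomorphic_on_mult holomorphic_on_const chol) auto
    moreover have "norm (\<phi> x) \<le> K1 * (K0 * K0 * K0)" if "x \<in> ball 0 \<rho> - {0}" for x
    proof -
      have x: "norm x < \<rho>" using that by simp
      have "norm (chg t (q powi (- i) * x)) \<le> K0" "norm (chg t (q powi (- j) * x)) \<le> K0"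
        "norm (chg t (q powi 0 * x)) \<le> K0"
        by (rule cb[OF x]; simp)+
      then show ?thesis unfolding \<phi>_def norm_mult[of "(t * q) powi (- i - j)"] norm_mult[of "chg _ _ * chg _ _"]
          norm_mult[of "chg _ _"]
        using K0(1) K1(1) by (intro mult_mono K1(2)[OF tV]) auto
    qed
    moreover have "uf i j t (int n) = (t ^ 3 * q\<^sup>2) ^ n * \<phi> (q ^ n)" if n: "n \<ge> N" for n
    proof -
      have qn: "norm (q ^ n) < \<rho>"
      proof -
        have "norm q ^ n \<le> norm q ^ N" using norm_q n by (intro power_decreasing) auto
        then show ?thesis using N by (simp add: norm_power)
      qed
      have cfm: "cf t (- (int n + m)) = q powi (int n + m) * (t powi (int n + m) * chg t (q powi m * q ^ n))"
        "cf t (int n + m) = t powi (int n + m) * chg t (q powi m * q ^ n)"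
        if m: "m = 0 \<or> m = - i \<or> m = - j" for m
      proof -
        define k where "k = nat (int n + m)"
        have k: "int k = int n + m" using m N n by (auto simp: k_def)
        have qk: "q ^ k = q powi m * q ^ n"
          using k power_int_add[of q "int n" m] by (simp add: mult.commute flip: power_int_of_nat)
        have "norm (q ^ k) < norm t" using sh[OF qn m] \<delta> t(1) unfolding qk by linarith
        then have "ch t k = t ^ k * chg t (q ^ k)" by (rule ch_eq_chg[OF t0])
        then show 1: "cf t (int n + m) = t powi (int n + m) * chg t (q powi m * q ^ n)"
          unfolding k[symmetric] qk[symmetric] by (simp add: cf_def)
        show "cf t (- (int n + m)) = q powi (int n + m) * (t powi (int n + m) * chg t (q powi m * q ^ n))"
          unfolding cf_uminus 1 ..
      qed
      have "uf i j t (int n) = cf t (- (int n + - i)) * cf t (- (int n + - j)) * cf t (int n + 0)"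
        by (simp add: uf_def)
      also have "\<dots> = (q powi (int n + - i) * t powi (int n + - i)) * (q powi (int n + - j) * t powi (int n + - j))
          * t powi (int n + 0) * (chg t (q powi (- i) * q ^ n) * chg t (q powi (- j) * q ^ n) * chg t (q powi 0 * q ^ n))"
        by (subst cfm, simp, subst cfm, simp, subst cfm(2), simp) (simp only: mult_ac)
      also have "(q powi (int n + - i) * t powi (int n + - i)) * (q powi (int n + - j) * t powi (int n + - j))
          * t powi (int n + 0) = (t ^ 3 * q\<^sup>2) ^ n * (t * q) powi (- i - j)"
      proof -
        have e: "x powi (int n + m) = x ^ n * x powi m" if "x \<noteq> 0" for x :: complex and m
          using power_int_add[of x "int n" m] that by simp
        have e2: "x powi (- i - j) = x powi (- i) * x powi (- j)" if "x \<noteq> 0" for x :: complex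
          using power_int_add[of x "- i" "- j"] that by simp
        show ?thesis
          by (simp only: e[OF q_nonzero] e[OF t0] e2[OF q_nonzero] e2[OF t0] power_int_mult_distrib
              power_mult_distrib power3_eq_cube power2_eq_square power_int_0_right mult_1_right mult_1_left mult_ac)
      qed
      finally show ?thesis by (simp add: \<phi>_def mult_ac)
    qed
    ultimately show "\<exists>\<phi>. \<phi> holomorphic_on ball 0 \<rho> \<and> (\<forall>x\<in>ball 0 \<rho> - {0}. norm (\<phi> x) \<le> K1 * (K0 * K0 * K0)) \<and>
         (\<forall>n\<ge>N. uf i j t (int n) = (t ^ 3 * q\<^sup>2) ^ n * \<phi> (q ^ n))" by blast
  qed
qed

text \<open>The first half treats n -> +infinity. At the other end the product behaves like (t^3 q
  q^k)^(-n), whence the inverses; there one factor q is lost since c(n) is now the only reflected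
  factor.\<close>

definition rootfs :: "nat \<Rightarrow> (complex \<Rightarrow> complex) list" where
  "rootfs M = map (\<lambda>k t. t ^ 3 * q\<^sup>2 * q ^ k) [0..<M] @ map (\<lambda>k t. inverse (t ^ 3 * q * q ^ k)) [0..<M]"

text \<open>For positive n the roots of the right tail are applied before the others, for negative n
  the other way round, which is allowed because shift polynomials commute. The resulting rates t^3
  q^(M+2) and t^3 q^(M+1) are both at most \<open>l\<close> in modulus.\<close>

lemma uf_regularised_bound:
  assumes \<delta>: "\<delta> > 0" and T: "2 * \<delta> \<le> T" "T ^ 3 * norm q ^ Suc M < 1"
  obtains N C l where "C \<ge> 0" "0 < l" "l < 1"
    "\<And>t n. 2 * \<delta> \<le> norm t \<Longrightarrow> norm t \<le> T \<Longrightarrow> nat \<bar>n\<bar> \<ge> N \<Longrightarrow>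
       norm (shift_poly (map (\<lambda>f. f t) (rootfs M)) (uf i j t) n) \<le> C * l ^ nat \<bar>n\<bar>"
proof -
  obtain \<rho>1 K1 where 1: "\<rho>1 > 0" "K1 \<ge> 0"
    "\<And>t N. 2 * \<delta> \<le> norm t \<Longrightarrow> norm t \<le> T \<Longrightarrow> norm q ^ N < \<rho>1 \<Longrightarrow> int N \<ge> \<bar>i\<bar> \<Longrightarrow> int N \<ge> \<bar>j\<bar> \<Longrightarrow>
       \<exists>\<phi>. \<phi> holomorphic_on ball 0 \<rho>1 \<and> (\<forall>x\<in>ball 0 \<rho>1 - {0}. norm (\<phi> x) \<le> K1) \<and>
         (\<forall>n\<ge>N. uf i j t (int n) = (t ^ 3 * q\<^sup>2) ^ n * \<phi> (q ^ n))"
    by (rule uf_right_tail[OF \<delta>, of T i j]) (rule that)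
  obtain \<rho>2 K2 where 2: "\<rho>2 > 0" "K2 \<ge> 0"
    "\<And>t N. 2 * \<delta> \<le> norm t \<Longrightarrow> norm t \<le> T \<Longrightarrow> norm q ^ N < \<rho>2 \<Longrightarrow> int N \<ge> \<bar>- i\<bar> \<Longrightarrow> int N \<ge> \<bar>- j\<bar> \<Longrightarrow>
       \<exists>\<phi>. \<phi> holomorphic_on ball 0 \<rho>2 \<and> (\<forall>x\<in>ball 0 \<rho>2 - {0}. norm (\<phi> x) \<le> K2) \<and>
         (\<forall>n\<ge>N. uf (- i) (- j) t (int n) = (t ^ 3 * q\<^sup>2) ^ n * \<phi> (q ^ n))"
    by (rule uf_right_tail[OF \<delta>, of T "- i" "- j"]) (rule that)
  have T0: "T > 0" using \<delta> T(1) by simp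
  define l where "l = T ^ 3 * norm q ^ Suc M"
  have l: "0 < l" "l < 1" using T0 T(2) norm_q_pos by (simp_all add: l_def)
  define K2' where "K2' = norm (q powi (- i - j)) * K2"
  have K2': "K2' \<ge> 0" using 2 by (simp add: K2'_def)
  define B0 where "B0 = T ^ 3"
  have B0: "B0 \<ge> 0" using T0 by (simp add: B0_def)
  obtain C1 where C1: "C1 \<ge> 0" "\<forall>r \<phi> u N. norm r \<le> B0 \<longrightarrow> \<phi> holomorphic_on ball 0 \<rho>1 \<longrightarrow>
      (\<forall>x\<in>ball 0 \<rho>1 - {0}. norm (\<phi> x) \<le> K1) \<longrightarrow> norm q ^ N < \<rho>1 \<longrightarrow>
      (\<forall>n\<ge>N. u (int n) = r ^ n * \<phi> (q ^ n)) \<longrightarrow>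
      (\<exists>\<psi>. \<psi> holomorphic_on ball 0 \<rho>1 \<and> (\<forall>x\<in>ball 0 \<rho>1 - {0}. norm (\<psi> x) \<le> C1) \<and>
         (\<forall>n\<ge>N. shift_poly (map (\<lambda>k. r * q ^ k) [0..<M]) u (int n) = (r * q ^ M) ^ n * \<psi> (q ^ n)))"
    using shift_poly_tail[OF 1(1,2) B0, of M] by (elim exE conjE) (rule that)
  obtain C2 where C2: "C2 \<ge> 0" "\<forall>r \<phi> u N. norm r \<le> B0 \<longrightarrow> \<phi> holomorphic_on ball 0 \<rho>2 \<longrightarrow>
      (\<forall>x\<in>ball 0 \<rho>2 - {0}. norm (\<phi> x) \<le> K2') \<longrightarrow> norm q ^ N < \<rho>2 \<longrightarrow>
      (\<forall>n\<ge>N. u (int n) = r ^ n * \<phi> (q ^ n)) \<longrightarrow>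
      (\<exists>\<psi>. \<psi> holomorphic_on ball 0 \<rho>2 \<and> (\<forall>x\<in>ball 0 \<rho>2 - {0}. norm (\<psi> x) \<le> C2) \<and>
         (\<forall>n\<ge>N. shift_poly (map (\<lambda>k. r * q ^ k) [0..<M]) u (int n) = (r * q ^ M) ^ n * \<psi> (q ^ n)))"
    using shift_poly_tail[OF 2(1) K2' B0, of M] by (elim exE conjE) (rule that)
  obtain N1 where N1: "norm q ^ N1 < min \<rho>1 \<rho>2"
    using real_arch_pow_inv[of "min \<rho>1 \<rho>2" "norm q"] 1(1) 2(1) norm_q by auto
  define N where "N = N1 + nat \<bar>i\<bar> + nat \<bar>j\<bar>"
  have qN: "norm q ^ N < \<rho>1" "norm q ^ N < \<rho>2"
  proof -
    have "norm q ^ N \<le> norm q ^ N1" using norm_q by (intro power_decreasing) (auto simp: N_def)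
    then show "norm q ^ N < \<rho>1" "norm q ^ N < \<rho>2" using N1 by auto
  qed
  have Nij: "\<bar>i\<bar> \<le> int N" "\<bar>j\<bar> \<le> int N" by (simp_all add: N_def)
  \<comment> \<open>Bounds the inverse roots of the left tail; this is where t has to stay away from
    0.\<close>
  define L where "L = 1 / ((2 * \<delta>) ^ 3 * norm q ^ Suc M)"
  define B where "B = B0 + L"
  have L0: "L > 0" using \<delta> norm_q_pos by (simp add: L_def)
  define D where "D = ((1 + B) / l) ^ M * max C1 (L ^ M * C2 * (1 / l) ^ M)"
  have D0: "max C1 (L ^ M * C2 * (1 / l) ^ M) \<ge> 0" using C1 by simp
  \<comment> \<open>One \<open>M\<close> is lost when the left tail is reflected, the other when the
    remaining M roots shift it towards the origin.\<close>
  show thesis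
  proof (rule that[of D l "N + M + M"])
    show "D \<ge> 0" unfolding D_def using D0 l B0 L0 by (intro mult_nonneg_nonneg) (auto simp: B_def)
    fix t :: complex and n assume t: "2 * \<delta> \<le> norm t" "norm t \<le> T" and n: "N + M + M \<le> nat \<bar>n\<bar>"
    have t0: "t \<noteq> 0" using t \<delta> by auto
    define u where "u = uf i j t"
    define rp where "rp = map (\<lambda>k. t ^ 3 * q\<^sup>2 * q ^ k) [0..<M]"
    define rm where "rm = map (\<lambda>k. t ^ 3 * q * q ^ k) [0..<M]"
    have maps: "map (\<lambda>f. f t) (rootfs M) = rp @ map inverse rm"
      by (simp add: rootfs_def rp_def rm_def o_def)
    have t3: "norm t ^ 3 \<le> T ^ 3" using t by (intro power_mono) auto
    have qk1: "norm q ^ k \<le> 1" for k using norm_q by (simp add: power_le_one)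
    have r1: "norm (t ^ 3 * q\<^sup>2) \<le> B0" "norm (t ^ 3 * q) \<le> B0"
      using mult_mono[OF t3 qk1[of 2]] mult_mono[OF t3 qk1[of 1]] T0 by (simp_all add: B0_def norm_mult norm_power)
    have rpB: "norm r \<le> B" if rin: "r \<in> set rp" for r
    proof -
      obtain k where r: "r = t ^ 3 * q\<^sup>2 * q ^ k" using rin by (auto simp: rp_def)
      have "norm (t ^ 3 * q\<^sup>2) * norm q ^ k \<le> B0 * 1"
        by (intro mult_mono r1 qk1) (use B0 in auto)
      then show ?thesis using L0 by (simp add: r B_def norm_mult norm_power)
    qed
    have rmB: "norm (inverse r) \<le> L" if rin: "r \<in> set rm" for r
    proof -
      obtain k where r: "r = t ^ 3 * q * q ^ k" "k \<in> set [0..<M]"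
        using rin unfolding rm_def set_map by (rule imageE)
      have "(2 * \<delta>) ^ 3 * norm q ^ Suc M \<le> norm t ^ 3 * norm q ^ Suc k"
        by (intro mult_mono power_mono power_decreasing) (use t \<delta> r norm_q in auto)
      also have "\<dots> = norm r" by (simp add: r norm_mult norm_power)
      finally have le: "(2 * \<delta>) ^ 3 * norm q ^ Suc M \<le> norm r" .
      have "0 < (2 * \<delta>) ^ 3 * norm q ^ Suc M" using \<delta> norm_q_pos by simp
      then have "inverse (norm r) \<le> inverse ((2 * \<delta>) ^ 3 * norm q ^ Suc M)"
        by (rule le_imp_inverse_le[OF le])
      then show ?thesis by (simp only: L_def norm_inverse norm_divide norm_one inverse_eq_divide)
    qed
    have rmB': "norm r \<le> B" if "r \<in> set (map inverse rm)" for r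
      using that rmB B0 by (auto simp: B_def intro: add_increasing)
    have rm0: "0 \<notin> set rm" using t0 by (auto simp: rm_def)
    have lens: "length rp = M" "length rm = M" by (simp_all add: rp_def rm_def)
    have lM: "norm (t ^ 3 * q\<^sup>2 * q ^ M) \<le> l" "norm (t ^ 3 * q * q ^ M) \<le> l"
    proof -
      have "norm t ^ 3 * norm q ^ Suc (Suc M) \<le> T ^ 3 * norm q ^ Suc M"
        by (intro mult_mono t3 power_decreasing) (use norm_q T0 in auto)
      then show "norm (t ^ 3 * q\<^sup>2 * q ^ M) \<le> l"
        by (simp add: l_def norm_mult norm_power power2_eq_square mult_ac)
      show "norm (t ^ 3 * q * q ^ M) \<le> l"
        using mult_right_mono[OF t3, of "norm q ^ Suc M"] by (simp add: l_def norm_mult norm_power mult_ac)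
    qed
    have plus: "norm (shift_poly rp u (int m)) \<le> C1 * l ^ m" if m: "m \<ge> N" for m
    proof -
      obtain \<phi> where p: "\<phi> holomorphic_on ball 0 \<rho>1" "\<forall>x\<in>ball 0 \<rho>1 - {0}. norm (\<phi> x) \<le> K1"
        "\<forall>n\<ge>N. u (int n) = (t ^ 3 * q\<^sup>2) ^ n * \<phi> (q ^ n)"
        using 1(3)[OF t qN(1) Nij, folded u_def] by (elim exE conjE) (rule that)
      obtain \<psi> where psi: "\<forall>x\<in>ball 0 \<rho>1 - {0}. norm (\<psi> x) \<le> C1"
        "\<forall>n\<ge>N. shift_poly rp u (int n) = (t ^ 3 * q\<^sup>2 * q ^ M) ^ n * \<psi> (q ^ n)"
        using C1(2)[THEN spec[of _ "t ^ 3 * q\<^sup>2"], THEN spec[of _ \<phi>], THEN spec[of _ u], THEN spec[of _ N],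
            THEN mp, OF r1(1), THEN mp, OF p(1), THEN mp, OF p(2), THEN mp, OF qN(1), THEN mp, OF p(3), folded rp_def]
        by (elim exE conjE) (rule that)
      have "norm q ^ m \<le> norm q ^ N" using norm_q m by (intro power_decreasing) auto
      then have "norm (\<psi> (q ^ m)) \<le> C1" using psi(1) qN(1) by (auto simp: norm_power)
      moreover have "norm (t ^ 3 * q\<^sup>2 * q ^ M) ^ m \<le> l ^ m" by (intro power_mono lM) auto
      ultimately have "norm (t ^ 3 * q\<^sup>2 * q ^ M) ^ m * norm (\<psi> (q ^ m)) \<le> l ^ m * C1"
        by (intro mult_mono) (use l in auto)
      then show ?thesis using psi(2) m by (simp add: norm_mult norm_power mult.commute)
    qed
    have minus0: "norm (shift_poly rm (\<lambda>n. u (- n)) (int m)) \<le> C2 * l ^ m" if m: "m \<ge> N" for m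
    proof -
      have Nij': "int N \<ge> \<bar>- i\<bar>" "int N \<ge> \<bar>- j\<bar>" using Nij by simp_all
      obtain \<phi> where p: "\<phi> holomorphic_on ball 0 \<rho>2" "\<forall>x\<in>ball 0 \<rho>2 - {0}. norm (\<phi> x) \<le> K2"
        "\<forall>n\<ge>N. uf (- i) (- j) t (int n) = (t ^ 3 * q\<^sup>2) ^ n * \<phi> (q ^ n)"
        using 2(3)[OF t qN(2) Nij'] by (elim exE conjE) (rule that)
      define \<phi>' where "\<phi>' = (\<lambda>x. q powi (- i - j) * \<phi> x)"
      have p': "\<phi>' holomorphic_on ball 0 \<rho>2" unfolding \<phi>'_def by (intro holomorphic_intros p)
      have p'': "\<forall>x\<in>ball 0 \<rho>2 - {0}. norm (\<phi>' x) \<le> K2'"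
        unfolding \<phi>'_def K2'_def norm_mult using p(2) by (auto intro!: mult_left_mono)
      have eq: "\<forall>n\<ge>N. u (- int n) = (t ^ 3 * q) ^ n * \<phi>' (q ^ n)"
      proof (intro allI impI)
        fix n assume n: "n \<ge> N"
        have "u (- int n) = q powi (- i - j - int n) * ((t ^ 3 * q\<^sup>2) ^ n * \<phi> (q ^ n))"
          using p(3) n by (simp add: u_def uf_uminus)
        also have "q powi (- i - j - int n) = q powi (- i - j) / q ^ n"
          using power_int_diff[of q "- i - j" "int n"] by simp
        also have "(t ^ 3 * q\<^sup>2) ^ n = (t ^ 3 * q) ^ n * q ^ n"
          by (simp add: power_mult_distrib power2_eq_square)
        finally show "u (- int n) = (t ^ 3 * q) ^ n * \<phi>' (q ^ n)" by (simp add: \<phi>'_def)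
      qed
      obtain \<psi> where psi: "\<forall>x\<in>ball 0 \<rho>2 - {0}. norm (\<psi> x) \<le> C2"
        "\<forall>n\<ge>N. shift_poly rm (\<lambda>n. u (- n)) (int n) = (t ^ 3 * q * q ^ M) ^ n * \<psi> (q ^ n)"
        using C2(2)[THEN spec[of _ "t ^ 3 * q"], THEN spec[of _ \<phi>'], THEN spec[of _ "\<lambda>n. u (- n)"], THEN spec[of _ N],
            THEN mp, OF r1(2), THEN mp, OF p', THEN mp, OF p'', THEN mp, OF qN(2), THEN mp, OF eq, folded rm_def]
        by (elim exE conjE) (rule that)
      have "norm q ^ m \<le> norm q ^ N" using norm_q m by (intro power_decreasing) auto
      then have "norm (\<psi> (q ^ m)) \<le> C2" using psi(1) qN(2) by (auto simp: norm_power)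
      moreover have "norm (t ^ 3 * q * q ^ M) ^ m \<le> l ^ m" by (intro power_mono lM) auto
      ultimately have "norm (t ^ 3 * q * q ^ M) ^ m * norm (\<psi> (q ^ m)) \<le> l ^ m * C2"
        by (intro mult_mono) (use l in auto)
      then show ?thesis using psi(2) m by (simp add: norm_mult norm_power mult.commute)
    qed
    have minus: "norm (shift_poly (map inverse rm) u (- int m)) \<le> L ^ M * C2 * (1 / l) ^ M * l ^ m" if m: "m \<ge> N + M" for m
    proof -
      have "shift_poly (map inverse rm) u (- int m) =
          (\<Prod>r\<leftarrow>rm. - inverse r) * shift_poly rm (\<lambda>n. u (- n)) (int (m - M))"
        using fun_cong[OF shift_poly_uminus_index[OF rm0, of "\<lambda>n. u (- n)"], of "- int m"] m
        by (simp add: lens of_nat_diff)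
      moreover have "norm (\<Prod>r\<leftarrow>rm. - inverse r) \<le> L ^ length rm"
        using rmB
      proof (induction rm)
        case (Cons r rm)
        then show ?case using L0 unfolding list.map prod_list.Cons norm_mult list.size
          by (simp del: norm_inverse) (intro mult_mono, auto)
      qed simp
      moreover have "norm (shift_poly rm (\<lambda>n. u (- n)) (int (m - M))) \<le> C2 * l ^ (m - M)"
        using m by (intro minus0) simp
      ultimately have "norm (shift_poly (map inverse rm) u (- int m)) \<le> L ^ M * (C2 * l ^ (m - M))"
        unfolding lens by (simp add: norm_mult mult_mono' L0 less_imp_le)
      also have "l ^ (m - M) = (1 / l) ^ M * l ^ m"
        using l m by (simp add: power_diff power_one_over field_simps)
      finally show ?thesis by (simp add: mult_ac)
    qed
    show "norm (shift_poly (map (\<lambda>f. f t) (rootfs M)) (uf i j t) n) \<le> D * l ^ nat \<bar>n\<bar>"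
    proof (cases "n \<ge> 0")
      case True
      then obtain m where m: "n = int m" "m \<ge> N" using n by (metis nonneg_int_cases abs_of_nonneg nat_int add_leE)
      have "norm (shift_poly (map inverse rm) (shift_poly rp u) (int m)) \<le>
          ((1 + B) / l) ^ length (map inverse rm) * C1 * l ^ m"
        by (rule shift_poly_geometric_right[OF rmB' _ C1(1) l(1) _ plus m(2)]) (use B0 L0 l in \<open>auto simp: B_def\<close>)
      also have "\<dots> \<le> D * l ^ m"
        unfolding D_def using l B0 L0 lens by (intro mult_right_mono mult_left_mono) (auto simp: B_def)
      finally show ?thesis by (simp add: maps shift_poly_append m u_def)
    next
      case False
      then obtain m where m: "n = - int m" "m \<ge> N + M + M" using n
        by (metis nonneg_int_cases abs_of_neg linorder_not_le nat_int neg_0_le_iff_le order_less_imp_le minus_minus)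
      have "norm (shift_poly rp (shift_poly (map inverse rm) u) (- int m)) \<le>
          ((1 + B) / l) ^ length rp * (L ^ M * C2 * (1 / l) ^ M) * l ^ m"
        by (rule shift_poly_geometric_left[OF rpB _ _ l(1) _ minus])
          (use B0 L0 l C2 m lens in \<open>auto simp: B_def\<close>)
      also have "\<dots> \<le> D * l ^ m"
        unfolding D_def using l B0 L0 lens by (intro mult_right_mono mult_left_mono) (auto simp: B_def)
      finally show ?thesis by (simp add: maps shift_poly_append shift_poly_commute[of rp] m u_def)
    qed
  qed (use l in auto)
qed

end


section \<open>Local continuation of the regularised sum in t\<close>

context qbase
begin

definition cprod :: "int \<Rightarrow> int \<Rightarrow> complex \<Rightarrow> int \<Rightarrow> complex" where
  "cprod i j t n = cc t (i - n) * cc t (j - n) * cc t n"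

lemma cprod_eq_uf: "cprod i j t n = 1 / (ph q * ph (t\<^sup>2 * q)) ^ 3 * uf i j t n"
  by (simp add: cprod_def uf_def cc_def power3_eq_cube)

lemma rootfs_holomorphic: "f \<in> set (rootfs M) \<Longrightarrow> f holomorphic_on - {0}"
  unfolding rootfs_def by (auto intro!: holomorphic_intros)

text \<open>The roots move holomorphically with t, so the regularised sequence is holomorphic in t
  term by term, and the geometric bound makes its sum \<open>W\<close> holomorphic. Poles can come
  only from roots that take the value 1.\<close>

lemma regsum_uf:
  assumes t0: "t0 \<noteq> 0" and M: "norm t0 ^ 3 * norm q ^ Suc M < 1"
  obtains \<delta> W where "\<delta> > 0" "W holomorphic_on ball t0 \<delta>" "0 \<notin> ball t0 \<delta>"
    "\<And>t. t \<in> ball t0 \<delta> \<Longrightarrow> \<forall>f\<in>set (rootfs M). f t \<noteq> 1 \<Longrightarrow>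
       regsum (uf i j t) (W t / (\<Prod>f\<leftarrow>rootfs M. 1 - f t))"
proof -
  have "((\<lambda>T. T ^ 3 * norm q ^ Suc M) \<longlongrightarrow> norm t0 ^ 3 * norm q ^ Suc M) (at_right (norm t0))"
    by (intro tendsto_intros)
  then have "\<forall>\<^sub>F T in at_right (norm t0). T ^ 3 * norm q ^ Suc M < 1"
    using M by (rule order_tendstoD(2))
  then obtain b where b: "b > norm t0" "\<forall>T>norm t0. T < b \<longrightarrow> T ^ 3 * norm q ^ Suc M < 1"
    unfolding eventually_at_right_field by (elim exE conjE) (rule that)
  define d where "d = b - norm t0"
  have d: "d > 0" using b(1) by (simp add: d_def)
  define T where "T = norm t0 + d / 2"
  have T3: "T ^ 3 * norm q ^ Suc M < 1"
  proof -
    have "norm t0 < T" "T < b" unfolding T_def using d d_def by linarith+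
    then show ?thesis using b(2) by blast
  qed
  define \<delta> where "\<delta> = min (d / 2) (norm t0 / 2)"
  have \<delta>: "\<delta> > 0" using d t0 by (simp add: \<delta>_def)
  define e where "e = norm t0 / 4"
  have e: "e > 0" using t0 by (simp add: e_def)
  have V: "2 * e \<le> norm t" "norm t \<le> T" "t \<noteq> 0" if "t \<in> cball t0 \<delta>" for t
  proof -
    have *: "norm (t0 - t) \<le> d / 2" "norm (t0 - t) \<le> norm t0 / 2"
      using that by (auto simp: \<delta>_def dist_norm)
    show "2 * e \<le> norm t" using *(2) norm_triangle_ineq2[of t0 t] by (simp add: e_def)
    then show "t \<noteq> 0" using e by auto
    show "norm t \<le> T" using *(1) norm_triangle_ineq2[of t t0] by (simp add: T_def norm_minus_commute)
  qed
  have eT: "2 * e \<le> T" using V(1,2)[of t0] \<delta> by simp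
  obtain N C l where b: "C \<ge> 0" "0 < l" "l < 1"
    "\<And>t n. 2 * e \<le> norm t \<Longrightarrow> norm t \<le> T \<Longrightarrow> nat \<bar>n\<bar> \<ge> N \<Longrightarrow>
       norm (shift_poly (map (\<lambda>f. f t) (rootfs M)) (uf i j t) n) \<le> C * l ^ nat \<bar>n\<bar>"
    by (rule uf_regularised_bound[OF e eT T3, of i j]) (rule that)
  define w where "w = (\<lambda>n t. shift_poly (map (\<lambda>f. f t) (rootfs M)) (uf i j t) n)"
  have wh: "w n holomorphic_on cball t0 \<delta>" for n
    unfolding w_def
  proof (rule shift_poly_holomorphic)
    show "f holomorphic_on cball t0 \<delta>" if "f \<in> set (rootfs M)" for f
      by (rule holomorphic_on_subset[OF rootfs_holomorphic[OF that]]) (use V(3) in blast)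
  qed (rule uf_holomorphic)
  have "\<exists>c. \<forall>t\<in>cball t0 \<delta>. norm (w n t) \<le> c" for n
  proof -
    have "bounded (w n ` cball t0 \<delta>)"
      by (intro compact_imp_bounded compact_continuous_image holomorphic_on_imp_continuous_on wh compact_cball)
    then show ?thesis unfolding bounded_iff by auto
  qed
  then obtain c where c: "\<And>n t. t \<in> cball t0 \<delta> \<Longrightarrow> norm (w n t) \<le> c n" by metis
  \<comment> \<open>The uniform geometric bound holds for |n| >= N only; the finitely many other
    terms are bounded by their maxima on the compact disc.\<close>
  define B where "B = (\<lambda>n. C * l ^ nat \<bar>n\<bar> + (if nat \<bar>n\<bar> < N then \<bar>c n\<bar> else 0))"
  have Bs: "B summable_on UNIV" unfolding B_def
  proof (rule summable_on_add)
    show "(\<lambda>n. C * l ^ nat \<bar>n\<bar>) summable_on UNIV"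
      using b by (intro summable_on_cmult_right summable_on_int_geometric) auto
    have "finite {n. nat \<bar>n\<bar> < N}"
      by (rule finite_subset[of _ "{- int N..int N}"]) auto
    then show "(\<lambda>n. if nat \<bar>n\<bar> < N then \<bar>c n\<bar> else 0) summable_on UNIV"
      by (rule finite_nonzero_values_imp_summable_on[OF finite_subset[rotated]]) auto
  qed
  have wB: "norm (w n t) \<le> B n" if "t \<in> cball t0 \<delta>" for n t
  proof (cases "nat \<bar>n\<bar> < N")
    case True
    then show ?thesis using c[OF that, of n] b by (simp add: B_def add_increasing)
  next
    case False
    then show ?thesis using b(4)[OF V(1,2)[OF that], of n] by (simp add: B_def w_def)
  qed
  define W where "W = (\<lambda>t. \<Sum>\<^sub>\<infinity>n. w n t)"
  have Wh: "W holomorphic_on ball t0 \<delta>"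
    unfolding W_def
  proof (rule holomorphic_on_infsum)
    show "w n holomorphic_on ball t0 \<delta>" for n
      by (rule holomorphic_on_subset[OF wh ball_subset_cball])
    fix x assume "x \<in> ball t0 \<delta>"
    then obtain r where r: "r > 0" "cball x r \<subseteq> ball t0 \<delta>" using open_contains_cball open_ball by blast
    then have "cball x r \<subseteq> cball t0 \<delta>" using ball_subset_cball by blast
    then show "\<exists>d>0. cball x d \<subseteq> ball t0 \<delta> \<and> (\<exists>B. B summable_on UNIV \<and>
        (\<forall>n\<in>UNIV. \<forall>y\<in>cball x d. norm (w n y) \<le> B n))"
      using r Bs wB by (intro exI[of _ r] conjI exI[of _ B]) auto
  qed simp
  have "regsum (uf i j t) (W t / (\<Prod>f\<leftarrow>rootfs M. 1 - f t))"
    if t: "t \<in> ball t0 \<delta>" and nr: "\<forall>f\<in>set (rootfs M). f t \<noteq> 1" for t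
  proof -
    have tc: "t \<in> cball t0 \<delta>" using t by simp
    have "(\<lambda>n. w n t) summable_on UNIV"
      by (rule abs_summable_summable, rule Infinite_Sum.abs_summable_on_comparison_test'[OF Bs]) (rule wB[OF tc])
    then have hs: "((\<lambda>n. w n t) has_sum W t) UNIV" unfolding W_def by (rule has_sum_infsum)
    have pm: "(\<Prod>r\<leftarrow>map (\<lambda>f. f t) fs. 1 - r) = (\<Prod>f\<leftarrow>fs. 1 - f t)" for fs :: "(complex \<Rightarrow> complex) list"
      by (induction fs) auto
    have nz: "(\<Prod>f\<leftarrow>rootfs M. 1 - f t) \<noteq> 0" using nr by (auto simp: prod_list_zero_iff)
    show ?thesis unfolding regsum_def
    proof (intro exI[of _ "map (\<lambda>f. f t) (rootfs M)"] conjI)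
      show "0 \<notin> set (map (\<lambda>f. f t) (rootfs M))" using V(3)[OF tc] by (auto simp: rootfs_def)
      show "1 \<notin> set (map (\<lambda>f. f t) (rootfs M))" using nr by force
      show "(shift_poly (map (\<lambda>f. f t) (rootfs M)) (uf i j t) has_sum
          (\<Prod>r\<leftarrow>map (\<lambda>f. f t) (rootfs M). 1 - r) * (W t / (\<Prod>f\<leftarrow>rootfs M. 1 - f t))) UNIV"
        using hs nz unfolding pm w_def by simp
    qed
  qed
  note R = this
  have "0 \<notin> ball t0 \<delta>" using V(3) ball_subset_cball[of t0 \<delta>] by blast
  then show thesis by (rule that[OF \<delta> Wh]) (rule R)
qed

end

section \<open>The constant term as a meromorphic function of k\<close>

context qcircle
begin

text \<open>Where no regularised sum exists the value is unspecified. Such points are isolated, and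
  \<open>remove_sings\<close> later replaces the value there.\<close>

definition ctm :: "int \<Rightarrow> int \<Rightarrow> complex \<Rightarrow> complex" where
  "ctm i j k = (THE S. regsum (cprod i j (qpar a powr k)) S)"

lemma ctm_eqI: "regsum (cprod i j (qpar a powr k)) S \<Longrightarrow> ctm i j k = S"
  unfolding ctm_def using regsum_unique by blast

lemma powr_holomorphic [holomorphic_intros]: "(\<lambda>k. qpar a powr k) holomorphic_on A"
  unfolding qpar_powr by (intro holomorphic_intros) (use a_pos in auto)

lemma powr_nonzero [simp]: "qpar a powr k \<noteq> 0"
  by (simp add: qpar_powr)

lemma norm_powr_less_1: "Re k > 0 \<Longrightarrow> norm (qpar a powr k) < 1"
  using a_pos by (simp add: qpar_powr Re_divide_of_real)

text \<open>The common denominator of the local formulas: one factor for every root of the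
  regularisation, and the normalisation of c to the third power.\<close>

definition nondeg :: "nat \<Rightarrow> complex \<Rightarrow> complex" where
  "nondeg M k = (\<Prod>f\<leftarrow>rootfs M. 1 - f (qpar a powr k)) * (ph (qpar a) * ph ((qpar a powr k)\<^sup>2 * qpar a)) ^ 3"

lemma prod_list_holomorphic:
  assumes "\<And>f. f \<in> set fs \<Longrightarrow> (\<lambda>k. 1 - f (g k)) holomorphic_on A"
  shows "(\<lambda>k::complex. \<Prod>f\<leftarrow>fs. 1 - f (g k) :: complex) holomorphic_on A"
  using assms by (induction fs) (simp_all add: holomorphic_on_mult)

lemma nondeg_holomorphic: "nondeg M holomorphic_on A"
proof -
  have "(\<lambda>k. 1 - f (qpar a powr k)) holomorphic_on A" if "f \<in> set (rootfs M)" for f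
    using that unfolding rootfs_def by (auto intro!: holomorphic_intros)
  then have "(\<lambda>k. \<Prod>f\<leftarrow>rootfs M. 1 - f (qpar a powr k)) holomorphic_on A"
    by (rule prod_list_holomorphic)
  then show ?thesis unfolding nondeg_def by (intro holomorphic_intros)
qed

lemma nondeg_nonzeroI:
  assumes "\<And>j. (qpar a powr k) ^ 3 * qpar a ^ Suc j \<noteq> 1" "\<And>j. (qpar a powr k)\<^sup>2 * qpar a ^ Suc j \<noteq> 1"
  shows "nondeg M k \<noteq> 0"
proof -
  let ?t = "qpar a powr k"
  have "?t ^ 3 * (qpar a)\<^sup>2 * qpar a ^ n \<noteq> 1" for n
    using assms(1)[of "Suc n"] by (auto simp: power2_eq_square mult_ac)
  moreover have "inverse (?t ^ 3 * qpar a * qpar a ^ n) \<noteq> 1" for n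
    unfolding inverse_eq_1_iff using assms(1)[of n] by (simp add: mult_ac)
  ultimately have "(\<Prod>f\<leftarrow>rootfs M. 1 - f ?t) \<noteq> 0"
    by (auto simp: prod_list_zero_iff rootfs_def)
  moreover have "ph (?t\<^sup>2 * qpar a) \<noteq> 0"
    using assms(2) by (auto simp: ph_eq_0_iff mult_ac)
  ultimately show ?thesis by (simp add: nondeg_def)
qed

lemma nondeg_nonzero_right:
  assumes "Re k > 0"
  shows "nondeg M k \<noteq> 0"
proof (rule nondeg_nonzeroI)
  have t: "norm (qpar a powr k) < 1"
    using assms by (rule norm_powr_less_1)
  have lt: "norm ((qpar a powr k) ^ m * qpar a ^ Suc j) < 1" for m j
  proof -
    have "norm (qpar a powr k) ^ m * norm (qpar a) ^ Suc j \<le> 1 * norm (qpar a) ^ Suc j"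
      using t by (intro mult_right_mono power_le_one) auto
    also have "\<dots> < 1" unfolding mult_1 by (simp only: power_Suc_less_one norm_q_pos norm_q)
    finally show ?thesis by (simp add: norm_mult norm_power)
  qed
  show "(qpar a powr k) ^ 3 * qpar a ^ Suc j \<noteq> 1" "(qpar a powr k)\<^sup>2 * qpar a ^ Suc j \<noteq> 1" for j
    using lt[of 3 j] lt[of 2 j] by (metis less_irrefl norm_one)+
qed

lemma ctm_local:
  assumes M: "norm (qpar a powr k0) ^ 3 * norm (qpar a) ^ Suc M < 1"
  obtains U H where "open U" "k0 \<in> U" "H holomorphic_on U"
    "\<And>k. k \<in> U \<Longrightarrow> nondeg M k \<noteq> 0 \<Longrightarrow> regsum (cprod i j (qpar a powr k)) (H k / nondeg M k)"
proof -
  obtain \<delta> W where W: "\<delta> > 0" "W holomorphic_on ball (qpar a powr k0) \<delta>" "0 \<notin> ball (qpar a powr k0) \<delta>"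
    "\<And>t. t \<in> ball (qpar a powr k0) \<delta> \<Longrightarrow> \<forall>f\<in>set (rootfs M). f t \<noteq> 1 \<Longrightarrow>
       regsum (uf i j t) (W t / (\<Prod>f\<leftarrow>rootfs M. 1 - f t))"
    by (rule regsum_uf[OF powr_nonzero M, of i j]) (rule that)
  define U where "U = (\<lambda>k. qpar a powr k) -` ball (qpar a powr k0) \<delta>"
  have "continuous_on UNIV (\<lambda>k. qpar a powr k)"
    by (intro holomorphic_on_imp_continuous_on powr_holomorphic)
  then have "open U" unfolding U_def by (intro open_vimage open_ball)
  moreover have "k0 \<in> U" using W(1) by (simp add: U_def)
  moreover have "(\<lambda>k. W (qpar a powr k)) holomorphic_on U"
    using holomorphic_on_compose_gen[OF powr_holomorphic W(2), of U] by (auto simp: U_def o_def)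
  moreover have "regsum (cprod i j (qpar a powr k)) (W (qpar a powr k) / nondeg M k)"
    if "k \<in> U" "nondeg M k \<noteq> 0" for k
  proof -
    have "\<forall>f\<in>set (rootfs M). f (qpar a powr k) \<noteq> 1"
      using that(2) by (force simp: nondeg_def prod_list_zero_iff)
    then have "regsum (uf i j (qpar a powr k)) (W (qpar a powr k) / (\<Prod>f\<leftarrow>rootfs M. 1 - f (qpar a powr k)))"
      using that(1) by (intro W(4)) (simp_all add: U_def)
    from regsum_cmult[OF this, of "1 / (ph (qpar a) * ph ((qpar a powr k)\<^sup>2 * qpar a)) ^ 3"]
    show ?thesis unfolding cprod_eq_uf[abs_def] nondeg_def by (simp add: mult.commute)
  qed
  ultimately show thesis by (rule that)
qed

lemma exists_M:
  obtains M where "norm (qpar a powr k0) ^ 3 * norm (qpar a) ^ Suc M < 1"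
proof -
  obtain M where M: "norm (qpar a) ^ M < 1 / norm (qpar a powr k0) ^ 3"
    using real_arch_pow_inv[of "1 / norm (qpar a powr k0) ^ 3" "norm (qpar a)"] norm_q by auto
  have "norm (qpar a) ^ Suc M \<le> norm (qpar a) ^ M" using norm_q by (intro power_decreasing) auto
  then have "norm (qpar a) ^ Suc M < 1 / norm (qpar a powr k0) ^ 3" using M by linarith
  then have "norm (qpar a powr k0) ^ 3 * norm (qpar a) ^ Suc M < 1" by (simp add: field_simps)
  then show thesis by (rule that)
qed

lemma ctm_meromorphic: "ctm i j meromorphic_on UNIV"
proof -
  have "ctm i j meromorphic_on {k0}" for k0
  proof -
    obtain M where M: "norm (qpar a powr k0) ^ 3 * norm (qpar a) ^ Suc M < 1" by (rule exists_M)
    obtain U H where U: "open U" "k0 \<in> U" "H holomorphic_on U"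
      "\<And>k. k \<in> U \<Longrightarrow> nondeg M k \<noteq> 0 \<Longrightarrow> regsum (cprod i j (qpar a powr k)) (H k / nondeg M k)"
      by (rule ctm_local[OF M]) (rule that)
    \<comment> \<open>The entire function \<open>nondeg M\<close> is nonzero at k = 1, so its zeros
      are isolated.\<close>
    have "\<forall>\<^sub>F k in at k0. nondeg M k \<noteq> 0 \<and> k \<in> UNIV"
      by (rule non_zero_neighbour_alt[of _ _ _ 1]) (auto intro!: nondeg_holomorphic nondeg_nonzero_right)
    moreover have "\<forall>\<^sub>F k in at k0. k \<in> U" using U(1,2) by (rule eventually_at_in_open')
    ultimately have "\<forall>\<^sub>F k in at k0. ctm i j k = H k / nondeg M k"
      by eventually_elim (use U(4) in \<open>auto intro!: ctm_eqI\<close>)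
    moreover have "(\<lambda>k. H k / nondeg M k) meromorphic_on {k0}"
    proof (intro meromorphic_on_divide analytic_on_imp_meromorphic_on)
      show "H analytic_on {k0}" using U by (auto simp: analytic_at)
      show "nondeg M analytic_on {k0}" using nondeg_holomorphic[of M UNIV] by (auto simp: analytic_at)
    qed
    ultimately show ?thesis by (subst meromorphic_on_cong) auto
  qed
  then show ?thesis using meromorphic_on_meromorphic_at by blast
qed

lemma ctm_analytic:
  assumes M: "norm (qpar a powr k0) ^ 3 * norm (qpar a) ^ Suc M < 1" and nz: "nondeg M k0 \<noteq> 0"
  shows "ctm i j analytic_on {k0}"
proof -
  obtain U H where U: "open U" "k0 \<in> U" "H holomorphic_on U"
    "\<And>k. k \<in> U \<Longrightarrow> nondeg M k \<noteq> 0 \<Longrightarrow> regsum (cprod i j (qpar a powr k)) (H k / nondeg M k)"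
    by (rule ctm_local[OF M]) (rule that)
  define V where "V = U \<inter> {k. nondeg M k \<noteq> 0}"
  have "continuous_on UNIV (nondeg M)"
    by (intro holomorphic_on_imp_continuous_on nondeg_holomorphic)
  then have "open (nondeg M -` (- {0}))" by (intro open_vimage) auto
  moreover have "V = U \<inter> (nondeg M -` (- {0}))" by (auto simp: V_def)
  ultimately have "open V" using U(1) by auto
  have "(\<lambda>k. H k / nondeg M k) holomorphic_on V"
    by (intro holomorphic_intros holomorphic_on_subset[OF U(3)] nondeg_holomorphic) (auto simp: V_def)
  then have "ctm i j holomorphic_on V"
    by (rule holomorphic_transform) (auto simp: V_def intro!: ctm_eqI[symmetric] U(4))
  then show ?thesis using \<open>open V\<close> U(2) nz by (auto simp: analytic_at V_def)
qed

definition ctf :: "laurent2 \<Rightarrow> complex \<Rightarrow> complex" where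
  "ctf f k = (\<Sum>(i, j)\<in>Poly_Mapping.keys f. Poly_Mapping.lookup f (i, j) * ctm (- i) (- j) k)"

lemma ctf_meromorphic: "ctf f meromorphic_on UNIV"
  unfolding ctf_def[abs_def] case_prod_unfold
  by (intro meromorphic_on_sum meromorphic_on_mult meromorphic_on_const ctm_meromorphic)

lemma ctf_analytic:
  assumes "norm (qpar a powr k0) ^ 3 * norm (qpar a) ^ Suc M < 1" "nondeg M k0 \<noteq> 0"
  shows "ctf f analytic_on {k0}"
  unfolding ctf_def[abs_def] case_prod_unfold
  by (intro analytic_on_sum analytic_on_mult analytic_on_const ctm_analytic[OF assms])

lemma nicely_meromorphic_remove_sings:
  assumes "g nicely_meromorphic_on A" "z \<in> A"
  shows "remove_sings g z = g z"
  using assms unfolding nicely_meromorphic_on_def by (metis remove_sings_at_pole remove_sings_eqI)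

text \<open>For Re k > 0 the regularised sum is an ordinary one and equals the defining series. Any
  other candidate agrees with it on a half plane, hence everywhere off a discrete set; being nicely
  meromorphic fixes the remaining values.\<close>

lemma ct_eq: "ct a f = remove_sings (ctf f)"
  unfolding ct_def
proof (rule the_equality)
  have right: "remove_sings (ctf f) k = ct_series (qpar a) (qpar a powr k) f" if k: "Re k > 0" for k
  proof -
    have t: "norm (qpar a powr k) < 1"
      using k by (rule norm_powr_less_1)
    have "norm (qpar a powr k) ^ 3 * norm (qpar a) ^ Suc 0 < 1 * 1"
      by (intro mult_le_less_imp_less power_le_one) (use t norm_q in auto)
    then have "ctf f analytic_on {k}"
      using nondeg_nonzero_right[OF k] by (intro ctf_analytic[of _ 0]) auto
    then have "remove_sings (ctf f) k = ctf f k" by simp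
    also have "ctm i j k = mu_coeff (qpar a) (qpar a powr k) i j" for i j
    proof (rule ctm_eqI, rule regsum_has_sum)
      show "(cprod i j (qpar a powr k) has_sum mu_coeff (qpar a) (qpar a powr k) i j) UNIV"
        using mu_coeff_eq[OF t, of j i] unfolding cprod_def[abs_def] by (simp add: mult_ac)
    qed
    then have "ctf f k = ct_series (qpar a) (qpar a powr k) f"
      by (simp add: ctf_def ct_series_def)
    finally show ?thesis .
  qed
  show "remove_sings (ctf f) nicely_meromorphic_on UNIV \<and>
      (\<forall>k. Re k > 0 \<longrightarrow> remove_sings (ctf f) k = ct_series (qpar a) (qpar a powr k) f)"
    using right remove_sings_nicely_meromorphic[OF ctf_meromorphic] by blast
  fix g assume g: "g nicely_meromorphic_on UNIV \<and>
      (\<forall>k. Re k > 0 \<longrightarrow> g k = ct_series (qpar a) (qpar a powr k) f)"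
  define h where "h = (\<lambda>k. g k - remove_sings (ctf f) k)"
  have hm: "h meromorphic_on UNIV"
    unfolding h_def using g remove_sings_nicely_meromorphic[OF ctf_meromorphic, of f]
    by (intro meromorphic_on_diff) (auto simp: nicely_meromorphic_on_def)
  have h0: "h k = 0" if "Re k > 0" for k using g right[OF that] that by (simp add: h_def)
  have "(\<forall>\<^sub>\<approx>k\<in>UNIV. h k = 0) \<or> (\<forall>\<^sub>\<approx>k\<in>UNIV. h k \<noteq> 0)"
    by (rule meromorphic_imp_constant_or_avoid[OF hm]) auto
  then have ev: "\<forall>\<^sub>\<approx>k\<in>UNIV. h k = 0"
  proof
    assume "\<forall>\<^sub>\<approx>k\<in>UNIV. h k \<noteq> 0"
    then have "\<forall>\<^sub>F k in at 1. h k \<noteq> 0" by (simp add: eventually_cosparse_open_eq)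
    moreover have "\<forall>\<^sub>F k in at 1. Re k > 0"
      using eventually_at_in_open'[OF open_halfspace_Re_gt[of 0], of 1] by simp
    ultimately have "\<forall>\<^sub>F k in at (1 :: complex). False"
      by eventually_elim (use h0 in auto)
    then show ?thesis by simp
  qed
  show "g = remove_sings (ctf f)"
  proof
    fix z
    have "\<forall>\<^sub>F k in at z. g k = remove_sings (ctf f) k"
      using ev by (simp add: eventually_cosparse_open_eq h_def)
    then have "remove_sings g z = remove_sings (remove_sings (ctf f)) z"
      by (rule remove_sings_cong) simp
    then show "g z = remove_sings (ctf f) z"
      using nicely_meromorphic_remove_sings[of g UNIV z] g
        nicely_meromorphic_remove_sings[OF remove_sings_nicely_meromorphic[OF ctf_meromorphic], of z] by simp
  qed
qed

lemma ct_nicely_meromorphic: "ct a f nicely_meromorphic_on UNIV"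
  unfolding ct_eq by (rule remove_sings_nicely_meromorphic[OF ctf_meromorphic])

text \<open>At these points the continuation is analytic, so removing singularities changes nothing,
  and any regularised sums that can be exhibited give the value.\<close>

lemma ct_eqI:
  assumes "\<And>j. (qpar a powr k) ^ 3 * qpar a ^ Suc j \<noteq> 1" "\<And>j. (qpar a powr k)\<^sup>2 * qpar a ^ Suc j \<noteq> 1"
    and "\<And>i j. (i, j) \<in> Poly_Mapping.keys f \<Longrightarrow> regsum (cprod (- i) (- j) (qpar a powr k)) (S i j)"
  shows "ct a f k = (\<Sum>(i, j)\<in>Poly_Mapping.keys f. Poly_Mapping.lookup f (i, j) * S i j)"
proof -
  obtain M where M: "norm (qpar a powr k) ^ 3 * norm (qpar a) ^ Suc M < 1" by (rule exists_M)
  have "ctf f analytic_on {k}" by (rule ctf_analytic[OF M nondeg_nonzeroI[OF assms(1,2)]])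
  then have "ct a f k = ctf f k" by (simp add: ct_eq)
  then show ?thesis using ctm_eqI[OF assms(3)] by (auto simp: ctf_def intro!: sum.cong)
qed

end


section \<open>The strip \<open>- l - 1/2 < Re k < - l\<close>\<close>

context qbase
begin

lemma zeta1_eq: "zeta1 q t m Z = rho0 q t * t powi (- 2 * int m) *
     (\<Prod>j=1..m. ((1 - t\<^sup>2 * q ^ j) * (1 - t\<^sup>2 * (q ^ j / Z))) / ((1 - q ^ j) * (1 - q ^ j / Z))) *
     (ph (q / Z) * ph (Z / t) / (ph (t * Z) * ph (t\<^sup>2 * q / Z)))"
proof -
  have "prodinf (\<lambda>j. ((1 - q ^ (j + 1) / Z) * (1 - inverse t * (Z * q ^ j))) /
           ((1 - t * (Z * q ^ j)) * (1 - t\<^sup>2 * (q ^ (j + 1) / Z)))) =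
      prodinf (\<lambda>j. ((1 - q / Z * q ^ j) * (1 - Z / t * q ^ j)) / ((1 - t * Z * q ^ j) * (1 - t\<^sup>2 * q / Z * q ^ j)))"
    by (simp add: divide_inverse mult_ac)
  also have "\<dots> = ph (q / Z) * ph (Z / t) / (ph (t * Z) * ph (t\<^sup>2 * q / Z))"
    unfolding ph_def by (simp only: prodinf_divide prodinf_mult convergent_prod_mult convergent_ph)
  finally show ?thesis unfolding zeta1_def by (simp only:)
qed

lemma zeta2_eq: "zeta2 q t m Z = rho0 q t * t powi (- 2 * int m - 1) *
     (\<Prod>j=1..m. ((1 - t\<^sup>2 * q ^ j) * (1 - t\<^sup>2 * (Z * q ^ j))) / ((1 - q ^ j) * (1 - Z * q ^ j))) *
     (ph (Z * q) * ph (q / (t * Z)) / (ph (t * q / Z) * ph (t\<^sup>2 * q * Z)))"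
proof -
  have "prodinf (\<lambda>j. ((1 - Z * q ^ (j + 1)) * (1 - inverse t * (q ^ (j + 1) / Z))) /
           ((1 - t * (q ^ (j + 1) / Z)) * (1 - t\<^sup>2 * (Z * q ^ (j + 1))))) =
      prodinf (\<lambda>j. ((1 - Z * q * q ^ j) * (1 - q / (t * Z) * q ^ j)) / ((1 - t * q / Z * q ^ j) * (1 - t\<^sup>2 * q * Z * q ^ j)))"
    by (simp add: divide_inverse mult_ac)
  also have "\<dots> = ph (Z * q) * ph (q / (t * Z)) / (ph (t * q / Z) * ph (t\<^sup>2 * q * Z))"
    unfolding ph_def by (simp only: prodinf_divide prodinf_mult convergent_prod_mult convergent_ph)
  finally show ?thesis unfolding zeta2_def by (simp only:)
qed

lemma Rk_Suc: "Rk t (Suc m) = Rk t m * ((1 - t\<^sup>2 * q ^ Suc m) / (1 - q ^ Suc m)) / t"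
  by (simp add: Rk_def gk_Suc)

lemma powi_minus_double_Suc: "t \<noteq> 0 \<Longrightarrow> t powi (- 2 * int (Suc m) - n) = t powi (- 2 * int m - n) / (t * t)"
  for t :: complex
proof -
  have e: "- 2 * int (Suc m) - n = (- 2 * int m - n) - 2" by simp
  assume "t \<noteq> 0"
  then show ?thesis unfolding e by (subst power_int_diff) (simp_all add: power2_eq_square)
qed

lemma prod_to_Suc: "(\<Prod>j=1..Suc m. g j) = (\<Prod>j=1..m. g j) * (g (Suc m) :: complex)"
  by simp

lemma regroup: "A * (P / D) * (Q * f) * R = A * P * Q * R / D * f" for A P D Q f R :: complex
  by simp

lemma regroup2: "R * (A * B) / (t * t) * ((c * d) / (e * f)) = R * (c / e) / t * (A * (B * d / t / f))"
  for R A B t c d e f :: complex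
  by (simp add: mult_ac)

text \<open>With X = 1/(t q^m) and Y = Z the factor of X has a pole, which contributes
  \<open>Rk t m\<close>; the factors of Y and X Y give the two values of \<open>dl\<close>. The
  induction uses quasi-periodicity at w = Z / (t q^(m+1)).\<close>

lemma zeta1_dl:
  assumes "t \<noteq> 0" "Z \<noteq> 0" "\<And>i. Z * q ^ i \<noteq> 1" "\<And>i. q ^ Suc i \<noteq> Z"
    "\<And>i. t * q ^ Suc i \<noteq> Z" "\<And>i. t\<^sup>2 * q ^ Suc i \<noteq> Z"
  shows "zeta1 q t m Z = Rk t m * (dl t Z * dl t (1 / (t * q ^ m) * Z))"
proof (induction m)
  case 0
  have "ph Z \<noteq> 0" "ph (t * q / Z) \<noteq> 0"
    using assms by (auto simp: ph_eq_0_iff field_simps)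
  then show ?case using assms(1,2)
    by (simp add: zeta1_eq Rk_def gk_def dl_def power2_eq_square mult_ac)
next
  case (Suc m)
  define x where "x = q ^ Suc m"
  have x0: "x \<noteq> 0" by (simp add: x_def)
  have nx: "x \<noteq> Z" "t * x \<noteq> Z" "t\<^sup>2 * x \<noteq> Z"
    using assms(4,5,6)[of m] by (simp_all add: x_def)
  define w where "w = 1 / (t * x) * Z"
  have qw: "q * w = 1 / (t * q ^ m) * Z" by (simp add: w_def x_def)
  have "dl t (q * w) * (w - t) = dl t w * (t * w - 1)"
    using nx assms x0 by (intro dl_q_shift) (auto simp: w_def field_simps power2_eq_square)
  moreover have "w - t = Z / (t * x) * (1 - t\<^sup>2 * (x / Z))" "t * w - 1 = Z / x * (1 - x / Z)"
    using assms x0 by (simp_all add: w_def field_simps power2_eq_square)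
  ultimately have "Z / x * (dl t w * (1 - x / Z)) = Z / x * (dl t (q * w) * (1 - t\<^sup>2 * (x / Z)) / t)"
    by (simp add: mult_ac)
  then have dw: "dl t w * (1 - x / Z) = dl t (q * w) * (1 - t\<^sup>2 * (x / Z)) / t"
    using assms x0 by (subst (asm) mult_left_cancel) auto
  have nz: "1 - x / Z \<noteq> 0" using nx assms by simp
  have dw': "dl t w = dl t (q * w) * (1 - t\<^sup>2 * (x / Z)) / t / (1 - x / Z)"
    unfolding nonzero_eq_divide_eq[OF nz] by (rule dw)
  have "zeta1 q t (Suc m) Z = zeta1 q t m Z / (t * t) *
      (((1 - t\<^sup>2 * x) * (1 - t\<^sup>2 * (x / Z))) / ((1 - x) * (1 - x / Z)))"
  proof -
    have pw: "t powi (- 2 * int (Suc m)) = t powi (- 2 * int m) / (t * t)"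
      using powi_minus_double_Suc[OF assms(1), of m 0] by (simp only: diff_0_right)
    show ?thesis unfolding zeta1_eq pw prod_to_Suc x_def by (rule regroup)
  qed
  also have "\<dots> = Rk t (Suc m) * (dl t Z * (dl t (q * w) * (1 - t\<^sup>2 * (x / Z)) / t / (1 - x / Z)))"
    unfolding Suc Rk_Suc qw[symmetric] x_def[symmetric] by (rule regroup2)
  finally show ?case unfolding dw'[symmetric] by (simp add: w_def x_def)
qed

text \<open>Here the pole is in the factor of X Y = 1/(t q^m) with Y = Z. The factor of X = 1/(t q^m
  Z) becomes \<open>dl t (t * q ^ Suc m * Z)\<close> by the symmetry of \<open>dl\<close>; poles at
  t q^(m+1) lead to the same function.\<close>

lemma zeta2_dl:
  assumes "t \<noteq> 0" "Z \<noteq> 0" "\<And>i. Z * q ^ i \<noteq> 1" "\<And>i. q ^ Suc i \<noteq> Z" "\<And>i. t * Z * q ^ i \<noteq> 1"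
    "\<And>i. t\<^sup>2 * Z * q ^ Suc i \<noteq> 1"
  shows "zeta2 q t m Z = Rk t m * (dl t Z * dl t (t * q ^ Suc m * Z))"
proof (induction m)
  case 0
  have nz: "1 - Z \<noteq> 0" "1 - t * Z \<noteq> 0" "Z - 1 \<noteq> 0" using assms(3,5)[of 0] by auto
  have nz2: "ph (q / Z) \<noteq> 0" "ph (t * q * Z) \<noteq> 0"
    using assms(2,4) assms(5)[of "Suc _"] by (auto simp: ph_eq_0_iff field_simps)
  have r: "ph Z = (1 - Z) * ph (Z * q)" "ph (t * Z) = (1 - t * Z) * ph (t * q * Z)"
    "ph (1 / (t * Z)) = (1 - 1 / (t * Z)) * ph (q / (t * Z))" "ph (1 / Z) = (1 - 1 / Z) * ph (q / Z)"
    using ph_rec[of Z] ph_rec[of "t * Z"] ph_rec[of "1 / (t * Z)"] ph_rec[of "1 / Z"] by (simp_all add: mult_ac)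
  have e: "q / (t * q * Z) = 1 / (t * Z)" "t * q / (t * q * Z) = 1 / Z" "t * (t * q * Z) = t\<^sup>2 * q * Z"
    using assms by (simp_all add: power2_eq_square)
  have frac: "(1 - Z) * (1 - 1 / (t * Z)) / ((1 - t * Z) * (1 - 1 / Z)) = 1 / t"
  proof -
    have "(1 - Z) * (1 - 1 / (t * Z)) * t = (1 - t * Z) * (1 - 1 / Z)"
      using assms by (simp add: field_simps)
    moreover have "1 - 1 / Z \<noteq> 0" using nz assms by auto
    ultimately show ?thesis using nz assms(1)
      frac_eq_eq[of "(1 - t * Z) * (1 - 1 / Z)" t "(1 - Z) * (1 - 1 / (t * Z))" 1] by simp
  qed
  have "dl t Z * dl t (t * q * Z) = ph (Z * q) * ph (q / (t * Z)) / (ph (t * q / Z) * ph (t\<^sup>2 * q * Z)) *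
      ((1 - Z) * (1 - 1 / (t * Z)) / ((1 - t * Z) * (1 - 1 / Z)))"
    unfolding dl_def e r using nz2 by (simp add: mult_ac)
  then have "dl t Z * dl t (t * q * Z) = ph (Z * q) * ph (q / (t * Z)) / (ph (t * q / Z) * ph (t\<^sup>2 * q * Z)) * (1 / t)"
    unfolding frac .
  then show ?case by (simp add: zeta2_eq Rk_def gk_def power_int_minus divide_inverse mult_ac)
next
  case (Suc m)
  define x where "x = q ^ Suc m"
  have nx: "x * Z \<noteq> 1" "t * x * Z \<noteq> 1" "t\<^sup>2 * x * Z \<noteq> 1"
    using assms(3)[of "Suc m"] assms(5)[of "Suc m"] assms(6)[of m] by (simp_all add: x_def mult_ac)
  define w where "w = t * x * Z"
  have "dl t (q * w) * (w - t) = dl t w * (t * w - 1)"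
    using nx assms by (intro dl_q_shift) (auto simp: w_def x_def power2_eq_square mult_ac)
  moreover have "w - t = - t * (1 - Z * x)" "t * w - 1 = - (1 - t\<^sup>2 * (Z * x))"
    by (simp_all add: w_def algebra_simps power2_eq_square)
  ultimately have dw: "dl t (q * w) * (1 - Z * x) = dl t w * (1 - t\<^sup>2 * (Z * x)) / t"
    using assms(1) by (simp add: field_simps)
  have nz: "1 - Z * x \<noteq> 0" using nx by (simp add: mult.commute)
  have dw': "dl t (q * w) = dl t w * (1 - t\<^sup>2 * (Z * x)) / t / (1 - Z * x)"
    unfolding nonzero_eq_divide_eq[OF nz] by (rule dw)
  have "zeta2 q t (Suc m) Z = zeta2 q t m Z / (t * t) *
      (((1 - t\<^sup>2 * x) * (1 - t\<^sup>2 * (Z * x))) / ((1 - x) * (1 - Z * x)))"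
    unfolding zeta2_eq powi_minus_double_Suc[OF assms(1), of m 1] prod_to_Suc x_def by (rule regroup)
  also have "\<dots> = Rk t (Suc m) * (dl t Z * (dl t w * (1 - t\<^sup>2 * (Z * x)) / t / (1 - Z * x)))"
    unfolding Suc Rk_Suc x_def[symmetric] w_def[symmetric] by (rule regroup2)
  finally show ?case unfolding dw'[symmetric] by (simp add: w_def x_def mult_ac)
qed

end

text \<open>For t = q^k the two inequalities say Re k < -l and Re k > -l - 1/2. The last assumption
  removes the possible poles of the constant term.\<close>

locale strip = qcircle +
  fixes t :: complex and l :: nat
  assumes t_big: "norm (t * qpar a ^ l) > 1" and t_small: "norm (t\<^sup>2 * qpar a ^ Suc (2 * l)) < 1"
    and t_cube: "\<And>j. t ^ 3 * qpar a ^ Suc j \<noteq> 1"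
begin

abbreviation "q \<equiv> qpar a"

lemma q_pow_mono: "m \<le> n \<Longrightarrow> norm q ^ n \<le> norm q ^ m"
  using norm_q by (intro power_decreasing) auto

lemma norm_q_double: "norm q ^ (2 * l) = norm q ^ l * norm q ^ l" "norm q ^ (l * 2) = norm q ^ l * norm q ^ l"
  by (simp_all only: mult_2 mult_2_right power_add)

lemma big: "k \<le> l \<Longrightarrow> norm (t * q ^ k) > 1"
  using t_big mult_left_mono[OF q_pow_mono[of k l], of "norm t"] by (simp add: norm_mult norm_power)

lemma t_gt_1: "norm t > 1"
  using big[of 0] by simp

lemma t_nonzero [simp]: "t \<noteq> 0"
  using t_gt_1 by auto

lemma big2: "k \<le> 2 * l \<Longrightarrow> norm (t\<^sup>2 * q ^ k) > 1"
proof -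
  assume k: "k \<le> 2 * l"
  have "1 * 1 < norm (t * q ^ l) * norm (t * q ^ l)"
    by (intro mult_strict_mono t_big) auto
  also have "\<dots> = norm t ^ 2 * norm q ^ (2 * l)"
    by (simp add: norm_mult norm_power power2_eq_square norm_q_double mult_ac)
  also have "\<dots> \<le> norm t ^ 2 * norm q ^ k" by (intro mult_left_mono q_pow_mono k) auto
  finally show ?thesis by (simp add: norm_mult norm_power)
qed

lemma small2: "k > 2 * l \<Longrightarrow> norm (t\<^sup>2 * q ^ k) \<le> norm (t\<^sup>2 * q ^ Suc (2 * l))"
  unfolding norm_mult norm_power by (intro mult_left_mono q_pow_mono) auto

lemma small: "k > l \<Longrightarrow> norm (t * q ^ k) \<le> norm (t * q ^ Suc l)"
  unfolding norm_mult norm_power by (intro mult_left_mono q_pow_mono) auto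

lemma small_Suc: "norm (t * q ^ Suc l) < 1"
proof (rule ccontr)
  assume "\<not> ?thesis"
  then have "1 * 1 \<le> norm (t * q ^ Suc l) * norm (t * q ^ Suc l)" by (intro mult_mono) auto
  also have "\<dots> = norm (t\<^sup>2 * q ^ Suc (Suc (2 * l)))"
    by (simp add: norm_mult norm_power power2_eq_square norm_q_double mult_ac)
  also have "\<dots> \<le> norm (t\<^sup>2 * q ^ Suc (2 * l))" by (rule small2) simp
  finally show False using t_small by simp
qed

lemma t_q_powi: "t * q powi m \<noteq> 1"
proof (cases "m \<ge> 0")
  case True
  then have eq: "q powi m = q ^ nat m" by (simp add: power_int_def)
  have "norm (t * q ^ nat m) \<noteq> 1"
    using big[of "nat m"] small[of "nat m"] small_Suc by (cases "nat m \<le> l") auto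
  then show ?thesis unfolding eq by (metis norm_one)
next
  case False
  have "0 < norm q ^ nat (- m)" "norm q ^ nat (- m) \<le> 1"
    using norm_q_pos norm_q by (auto intro: power_le_one)
  then have "1 \<le> inverse (norm q ^ nat (- m))" by (rule one_le_inverse)
  moreover have "norm (q powi m) = inverse (norm q ^ nat (- m))"
    using False by (simp add: power_int_def norm_power norm_inverse power_inverse)
  ultimately have "1 \<le> norm (q powi m)" by simp
  then have "norm t * 1 \<le> norm t * norm (q powi m)" by (intro mult_left_mono) auto
  then have "norm (t * q powi m) > 1" unfolding norm_mult using t_gt_1 by linarith
  then show ?thesis by (metis less_irrefl norm_one)
qed

lemma t_q_pow: "t * q ^ m \<noteq> 1" "t * q ^ m \<noteq> q ^ n"
proof -
  show "t * q ^ m \<noteq> 1" using t_q_powi[of "int m"] by simp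
  show "t * q ^ m \<noteq> q ^ n"
    using t_q_powi[of "int m - int n"] by (simp add: power_int_diff)
qed

lemma t2: "t\<^sup>2 * q ^ Suc i \<noteq> 1"
proof -
  have "norm (t\<^sup>2 * q ^ Suc i) \<noteq> 1"
    using big2[of "Suc i"] small2[of "Suc i"] t_small by (cases "Suc i \<le> 2 * l") auto
  then show ?thesis by (metis norm_one)
qed

definition nopole :: "complex \<Rightarrow> bool" where
  "nopole Z \<longleftrightarrow> Z \<noteq> 0 \<and> (\<forall>i. t * Z * q ^ i \<noteq> 1) \<and> (\<forall>i. t * q ^ Suc i \<noteq> Z)"

lemma nopole_q: "nopole (q powi m)"
  unfolding nopole_def
proof (intro conjI allI)
  show "t * q powi m * q ^ i \<noteq> 1" for i
    using t_q_powi[of "m + int i"] by (simp add: power_int_add mult.assoc)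
  show "t * q ^ Suc i \<noteq> q powi m" for i
  proof
    assume eq: "t * q ^ Suc i = q powi m"
    have "q powi (int (Suc i) - m) = q ^ Suc i / q powi m"
      by (subst power_int_diff, simp, simp only: power_int_of_nat)
    then have "t * q powi (int (Suc i) - m) = t * q ^ Suc i / q powi m" by (simp only: times_divide_eq_right)
    then have "t * q powi (int (Suc i) - m) = 1" unfolding eq by simp
    then show False using t_q_powi by blast
  qed
qed simp

text \<open>One of the two pole conditions would read t^3 q^(j+1) = 1: residues taken twice are
  finite exactly off the exceptional points.\<close>

lemma nopole_t2: "nopole (t\<^sup>2 * q ^ Suc N)"
  unfolding nopole_def
proof (intro conjI allI)
  show "t * (t\<^sup>2 * q ^ Suc N) * q ^ i \<noteq> 1" for i
    using t_cube[of "N + i"] by (simp add: power_add power3_eq_cube power2_eq_square mult_ac)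
  show "t * q ^ Suc i \<noteq> t\<^sup>2 * q ^ Suc N" for i
    using t_q_pow(2)[of N i] by (simp add: power2_eq_square)
qed simp

lemma nopole_inverse_t2: "nopole (1 / (t\<^sup>2 * q ^ N))"
  unfolding nopole_def
proof (intro conjI allI)
  show "t * (1 / (t\<^sup>2 * q ^ N)) * q ^ i \<noteq> 1" for i
    using t_q_pow(2)[of N i] by (simp add: field_simps power2_eq_square)
  show "t * q ^ Suc i \<noteq> 1 / (t\<^sup>2 * q ^ N)" for i
    using t_cube[of "N + i"] by (simp add: power_add power3_eq_cube power2_eq_square field_simps)
qed simp

lemma dl_inverse_t2: "dl t (1 / (t\<^sup>2 * q ^ N)) = dl t (t\<^sup>2 * q ^ Suc N)"
  using dl_reflect[of "t\<^sup>2 * q ^ Suc N" t] by simp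

text \<open>The poles 1/(t q^k) with k <= l have entered the unit circle. The other family starts at
  t q rather than t, so only l of its members have left the circle.\<close>

definition dn :: "int \<Rightarrow> complex" where "dn = UU (Suc l) l t"

lemma regsum_dn:
  assumes "nopole (1 / s)"
  shows "regsum (\<lambda>n. dn (j - n) * s powi n) (s powi j * dl t (1 / s))"
proof -
  have s: "s \<noteq> 0" using assms by (auto simp: nopole_def)
  have "regsum (\<lambda>n. dn n * (1 / s) powi n) (dl t (1 / s))"
    unfolding dn_def using assms t2 s by (intro regsum_UU) (auto simp: nopole_def)
  from regsum_cmult[OF regsum_reflect[OF this, of j], of "s powi j"]
  show ?thesis using s by (simp add: power_int_divide_distrib power_int_diff mult_ac)
qed

lemma regsum_dn_q: "regsum (\<lambda>n. dn (j - n) * (q powi m) powi n) 0"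
  using regsum_dn[of "q powi m" j] nopole_q[of "- m"] dl_q_powi[of t "- m"]
  by (simp add: power_int_minus divide_inverse)

lemma regsum_dn_t2: "regsum (\<lambda>n. dn (j - n) * (t\<^sup>2 * q ^ N) powi n) ((t\<^sup>2 * q ^ N) powi j * dl t (t\<^sup>2 * q ^ Suc N))"
  using regsum_dn[OF nopole_inverse_t2[of N], of j] unfolding dl_inverse_t2 .

lemma regsum_dn_inverse_t2: "regsum (\<lambda>n. dn (j - n) * (1 / (t\<^sup>2 * q ^ Suc N)) powi n)
    ((t\<^sup>2 * q ^ Suc N) powi (- j) * dl t (t\<^sup>2 * q ^ Suc N))"
proof -
  define x where "x = t\<^sup>2 * q ^ Suc N"
  have e: "(1 / x) powi j = x powi (- j)" "1 / (1 / x) = x"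
    by (simp_all add: divide_inverse power_int_inverse power_int_minus)
  have "nopole x" unfolding x_def by (rule nopole_t2)
  then have "nopole (1 / (1 / x))" by (simp only: e(2))
  from regsum_dn[OF this, of j] show ?thesis unfolding e x_def[symmetric] .
qed

text \<open>These are the largest moduli below 1 in the four sequences q^j, t q^j, t^2 q^j and 1/(t
  q^k) with k <= l. Up to the unit circle, no singularity of the integrands lies outside the radius
  \<open>r0\<close>.\<close>

definition r0 :: real where
  "r0 = Max {norm q, norm (t * q ^ Suc l), norm (t\<^sup>2 * q ^ Suc (2 * l)), 1 / norm (t * q ^ l)}"

lemma r0_less_1: "r0 < 1"
proof -
  have "1 / norm (t * q ^ l) < 1" using t_big by (simp add: divide_less_eq)
  then show ?thesis unfolding r0_def using norm_q small_Suc t_small by (subst Max_less_iff) auto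
qed

lemma r0_ge: "norm q \<le> r0" "norm (t * q ^ Suc l) \<le> r0" "norm (t\<^sup>2 * q ^ Suc (2 * l)) \<le> r0"
    "1 / norm (t * q ^ l) \<le> r0"
  unfolding r0_def by (intro Max_ge; simp)+

lemma r0_pos: "r0 > 0" using r0_ge(1) norm_q_pos by linarith

lemma annulus:
  assumes Z: "r0 < norm Z" "norm Z \<le> 1"
  shows "Z \<noteq> 0" "q ^ Suc i \<noteq> Z" "t * q ^ Suc i \<noteq> Z" "t\<^sup>2 * q ^ Suc i \<noteq> Z"
    "Z * q ^ Suc i \<noteq> 1" "t * Z * q ^ i \<noteq> 1" "t\<^sup>2 * Z * q ^ Suc i \<noteq> 1"
    "k \<le> l \<Longrightarrow> norm (t * q ^ k * Z) > 1" "k \<le> 2 * l \<Longrightarrow> norm (t\<^sup>2 * q ^ k * Z) > 1"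
proof -
  show Z0: "Z \<noteq> 0" using Z r0_pos by auto
  have "norm (q ^ Suc i) \<le> norm q" using q_pow_mono[of 1 "Suc i"] by (simp add: norm_power norm_mult)
  then have qi: "norm (q ^ Suc i) < norm Z" using r0_ge(1) Z by linarith
  then show "q ^ Suc i \<noteq> Z" by auto
  have "norm (t * q ^ Suc i) \<noteq> norm Z"
    using big[of "Suc i"] small[of "Suc i"] r0_ge(2) Z by (cases "Suc i \<le> l") auto
  then show "t * q ^ Suc i \<noteq> Z" by metis
  have "norm (t\<^sup>2 * q ^ Suc i) \<noteq> norm Z"
    using big2[of "Suc i"] small2[of "Suc i"] r0_ge(3) Z by (cases "Suc i \<le> 2 * l") auto
  then show "t\<^sup>2 * q ^ Suc i \<noteq> Z" by metis
  have "norm Z * norm (q ^ Suc i) \<le> 1 * norm (q ^ Suc i)" using Z by (intro mult_right_mono) auto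
  also have "\<dots> < 1" using qi Z by simp
  finally have "norm (Z * q ^ Suc i) < 1" by (simp only: norm_mult)
  then show "Z * q ^ Suc i \<noteq> 1" by (metis less_irrefl norm_one)
  show b1: "norm (t * q ^ k * Z) > 1" if "k \<le> l" for k
  proof -
    have "1 / norm (t * q ^ l) < norm Z" using r0_ge(4) Z by linarith
    then have "1 < norm (t * q ^ l) * norm Z" using t_big by (simp add: divide_less_eq mult.commute)
    also have "\<dots> \<le> norm (t * q ^ k) * norm Z"
      unfolding norm_mult norm_power by (intro mult_right_mono mult_left_mono q_pow_mono that) auto
    finally show ?thesis by (simp only: norm_mult)
  qed
  show b2: "norm (t\<^sup>2 * q ^ k * Z) > 1" if "k \<le> 2 * l" for k
  proof -
    have "1 * 1 < norm (t * q ^ l) * norm (t * q ^ l * Z)"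
      by (intro mult_strict_mono t_big b1) auto
    also have "\<dots> = norm (t\<^sup>2 * q ^ (2 * l)) * norm Z"
      by (simp add: norm_mult norm_power power2_eq_square norm_q_double mult_ac)
    also have "\<dots> \<le> norm (t\<^sup>2 * q ^ k) * norm Z"
      unfolding norm_mult norm_power by (intro mult_right_mono mult_left_mono q_pow_mono that) auto
    finally show ?thesis by (simp only: norm_mult)
  qed
  have "norm (t * q ^ i * Z) \<noteq> 1"
  proof (cases "i \<le> l")
    case True then show ?thesis using b1[OF True] by simp
  next
    case False
    have "norm (t * q ^ i) * norm Z \<le> norm (t * q ^ i) * 1" using Z by (intro mult_left_mono) auto
    then have "norm (t * q ^ i * Z) \<le> norm (t * q ^ i)" by (simp only: norm_mult mult_1_right)
    then show ?thesis using False small[of i] small_Suc by auto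
  qed
  then show "t * Z * q ^ i \<noteq> 1" by (metis norm_one mult.assoc mult.commute)
  have "norm (t\<^sup>2 * q ^ Suc i * Z) \<noteq> 1"
  proof (cases "Suc i \<le> 2 * l")
    case True then show ?thesis using b2[OF True] by simp
  next
    case False
    have "norm (t\<^sup>2 * q ^ Suc i) * norm Z \<le> norm (t\<^sup>2 * q ^ Suc i) * 1" using Z by (intro mult_left_mono) auto
    then have "norm (t\<^sup>2 * q ^ Suc i * Z) \<le> norm (t\<^sup>2 * q ^ Suc i)" by (simp only: norm_mult mult_1_right)
    then show ?thesis using False small2[of "Suc i"] t_small by auto
  qed
  then show "t\<^sup>2 * Z * q ^ Suc i \<noteq> 1" by (metis norm_one mult.assoc mult.commute)
qed

lemma zeta_continuous:
  assumes "S \<subseteq> {Z. r0 < norm Z \<and> norm Z \<le> 1}"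
  shows "continuous_on S (zeta1 q t m)" "continuous_on S (zeta2 q t m)"
proof -
  have Z: "r0 < norm Z" "norm Z \<le> 1" if "Z \<in> S" for Z using that assms by auto
  have n1: "ph (t * Z) \<noteq> 0" "ph (t\<^sup>2 * q / Z) \<noteq> 0" "ph (t * q / Z) \<noteq> 0" "ph (t\<^sup>2 * q * Z) \<noteq> 0" if "Z \<in> S" for Z
    using annulus[OF Z[OF that]] by (auto simp: ph_eq_0_iff field_simps)
  have n2: "1 - q ^ j \<noteq> 0" "1 - q ^ j / Z \<noteq> 0" "1 - Z * q ^ j \<noteq> 0" if ZS: "Z \<in> S" and jm: "j \<in> {1..m}" for Z j
  proof -
    obtain i where j: "j = Suc i" using jm by (cases j) auto
    show "1 - q ^ j \<noteq> 0" using q_power_Suc_neq_1(1)[of i] j by (metis right_minus_eq)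
    show "1 - q ^ j / Z \<noteq> 0" "1 - Z * q ^ j \<noteq> 0"
      using annulus(1)[OF Z[OF ZS]] annulus(2)[OF Z[OF ZS], of i] annulus(5)[OF Z[OF ZS], of i] by (auto simp: j)
  qed
  have Z0: "Z \<noteq> 0" if "Z \<in> S" for Z using annulus(1)[OF Z[OF that]] .
  show "continuous_on S (zeta1 q t m)"
    unfolding zeta1_eq[abs_def] by (intro continuous_intros) (use n1 n2 Z0 in auto)
  show "continuous_on S (zeta2 q t m)"
    unfolding zeta2_eq[abs_def] by (intro continuous_intros) (use n1 n2 Z0 in auto)
qed

text \<open>For the intended p, a pole of \<open>dl t (p * Z)\<close> at Z = 1 is cancelled by a
  zero of \<open>dl t Z\<close>, and H is the continuous extension. The two Laurent series are
  multiplied on circles of radius r < 1. The resulting series does not depend on r, so neither does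
  the mean, and r -> 1 gives the integral over the unit circle.\<close>

lemma cmean_dl_product:
  assumes p: "p \<noteq> 0"
    and K: "\<And>k r. k < K \<Longrightarrow> r0 < r \<Longrightarrow> r < 1 \<Longrightarrow> norm (t * q ^ k * p) * r > 1"
      "\<And>r. r0 < r \<Longrightarrow> r < 1 \<Longrightarrow> norm (t * q ^ K * p) * r < 1"
    and L: "\<And>k r. k < L \<Longrightarrow> r0 < r \<Longrightarrow> r < 1 \<Longrightarrow> norm (t * q ^ Suc k) > norm p * r"
      "\<And>r. r0 < r \<Longrightarrow> r < 1 \<Longrightarrow> norm (t * q ^ Suc L) < norm p * r"
    and H: "continuous_on {Z. r0 < norm Z \<and> norm Z \<le> 1} H"
      "\<And>Z. r0 < norm Z \<Longrightarrow> norm Z < 1 \<Longrightarrow> H Z = c * (dl t Z * dl t (p * Z))"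
  shows "((\<lambda>n. c * (dn (J - n) * (UU K L t n * p powi n))) has_sum cmean a (\<lambda>Z. Z powi (- J) * H Z)) UNIV"
proof -
  define X where "X = (\<lambda>r::real. of_real r powi (- J) * cmean a (\<lambda>Z. Z powi (- J) * H (of_real r * Z)))"
  have hs: "((\<lambda>n. c * (dn (J - n) * (UU K L t n * p powi n))) has_sum X r) UNIV" if r: "r0 < r" "r < 1" for r
  proof -
    have rp: "r > 0" using r r0_pos by simp
    have A: "((\<lambda>n. dn n * of_real r powi n * Z powi n) has_sum dl t (of_real r * Z)) UNIV" if Z: "norm Z = 1" for Z
    proof -
      have nz: "norm (of_real r * Z) = r" using Z rp by (simp add: norm_mult)
      have ann: "r0 < norm (of_real r * Z)" "norm (of_real r * Z) \<le> 1" using r nz by simp_all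
      have "((\<lambda>n. UU (Suc l) l t n * (of_real r * Z) powi n) has_sum dl t (of_real r * Z)) UNIV"
      proof (rule UU_has_sum[OF t_gt_1 annulus(1)[OF ann] _ _ _ _ t2])
        show "1 < norm (t * q ^ k * (of_real r * Z))" if "k < Suc l" for k
          using annulus(8)[OF ann, of k] that by simp
        have "norm (t * q ^ Suc l) * r < 1 * 1" using small_Suc r rp by (intro mult_strict_mono) auto
        then show "norm (t * q ^ Suc l * (of_real r * Z)) < 1"
          unfolding norm_mult[of "t * q ^ Suc l"] nz by simp
        show "norm (of_real r * Z) < norm (t * q ^ Suc k)" if "k < l" for k
          using big[of "Suc k"] that r unfolding nz by simp
        show "norm (t * q ^ Suc l) < norm (of_real r * Z)"
          using r0_ge(2) r unfolding nz by simp
      qed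
      then show ?thesis by (simp add: dn_def power_int_mult_distrib mult.assoc)
    qed
    have B: "((\<lambda>n. UU K L t n * p powi n * of_real r powi n * Z powi n) has_sum dl t (p * (of_real r * Z))) UNIV"
      if Z: "norm Z = 1" for Z
    proof -
      have nz: "norm (p * (of_real r * Z)) = norm p * r" using Z rp by (simp add: norm_mult)
      have pr: "norm (t * q ^ k * (p * (of_real r * Z))) = norm (t * q ^ k * p) * r" for k
        using Z rp by (simp add: norm_mult mult_ac)
      have "p * (of_real r * Z) \<noteq> 0" using p rp Z by auto
      then have "((\<lambda>n. UU K L t n * (p * (of_real r * Z)) powi n) has_sum dl t (p * (of_real r * Z))) UNIV"
        using K L r by (intro UU_has_sum t_gt_1 t2) (simp_all only: nz pr not_False_eq_True)
      then show ?thesis by (simp add: power_int_mult_distrib mult.assoc)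
    qed
    have "((\<lambda>n. (dn (J - n) * of_real r powi (J - n)) * (UU K L t n * p powi n * of_real r powi n)) has_sum
       cmean a (\<lambda>Z. Z powi (- J) * (dl t (of_real r * Z) * dl t (p * (of_real r * Z))))) UNIV"
      by (rule cmean_product(1)[OF A B])
    from has_sum_cmult_right[OF this, of "c * of_real r powi (- J)"]
    have h: "((\<lambda>n. c * of_real r powi (- J) * ((dn (J - n) * of_real r powi (J - n)) * (UU K L t n * p powi n * of_real r powi n)))
      has_sum c * of_real r powi (- J) *
       cmean a (\<lambda>Z. Z powi (- J) * (dl t (of_real r * Z) * dl t (p * (of_real r * Z))))) UNIV" .
    have cont: "continuous_on (sphere 0 1) (\<lambda>Z. Z powi (- J) * (dl t (of_real r * Z) * dl t (p * (of_real r * Z))))"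
      by (intro continuous_on_mult cmean_product(2)[OF A B] cmean_product(2)[OF B A] continuous_intros) auto
    have "c * cmean a (\<lambda>Z. Z powi (- J) * (dl t (of_real r * Z) * dl t (p * (of_real r * Z)))) =
       cmean a (\<lambda>Z. c * (Z powi (- J) * (dl t (of_real r * Z) * dl t (p * (of_real r * Z)))))"
      by (rule cmean_cmult[OF cont, symmetric])
    also have "\<dots> = cmean a (\<lambda>Z. Z powi (- J) * H (of_real r * Z))"
      by (rule cmean_cong) (use r rp in \<open>simp add: H(2) norm_mult\<close>)
    finally have v: "c * of_real r powi (- J) *
       cmean a (\<lambda>Z. Z powi (- J) * (dl t (of_real r * Z) * dl t (p * (of_real r * Z)))) = X r"
    proof -
      assume v0: "c * cmean a (\<lambda>Z. Z powi (- J) * (dl t (of_real r * Z) * dl t (p * (of_real r * Z)))) =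
        cmean a (\<lambda>Z. Z powi (- J) * H (of_real r * Z))"
      have gen: "c * P * m = P * (c * m)" for P m :: complex by simp
      show ?thesis unfolding X_def v0[symmetric] by (rule gen)
    qed
    \<comment> \<open>The powers r^(-J), r^(J-n) and r^n cancel: the series whose sum is
      \<open>X r\<close> does not involve r.\<close>
    have eqn: "(\<lambda>n. c * of_real r powi (- J) * ((dn (J - n) * of_real r powi (J - n)) * (UU K L t n * p powi n * of_real r powi n))) =
      (\<lambda>n. c * (dn (J - n) * (UU K L t n * p powi n)))"
    proof
      fix n
      have one: "(of_real r :: complex) powi (- J) * of_real r powi (J - n) * of_real r powi n = 1"
        using rp by (simp flip: power_int_add)
      have gen: "c * x * ((d * y) * (u * z)) = x * y * z * (c * (d * u))" for x y z d u :: complex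
        by simp
      show "c * of_real r powi (- J) * ((dn (J - n) * of_real r powi (J - n)) * (UU K L t n * p powi n * of_real r powi n)) =
        c * (dn (J - n) * (UU K L t n * p powi n))"
        unfolding gen one by simp
    qed
    show ?thesis using h unfolding v eqn .
  qed
  define r1 where "r1 = (r0 + 1) / 2"
  have r1: "r0 < r1" "r1 < 1" using r0_less_1 by (simp_all add: r1_def)
  have const: "X r = X r1" if r: "r1 < r" "r < 1" for r
  proof -
    have "r0 < r" using r r1 by linarith
    then show ?thesis by (rule has_sum_unique[OF hs[OF _ r(2)] hs[OF r1]])
  qed
  have ul: "uniform_limit (sphere 0 1) (\<lambda>r Z. Z powi (- J) * H (of_real r * Z)) (\<lambda>Z. Z powi (- J) * H Z) (at_left 1)"
  proof (rule uniform_limitI)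
    fix e :: real assume e: "e > 0"
    define C where "C = {Z :: complex. r1 \<le> norm Z} \<inter> cball 0 1"
    have "compact C" unfolding C_def
      by (intro closed_Int_compact closed_Collect_le continuous_intros compact_cball)
    moreover have "continuous_on C H"
      by (rule continuous_on_subset[OF H(1)]) (use r1 in \<open>auto simp: C_def\<close>)
    ultimately have "uniformly_continuous_on C H" by (intro compact_uniformly_continuous)
    then obtain d where d: "d > 0" "\<And>x y. x \<in> C \<Longrightarrow> y \<in> C \<Longrightarrow> dist y x < d \<Longrightarrow> dist (H y) (H x) < e"
      by (rule uniformly_continuous_onE[OF _ e]) (rule that)
    have "\<forall>\<^sub>F r in at_left 1. max r1 (1 - d) < r \<and> r < 1"
      using r1 d(1) eventually_at_left_real[of "max r1 (1 - d)" 1] by (simp add: eventually_mono)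
    then show "\<forall>\<^sub>F r in at_left 1. \<forall>Z\<in>sphere 0 1. dist (Z powi (- J) * H (of_real r * Z)) (Z powi (- J) * H Z) < e"
    proof eventually_elim
      case (elim r)
      show ?case
      proof
        fix Z :: complex assume "Z \<in> sphere 0 1"
        then have Z: "norm Z = 1" by simp
        have rp: "r > 0" using elim r1 r0_pos by linarith
        have e: "of_real r * Z - Z = of_real (r - 1) * Z" by (simp add: algebra_simps)
        have "dist (of_real r * Z) Z = 1 - r"
          unfolding dist_norm e norm_mult norm_of_real Z using elim by simp
        then have "dist (H (of_real r * Z)) (H Z) < e"
          using elim Z rp r1 by (intro d(2)) (auto simp: C_def norm_mult)
        then show "dist (Z powi (- J) * H (of_real r * Z)) (Z powi (- J) * H Z) < e"
          unfolding dist_norm right_diff_distrib[symmetric] norm_mult norm_power_int Z by simp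
      qed
    qed
  qed
  have "\<forall>\<^sub>F r in at_left 1. r1 < r \<and> r < 1"
    using eventually_at_left_real[OF r1(2)] by simp
  then have evc: "\<forall>\<^sub>F r in at_left 1. continuous_on (sphere 0 1) (\<lambda>Z. Z powi (- J) * H (of_real r * Z))"
  proof eventually_elim
    case (elim r)
    then have "r > 0" using r1 r0_pos by linarith
    show ?case
    proof (intro continuous_on_mult)
      show "continuous_on (sphere 0 1) (\<lambda>Z. H (complex_of_real r * Z))"
        by (rule continuous_on_compose2[OF H(1)])
          (use elim r1 \<open>r > 0\<close> in \<open>auto intro!: continuous_intros simp: norm_mult\<close>)
    qed (intro continuous_intros, auto)
  qed
  have "((\<lambda>r. cmean a (\<lambda>Z. Z powi (- J) * H (of_real r * Z))) \<longlongrightarrow> cmean a (\<lambda>Z. Z powi (- J) * H Z)) (at_left 1)"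
    by (rule cmean_uniform_limit[OF evc ul]) simp
  moreover have "((\<lambda>r. (complex_of_real r) powi (- J)) \<longlongrightarrow> complex_of_real 1 powi (- J)) (at_left 1)"
    by (intro tendsto_intros) auto
  ultimately have lim1: "(X \<longlongrightarrow> complex_of_real 1 powi (- J) * cmean a (\<lambda>Z. Z powi (- J) * H Z)) (at_left 1)"
    unfolding X_def by (intro tendsto_mult)
  have "\<forall>\<^sub>F r in at_left 1. X r = X r1"
    using eventually_at_left_real[OF r1(2)] by (rule eventually_mono) (rule const; simp)
  then have lim2: "(X \<longlongrightarrow> X r1) (at_left 1)" by (rule tendsto_eventually)
  have "X r1 = complex_of_real 1 powi (- J) * cmean a (\<lambda>Z. Z powi (- J) * H Z)"
    by (rule tendsto_unique[OF trivial_limit_at_left_real lim2 lim1])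
  then show ?thesis using hs[OF r1] by simp
qed

end


section \<open>Sums with one crossed pole: single integrals and their residues\<close>

context strip
begin

definition I1 :: "nat \<Rightarrow> int \<Rightarrow> complex" where
  "I1 m J = cmean a (\<lambda>Z. Z powi (- J) * zeta1 q t m Z)"

definition I2 :: "nat \<Rightarrow> int \<Rightarrow> complex" where
  "I2 m J = cmean a (\<lambda>Z. Z powi (- J) * zeta2 q t m Z)"

text \<open>The residue at two poles: two crossed weights and the value of the third factor of mu.
  This is rho times a value of varpi_2, and \<open>BB\<close> is rho times a value of
  varpi_1.\<close>

definition AA :: "nat \<Rightarrow> nat \<Rightarrow> complex" where
  "AA k s = Rk t k * Rk t s * dl t (t\<^sup>2 * q ^ Suc (k + s))"

definition BB :: "nat \<Rightarrow> nat \<Rightarrow> complex" where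
  "BB k s = Rk t k * Rk t s * dl t (t\<^sup>2 * q ^ Suc (Suc (k + s)))"

text \<open>The residues are those at t^2 q^(m+k+1) with exponent at most 2 l, that is, of modulus
  greater than 1.\<close>

definition W1 :: "nat \<Rightarrow> int \<Rightarrow> complex" where
  "W1 m J = I1 m J + (\<Sum>k<2*l-m. AA m k * (t\<^sup>2 * q ^ Suc (m + k)) powi (- J))"

definition W2 :: "nat \<Rightarrow> int \<Rightarrow> complex" where
  "W2 m J = I2 m J + (\<Sum>k<2*l-m. BB m k * (t\<^sup>2 * q ^ Suc (m + k)) powi J)"

lemma cc_UU: "cc t n = UU K L t n + (\<Sum>k<K. Rk t k * (t * q ^ k) powi n) + (\<Sum>k<L. Rk t k * (t * q ^ Suc k) powi (- n))"
  by (simp add: UU_def)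

lemma powi_prod: "x powi n * p powi n = (x * p) powi n" "x powi (- n) * p powi n = (p / x) powi n" for x p :: complex
  by (simp_all only: power_int_mult_distrib divide_inverse power_int_inverse power_int_minus mult.commute)

text \<open>For p = 1/(t q^m) the circle |Z| = |p| r with r slightly below 1 has m poles of the
  first family inside and 2 l - m of the second family outside. Splitting c accordingly, the Laurent
  part gives the integral, the first group of exponentials becomes powers of q and vanishes, the
  second group gives \<open>AA\<close>.\<close>

lemma regsum_W1:
  assumes m: "m \<le> l"
  shows "regsum (\<lambda>n. Rk t m * (dn (J - n) * (cc t n * (1 / (t * q ^ m)) powi n))) (W1 m J)"
proof -
  define p where "p = 1 / (t * q ^ m)"
  have p0: "p \<noteq> 0" by (simp add: p_def)
  have np: "norm p * norm (t * q ^ m) = 1" by (simp add: p_def norm_divide norm_mult)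
  have npos: "norm (t * q ^ m) > 0" by simp
  have tp: "t * q ^ k * p = q powi (int k - int m)" for k
    by (simp add: p_def power_int_diff)
  have tp2: "p / (t * q ^ Suc k) = 1 / (t\<^sup>2 * q ^ Suc (m + k))" for k
    by (simp add: p_def power_add power2_eq_square mult_ac)
  have cp: "norm x < norm p * r" if "norm x * norm (t * q ^ m) < r" for x :: complex and r
  proof -
    have "norm x = norm x * norm (t * q ^ m) * norm p" using np by (simp only: mult.assoc mult.commute[of "norm p"] mult_1_right)
    also have "\<dots> < r * norm p" using that p0 by (intro mult_strict_right_mono) auto
    finally show ?thesis by (simp only: mult.commute)
  qed
  have cp': "norm p * r < norm x" if "r < norm x * norm (t * q ^ m)" for x :: complex and r
  proof -
    have "r * norm p < norm x * norm (t * q ^ m) * norm p" using that p0 by (intro mult_strict_right_mono) auto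
    also have "\<dots> = norm x" using np by (simp only: mult.assoc mult.commute[of "norm p"] mult_1_right)
    finally show ?thesis by (simp only: mult.commute)
  qed
  have prodn: "norm (t * q ^ k) * norm (t * q ^ m) = norm (t\<^sup>2 * q ^ (k + m))" for k
    by (simp add: norm_mult norm_power power_add power2_eq_square mult_ac)
  have "((\<lambda>n. Rk t m * (dn (J - n) * (UU m (2*l-m) t n * p powi n))) has_sum cmean a (\<lambda>Z. Z powi (- J) * zeta1 q t m Z)) UNIV"
  proof (rule cmean_dl_product[OF p0])
    fix k r assume r: "r0 < r" "r < 1"
    show "1 < norm (t * q ^ k * p) * r" if "k < m"
    proof -
      have "norm q ^ (m - k) \<le> norm q ^ 1" using that by (intro q_pow_mono) simp
      then have "norm q ^ (m - k) < r" using r0_ge(1) r by simp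
      moreover have "norm (t * q ^ k * p) * norm q ^ (m - k) = 1"
      proof -
        have "q ^ k * q ^ (m - k) = q ^ m" using that by (simp flip: power_add)
        then have "t * q ^ k * p * q ^ (m - k) = 1" by (simp add: p_def mult_ac)
        then show ?thesis by (metis norm_mult norm_one norm_power)
      qed
      moreover have "norm (t * q ^ k * p) > 0" using p0 by simp
      ultimately show ?thesis by (metis mult_strict_left_mono)
    qed
    show "norm p * r < norm (t * q ^ Suc k)" if "k < 2 * l - m"
    proof (rule cp')
      have "1 < norm (t\<^sup>2 * q ^ (Suc k + m))" using that by (intro big2) simp
      then show "r < norm (t * q ^ Suc k) * norm (t * q ^ m)" unfolding prodn using r by linarith
    qed
  next
    fix r assume r: "r0 < r" "r < 1"
    show "norm (t * q ^ m * p) * r < 1" using tp[of m] r by simp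
    have "Suc (2 * l - m) + m = Suc (2 * l)" using m by simp
    then show "norm (t * q ^ Suc (2 * l - m)) < norm p * r"
      using r0_ge(3) r by (intro cp) (simp only: prodn)
  next
    show "continuous_on {Z. r0 < norm Z \<and> norm Z \<le> 1} (zeta1 q t m)" by (rule zeta_continuous) simp
  next
    fix Z :: complex assume Z: "r0 < norm Z" "norm Z < 1"
    then have Z': "norm Z \<le> 1" by simp
    note ann = annulus[OF Z(1) Z']
    have "Z * q ^ i \<noteq> 1" for i
      using ann(5) Z(2) by (cases i) auto
    then show "zeta1 q t m Z = Rk t m * (dl t Z * dl t (p * Z))"
      unfolding p_def by (intro zeta1_dl) (use ann in auto)
  qed
  then have r1: "regsum (\<lambda>n. Rk t m * (dn (J - n) * (UU m (2*l-m) t n * p powi n))) (I1 m J)"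
    unfolding I1_def by (rule regsum_has_sum)
  have r2: "regsum (\<lambda>n. \<Sum>k<m. Rk t m * Rk t k * (dn (J - n) * (q powi (int k - int m)) powi n)) (\<Sum>k<m. Rk t m * Rk t k * 0)"
    by (intro regsum_sum regsum_cmult regsum_dn_q)
  have r3: "regsum (\<lambda>n. \<Sum>k<2*l-m. Rk t m * Rk t k * (dn (J - n) * (1 / (t\<^sup>2 * q ^ Suc (m + k))) powi n))
      (\<Sum>k<2*l-m. Rk t m * Rk t k * ((t\<^sup>2 * q ^ Suc (m + k)) powi (- J) * dl t (t\<^sup>2 * q ^ Suc (m + k))))"
    by (intro regsum_sum regsum_cmult regsum_dn_inverse_t2)
  have "regsum (\<lambda>n. Rk t m * (dn (J - n) * (UU m (2*l-m) t n * p powi n)) +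
      (\<Sum>k<m. Rk t m * Rk t k * (dn (J - n) * (q powi (int k - int m)) powi n)) +
      (\<Sum>k<2*l-m. Rk t m * Rk t k * (dn (J - n) * (1 / (t\<^sup>2 * q ^ Suc (m + k))) powi n)))
     (I1 m J + (\<Sum>k<m. Rk t m * Rk t k * 0) +
      (\<Sum>k<2*l-m. Rk t m * Rk t k * ((t\<^sup>2 * q ^ Suc (m + k)) powi (- J) * dl t (t\<^sup>2 * q ^ Suc (m + k)))))"
    by (intro regsum_add r1 r2 r3)
  moreover have "I1 m J + (\<Sum>k<m. Rk t m * Rk t k * 0) +
      (\<Sum>k<2*l-m. Rk t m * Rk t k * ((t\<^sup>2 * q ^ Suc (m + k)) powi (- J) * dl t (t\<^sup>2 * q ^ Suc (m + k)))) = W1 m J"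
    unfolding W1_def AA_def by (simp add: mult_ac)
  moreover have "(\<lambda>n. Rk t m * (dn (J - n) * (UU m (2*l-m) t n * p powi n)) +
      (\<Sum>k<m. Rk t m * Rk t k * (dn (J - n) * (q powi (int k - int m)) powi n)) +
      (\<Sum>k<2*l-m. Rk t m * Rk t k * (dn (J - n) * (1 / (t\<^sup>2 * q ^ Suc (m + k))) powi n))) =
      (\<lambda>n. Rk t m * (dn (J - n) * (cc t n * p powi n)))"
  proof
    fix n
    have "cc t n * p powi n = UU m (2*l-m) t n * p powi n + (\<Sum>k<m. Rk t k * (q powi (int k - int m)) powi n)
       + (\<Sum>k<2*l-m. Rk t k * (1 / (t\<^sup>2 * q ^ Suc (m + k))) powi n)"
      unfolding cc_UU[of n m "2*l-m"] distrib_right sum_distrib_right mult.assoc powi_prod tp[unfolded mult.assoc] tp2 ..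
    then show "Rk t m * (dn (J - n) * (UU m (2*l-m) t n * p powi n)) +
      (\<Sum>k<m. Rk t m * Rk t k * (dn (J - n) * (q powi (int k - int m)) powi n)) +
      (\<Sum>k<2*l-m. Rk t m * Rk t k * (dn (J - n) * (1 / (t\<^sup>2 * q ^ Suc (m + k))) powi n)) =
      Rk t m * (dn (J - n) * (cc t n * p powi n))"
      by (simp only: distrib_left sum_distrib_left mult_ac)
  qed
  ultimately show ?thesis by (simp only: p_def)
qed

text \<open>For p = t q^(m+1) the two groups of exponentials change roles: now the second family
  yields powers of q. There k = m is included, as r < 1 puts this pole outside the circle; hence
  \<open>Suc m\<close>.\<close>

lemma regsum_W2:
  assumes m: "m \<le> l"
  shows "regsum (\<lambda>n. Rk t m * (dn (J - n) * (cc t n * (t * q ^ Suc m) powi n))) (W2 m J)"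
proof -
  define p where "p = t * q ^ Suc m"
  have p0: "p \<noteq> 0" by (simp add: p_def)
  have tp: "t * q ^ k * p = t\<^sup>2 * q ^ Suc (m + k)" for k
    by (simp add: p_def power_add power2_eq_square mult_ac)
  have tp2: "p / (t * q ^ Suc k) = q powi (int m - int k)" for k
    by (simp add: p_def power_int_diff)
  have "((\<lambda>n. Rk t m * (dn (J - n) * (UU (2*l-m) (Suc m) t n * p powi n))) has_sum cmean a (\<lambda>Z. Z powi (- J) * zeta2 q t m Z)) UNIV"
  proof (rule cmean_dl_product[OF p0])
    fix k r assume r: "r0 < r" "r < 1"
    have rp: "r > 0" using r r0_pos by simp
    show "1 < norm (t * q ^ k * p) * r" if "k < 2 * l - m"
    proof -
      have "1 < norm (t\<^sup>2 * q ^ Suc (m + k) * of_real r)"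
        using r rp that by (intro annulus(9)) auto
      then show ?thesis unfolding tp using rp by (simp only: norm_mult norm_of_real abs_of_pos)
    qed
    show "norm p * r < norm (t * q ^ Suc k)" if "k < Suc m"
    proof -
      have "norm p * r < norm p * 1" using r p0 by (intro mult_strict_left_mono) auto
      also have "\<dots> \<le> norm (t * q ^ Suc k)"
        unfolding p_def norm_mult norm_power mult_1_right using that by (intro mult_left_mono q_pow_mono) auto
      finally show ?thesis .
    qed
  next
    fix r assume r: "r0 < r" "r < 1"
    have rp: "r > 0" using r r0_pos by simp
    have "Suc (m + (2 * l - m)) = Suc (2 * l)" using m by simp
    then have "norm (t * q ^ (2 * l - m) * p) = norm (t\<^sup>2 * q ^ Suc (2 * l))" unfolding tp by (simp only:)
    moreover have "norm (t\<^sup>2 * q ^ Suc (2 * l)) * r < 1 * 1"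
      using t_small r rp by (intro mult_strict_mono) auto
    ultimately show "norm (t * q ^ (2 * l - m) * p) * r < 1" by simp
    have "norm p * norm q < norm p * r" using r0_ge(1) r p0 by (intro mult_strict_left_mono) auto
    then show "norm (t * q ^ Suc (Suc m)) < norm p * r" by (simp add: p_def norm_mult norm_power mult_ac)
  next
    show "continuous_on {Z. r0 < norm Z \<and> norm Z \<le> 1} (zeta2 q t m)" by (rule zeta_continuous) simp
  next
    fix Z :: complex assume Z: "r0 < norm Z" "norm Z < 1"
    then have Z': "norm Z \<le> 1" by simp
    note ann = annulus[OF Z(1) Z']
    have "Z * q ^ i \<noteq> 1" for i
      using ann(5) Z(2) by (cases i) auto
    then show "zeta2 q t m Z = Rk t m * (dl t Z * dl t (p * Z))"
      unfolding p_def by (intro zeta2_dl) (use ann in auto)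
  qed
  then have r1: "regsum (\<lambda>n. Rk t m * (dn (J - n) * (UU (2*l-m) (Suc m) t n * p powi n))) (I2 m J)"
    unfolding I2_def by (rule regsum_has_sum)
  have r2: "regsum (\<lambda>n. \<Sum>k<Suc m. Rk t m * Rk t k * (dn (J - n) * (q powi (int m - int k)) powi n)) (\<Sum>k<Suc m. Rk t m * Rk t k * 0)"
    by (intro regsum_sum regsum_cmult regsum_dn_q)
  have r3: "regsum (\<lambda>n. \<Sum>k<2*l-m. Rk t m * Rk t k * (dn (J - n) * (t\<^sup>2 * q ^ Suc (m + k)) powi n))
      (\<Sum>k<2*l-m. Rk t m * Rk t k * ((t\<^sup>2 * q ^ Suc (m + k)) powi J * dl t (t\<^sup>2 * q ^ Suc (Suc (m + k)))))"
    by (intro regsum_sum regsum_cmult regsum_dn_t2)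
  have "regsum (\<lambda>n. Rk t m * (dn (J - n) * (UU (2*l-m) (Suc m) t n * p powi n)) +
      (\<Sum>k<2*l-m. Rk t m * Rk t k * (dn (J - n) * (t\<^sup>2 * q ^ Suc (m + k)) powi n)) +
      (\<Sum>k<Suc m. Rk t m * Rk t k * (dn (J - n) * (q powi (int m - int k)) powi n)))
     (I2 m J +
      (\<Sum>k<2*l-m. Rk t m * Rk t k * ((t\<^sup>2 * q ^ Suc (m + k)) powi J * dl t (t\<^sup>2 * q ^ Suc (Suc (m + k))))) +
      (\<Sum>k<Suc m. Rk t m * Rk t k * 0))"
    by (intro regsum_add r1 r2 r3)
  moreover have "I2 m J +
      (\<Sum>k<2*l-m. Rk t m * Rk t k * ((t\<^sup>2 * q ^ Suc (m + k)) powi J * dl t (t\<^sup>2 * q ^ Suc (Suc (m + k))))) +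
      (\<Sum>k<Suc m. Rk t m * Rk t k * 0) = W2 m J"
    unfolding W2_def BB_def by (simp add: mult_ac)
  moreover have "(\<lambda>n. Rk t m * (dn (J - n) * (UU (2*l-m) (Suc m) t n * p powi n)) +
      (\<Sum>k<2*l-m. Rk t m * Rk t k * (dn (J - n) * (t\<^sup>2 * q ^ Suc (m + k)) powi n)) +
      (\<Sum>k<Suc m. Rk t m * Rk t k * (dn (J - n) * (q powi (int m - int k)) powi n))) =
      (\<lambda>n. Rk t m * (dn (J - n) * (cc t n * p powi n)))"
  proof
    fix n
    have "cc t n * p powi n = UU (2*l-m) (Suc m) t n * p powi n
       + (\<Sum>k<2*l-m. Rk t k * (t\<^sup>2 * q ^ Suc (m + k)) powi n) + (\<Sum>k<Suc m. Rk t k * (q powi (int m - int k)) powi n)"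
      unfolding cc_UU[of n "2*l-m" "Suc m"] distrib_right sum_distrib_right mult.assoc powi_prod tp[unfolded mult.assoc] tp2 ..
    then show "Rk t m * (dn (J - n) * (UU (2*l-m) (Suc m) t n * p powi n)) +
      (\<Sum>k<2*l-m. Rk t m * Rk t k * (dn (J - n) * (t\<^sup>2 * q ^ Suc (m + k)) powi n)) +
      (\<Sum>k<Suc m. Rk t m * Rk t k * (dn (J - n) * (q powi (int m - int k)) powi n)) =
      Rk t m * (dn (J - n) * (cc t n * p powi n))"
      by (simp only: distrib_left sum_distrib_left mult_ac)
  qed
  ultimately show ?thesis by (simp only: p_def)
qed

text \<open>Shifting the index by i and reflecting c(i - n) to c(n - i) reduces an exponential in
  the third factor to the case of one in the first factor. The reflection is the source of the
  additional factor q.\<close>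

lemma regsum_dual:
  assumes "regsum (\<lambda>n. c * (dn (j - i - n) * (cc t n * (g * q) powi n))) V" "g \<noteq> 0"
  shows "regsum (\<lambda>n. c * (cc t (i - n) * (dn (j - n) * g powi n))) (g powi i * V)"
proof -
  have "regsum (\<lambda>n. c * (dn (j - i - (n + - i)) * (cc t (n + - i) * (g * q) powi (n + - i)))) V"
    by (rule regsum_shift[OF assms(1)])
  from regsum_cmult[OF this, of "g powi i"]
  have "regsum (\<lambda>n. g powi i * (c * (dn (j - n) * (cc t (n - i) * (g * q) powi (n - i))))) (g powi i * V)"
    by simp
  also have "(\<lambda>n. g powi i * (c * (dn (j - n) * (cc t (n - i) * (g * q) powi (n - i))))) =
      (\<lambda>n. c * (cc t (i - n) * (dn (j - n) * g powi n)))"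
  proof
    fix n
    have c1: "cc t (n - i) = q powi (i - n) * cc t (i - n)" using cc_uminus[of t "i - n"] by simp
    have c2: "q powi (i - n) * q powi (n - i) = 1" by (simp flip: power_int_add)
    have c3: "g powi i * g powi (n - i) = g powi n"
      using power_int_add[of g i "n - i"] assms(2) by simp
    have gen: "g powi i * (c * (dn (j - n) * (x * y * (g powi (n - i) * z)))) =
      c * (y * (dn (j - n) * (g powi i * g powi (n - i)))) * (x * z)" for x y z by simp
    show "g powi i * (c * (dn (j - n) * (cc t (n - i) * (g * q) powi (n - i)))) =
        c * (cc t (i - n) * (dn (j - n) * g powi n))"
      unfolding power_int_mult_distrib c1 gen c2 c3 by simp
  qed
  finally show ?thesis .
qed

text \<open>One index for each crossed pole: \<open>Inl k\<close> for the pole 1/(t q^k),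
  \<open>Inr k\<close> for the pole t q^(k+1).\<close>

definition EE :: "(nat + nat) set" where "EE = {..l} <+> {..<l}"

definition al :: "nat + nat \<Rightarrow> complex" where
  "al = case_sum (\<lambda>k. t * q ^ k) (\<lambda>k. 1 / (t * q ^ Suc k))"

definition rh :: "nat + nat \<Rightarrow> complex" where
  "rh = case_sum (Rk t) (Rk t)"

definition en :: "int \<Rightarrow> complex" where
  "en n = (\<Sum>x\<in>EE. rh x * al x powi n)"

lemma sum_EE: "(\<Sum>x\<in>EE. g x) = (\<Sum>k\<le>l. g (Inl k)) + (\<Sum>k<l. g (Inr k) :: complex)"
  unfolding EE_def by (subst sum.Plus) (auto simp: o_def)

lemma cc_split: "cc t n = dn n + en n"
proof -
  have "(1 / x) powi n = x powi (- n)" for x :: complex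
    by (simp only: divide_inverse mult_1_left power_int_inverse power_int_minus)
  then show ?thesis
    unfolding dn_def UU_def en_def sum_EE al_def rh_def by (simp add: lessThan_Suc_atMost)
qed

lemma al_nonzero [simp]: "al x \<noteq> 0"
  by (cases x) (auto simp: al_def)

lemma regsum_e1:
  "regsum (\<lambda>n. en (i - n) * (dn (j - n) * cc t n)) (\<Sum>x\<in>EE. al x powi i * case_sum W1 W2 x j)"
proof -
  have "regsum (\<lambda>n. \<Sum>x\<in>EE. al x powi i * (rh x * (dn (j - n) * (cc t n * (1 / al x) powi n))))
    (\<Sum>x\<in>EE. al x powi i * case_sum W1 W2 x j)"
  proof (intro regsum_sum regsum_cmult)
    fix x assume "x \<in> EE"
    then consider k where "x = Inl k" "k \<le> l" | k where "x = Inr k" "k \<le> l" by (auto simp: EE_def)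
    then show "regsum (\<lambda>n. rh x * (dn (j - n) * (cc t n * (1 / al x) powi n))) (case_sum W1 W2 x j)"
    proof cases
      case 1
      then show ?thesis using regsum_W1[of k j] by (simp add: rh_def al_def)
    next
      case 2
      then show ?thesis using regsum_W2[of k j] by (simp add: rh_def al_def)
    qed
  qed
  also have "(\<lambda>n. \<Sum>x\<in>EE. al x powi i * (rh x * (dn (j - n) * (cc t n * (1 / al x) powi n)))) =
      (\<lambda>n. en (i - n) * (dn (j - n) * cc t n))"
  proof
    fix n
    have "al x powi i * (1 / al x) powi n = al x powi (i - n)" for x
      by (simp add: power_int_divide_distrib power_int_diff)
    then have "al x powi i * (rh x * (dn (j - n) * (cc t n * (1 / al x) powi n))) =
        rh x * al x powi (i - n) * (dn (j - n) * cc t n)" for x by (metis mult.commute mult.left_commute)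
    then show "(\<Sum>x\<in>EE. al x powi i * (rh x * (dn (j - n) * (cc t n * (1 / al x) powi n)))) =
        en (i - n) * (dn (j - n) * cc t n)"
      unfolding en_def sum_distrib_right by (simp only:)
  qed
  finally show ?thesis .
qed

text \<open>In comparison with the first factor, \<open>W1\<close> and \<open>W2\<close> are
  exchanged: the additional q turns t q^k into t q^(k+1) and 1/(t q^(k+1)) into 1/(t q^k).\<close>

lemma regsum_e3:
  "regsum (\<lambda>n. cc t (i - n) * (dn (j - n) * en n)) (\<Sum>x\<in>EE. al x powi i * case_sum W2 W1 x (j - i))"
proof -
  have "regsum (\<lambda>n. \<Sum>x\<in>EE. rh x * (cc t (i - n) * (dn (j - n) * al x powi n)))
    (\<Sum>x\<in>EE. al x powi i * case_sum W2 W1 x (j - i))"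
  proof (intro regsum_sum regsum_dual al_nonzero)
    fix x assume "x \<in> EE"
    then consider k where "x = Inl k" "k \<le> l" | k where "x = Inr k" "k \<le> l" by (auto simp: EE_def)
    then show "regsum (\<lambda>n. rh x * (dn (j - i - n) * (cc t n * (al x * q) powi n))) (case_sum W2 W1 x (j - i))"
    proof cases
      case 1
      then show ?thesis using regsum_W2[of k "j - i"] by (simp add: rh_def al_def mult_ac)
    next
      case 2
      then show ?thesis using regsum_W1[of k "j - i"] by (simp add: rh_def al_def mult_ac)
    qed
  qed
  also have "(\<lambda>n. \<Sum>x\<in>EE. rh x * (cc t (i - n) * (dn (j - n) * al x powi n))) =
      (\<lambda>n. cc t (i - n) * (dn (j - n) * en n))"
    unfolding en_def sum_distrib_left by (simp only: mult_ac)
  finally show ?thesis .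
qed

end


section \<open>Sums with no, two or three crossed poles\<close>

context strip
begin

lemma dn_has_sum: "norm Z = 1 \<Longrightarrow> ((\<lambda>n. dn n * Z powi n) has_sum dl t Z) UNIV"
  unfolding dn_def
proof (rule UU_has_sum[OF t_gt_1 _ _ _ _ _ t2])
  assume Z: "norm Z = 1"
  show "Z \<noteq> 0" using Z by auto
  show "1 < norm (t * q ^ k * Z)" if "k < Suc l" for k
    using big[of k] that Z unfolding norm_mult[of _ Z] by simp
  show "norm (t * q ^ Suc l * Z) < 1"
    using small_Suc Z unfolding norm_mult[of _ Z] by simp
  show "norm Z < norm (t * q ^ Suc k)" if "k < l" for k
    using big[of "Suc k"] that Z by simp
  show "norm (t * q ^ Suc l) < norm Z" using small_Suc Z by simp
qed

definition DInt :: "int \<Rightarrow> int \<Rightarrow> complex" where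
  "DInt i j = cmean a (\<lambda>Y. cmean a (\<lambda>X. X powi (- i) * Y powi (- j) * mu q t X Y))"

lemma regsum_ddd: "regsum (\<lambda>n. dn (i - n) * (dn (j - n) * dn n)) (DInt i j)"
  using regsum_has_sum[OF cmean_cmean_mu(1)[OF dn_has_sum, where i = i and j = j]]
  unfolding DInt_def by (simp only: mult.left_commute)

lemma regsum_dn_pos: "nopole z \<Longrightarrow> regsum (\<lambda>n. dn n * z powi n) (dl t z)"
  unfolding dn_def nopole_def using t2 by (intro regsum_UU) auto

text \<open>Here the quotient of two exponentials matters. Two poles of the same family give a power
  of q, where \<open>dl\<close> vanishes; only the mixed pairs survive.\<close>

lemma regsum_ede:
  "regsum (\<lambda>n. en (i - n) * (dn (j - n) * en n))
    ((\<Sum>k\<le>l. \<Sum>s<l. (t * q ^ k) powi i * (AA k s * (t\<^sup>2 * q ^ Suc (k + s)) powi (- j))) +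
     (\<Sum>k<l. \<Sum>s\<le>l. (1 / (t * q ^ Suc k)) powi i * (BB k s * (t\<^sup>2 * q ^ Suc (k + s)) powi j)))"
proof -
  define V where "V = (\<lambda>x y. case_sum
      (\<lambda>k. case_sum (\<lambda>_. 0) (\<lambda>s. (t\<^sup>2 * q ^ Suc (k + s)) powi (- j) * dl t (t\<^sup>2 * q ^ Suc (k + s))) y)
      (\<lambda>k. case_sum (\<lambda>s. (t\<^sup>2 * q ^ Suc (k + s)) powi j * dl t (t\<^sup>2 * q ^ Suc (Suc (k + s)))) (\<lambda>_. 0) y) x)"
  have V: "regsum (\<lambda>n. dn (j - n) * (al y / al x) powi n) (V x y)" for x y
  proof (cases x; cases y)
    fix k s assume xy: "x = Inl k" "y = Inl s"
    have "al y / al x = q powi (int s - int k)" by (simp add: xy al_def power_int_diff)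
    then show ?thesis using regsum_dn_q[of j "int s - int k"] by (simp add: V_def xy)
  next
    fix k s assume xy: "x = Inl k" "y = Inr s"
    have "al y / al x = 1 / (t\<^sup>2 * q ^ Suc (k + s))"
      by (simp add: xy al_def power_add power2_eq_square mult_ac)
    then show ?thesis using regsum_dn_inverse_t2[of j "k + s"] by (simp add: V_def xy)
  next
    fix k s assume xy: "x = Inr k" "y = Inl s"
    have "al y / al x = t\<^sup>2 * q ^ Suc (k + s)"
      by (simp add: xy al_def power_add power2_eq_square mult_ac)
    then show ?thesis using regsum_dn_t2[of j "Suc (k + s)"] by (simp add: V_def xy)
  next
    fix k s assume xy: "x = Inr k" "y = Inr s"
    have "al y / al x = q powi (int k - int s)" by (simp add: xy al_def power_int_diff)
    then show ?thesis using regsum_dn_q[of j "int k - int s"] by (simp add: V_def xy)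
  qed
  have W: "rh x * (rh y * V x y) = case_sum
      (\<lambda>k. case_sum (\<lambda>_. 0) (\<lambda>s. AA k s * (t\<^sup>2 * q ^ Suc (k + s)) powi (- j)) y)
      (\<lambda>k. case_sum (\<lambda>s. BB k s * (t\<^sup>2 * q ^ Suc (k + s)) powi j) (\<lambda>_. 0) y) x" for x y
    by (cases x; cases y)
      (simp_all only: V_def rh_def AA_def BB_def sum.case mult_zero_left mult_zero_right mult_ac)
  have "regsum (\<lambda>n. \<Sum>x\<in>EE. \<Sum>y\<in>EE. al x powi i * (rh x * (rh y * (dn (j - n) * (al y / al x) powi n))))
    (\<Sum>x\<in>EE. \<Sum>y\<in>EE. al x powi i * (rh x * (rh y * V x y)))"
    by (intro regsum_sum regsum_cmult V)
  also have "(\<lambda>n. \<Sum>x\<in>EE. \<Sum>y\<in>EE. al x powi i * (rh x * (rh y * (dn (j - n) * (al y / al x) powi n)))) =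
     (\<lambda>n. en (i - n) * (dn (j - n) * en n))"
  proof
    fix n
    have "al x powi i * (rh x * (rh y * (dn (j - n) * (al y / al x) powi n))) =
        rh x * al x powi (i - n) * (dn (j - n) * (rh y * al y powi n))" for x y
      by (simp add: power_int_divide_distrib power_int_diff)
    then show "(\<Sum>x\<in>EE. \<Sum>y\<in>EE. al x powi i * (rh x * (rh y * (dn (j - n) * (al y / al x) powi n)))) =
        en (i - n) * (dn (j - n) * en n)"
      unfolding en_def sum_distrib_left[of "dn (j - n)"] sum_product by (simp only:)
  qed
  also have "(\<Sum>x\<in>EE. \<Sum>y\<in>EE. al x powi i * (rh x * (rh y * V x y))) =
    ((\<Sum>k\<le>l. \<Sum>s<l. (t * q ^ k) powi i * (AA k s * (t\<^sup>2 * q ^ Suc (k + s)) powi (- j))) +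
     (\<Sum>k<l. \<Sum>s\<le>l. (1 / (t * q ^ Suc k)) powi i * (BB k s * (t\<^sup>2 * q ^ Suc (k + s)) powi j)))"
    unfolding W sum_EE al_def
    by (simp only: sum.case mult_zero_right sum.neutral_const add_0_left add_0_right)
  finally show ?thesis .
qed

text \<open>Here the product of two exponentials matters, so the mixed pairs give powers of q and
  vanish, and the pairs from one family survive.\<close>

lemma regsum_eed:
  "regsum (\<lambda>n. en (i - n) * (en (j - n) * dn n))
    ((\<Sum>k\<le>l. \<Sum>s\<le>l. (t * q ^ k) powi i * ((t * q ^ s) powi j * AA k s)) +
     (\<Sum>k<l. \<Sum>s<l. (1 / (t * q ^ Suc k)) powi i * ((1 / (t * q ^ Suc s)) powi j * BB k s)))"
proof -
  define V where "V = (\<lambda>x y. case_sum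
      (\<lambda>k. case_sum (\<lambda>s. dl t (t\<^sup>2 * q ^ Suc (k + s))) (\<lambda>_. 0) y)
      (\<lambda>k. case_sum (\<lambda>_. 0) (\<lambda>s. dl t (t\<^sup>2 * q ^ Suc (Suc (k + s)))) y) x)"
  have V: "regsum (\<lambda>n. dn n * (1 / (al x * al y)) powi n) (V x y)" for x y
  proof (cases x; cases y)
    fix k s assume xy: "x = Inl k" "y = Inl s"
    have "1 / (al x * al y) = 1 / (t\<^sup>2 * q ^ (k + s))"
      by (simp add: xy al_def power_add power2_eq_square mult_ac)
    then show ?thesis using regsum_dn_pos[OF nopole_inverse_t2[of "k + s"]] unfolding dl_inverse_t2
      by (simp add: V_def xy)
  next
    fix k s assume xy: "x = Inl k" "y = Inr s"
    have "1 / (al x * al y) = q powi (int (Suc s) - int k)"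
      by (simp only: xy al_def sum.case power_int_diff[OF disjI1[OF q_nonzero]] power_int_of_nat) simp
    then show ?thesis using regsum_dn_pos[OF nopole_q[of "int (Suc s) - int k"]] unfolding dl_q_powi
      by (simp add: V_def xy)
  next
    fix k s assume xy: "x = Inr k" "y = Inl s"
    have "1 / (al x * al y) = q powi (int (Suc k) - int s)"
      by (simp only: xy al_def sum.case power_int_diff[OF disjI1[OF q_nonzero]] power_int_of_nat) simp
    then show ?thesis using regsum_dn_pos[OF nopole_q[of "int (Suc k) - int s"]] unfolding dl_q_powi
      by (simp add: V_def xy)
  next
    fix k s assume xy: "x = Inr k" "y = Inr s"
    have "1 / (al x * al y) = t\<^sup>2 * q ^ Suc (Suc (k + s))"
      by (simp add: xy al_def power_add power2_eq_square mult_ac)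
    then show ?thesis using regsum_dn_pos[OF nopole_t2[of "Suc (k + s)"]] by (simp add: V_def xy)
  qed
  have W: "rh x * (rh y * V x y) = case_sum
      (\<lambda>k. case_sum (\<lambda>s. AA k s) (\<lambda>_. 0) y)
      (\<lambda>k. case_sum (\<lambda>_. 0) (\<lambda>s. BB k s) y) x" for x y
    by (cases x; cases y)
      (simp_all only: V_def rh_def AA_def BB_def sum.case mult_zero_left mult_zero_right mult_ac)
  have "regsum (\<lambda>n. \<Sum>x\<in>EE. \<Sum>y\<in>EE. al x powi i * (al y powi j * (rh x * (rh y * (dn n * (1 / (al x * al y)) powi n)))))
    (\<Sum>x\<in>EE. \<Sum>y\<in>EE. al x powi i * (al y powi j * (rh x * (rh y * V x y))))"
    by (intro regsum_sum regsum_cmult V)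
  also have "(\<lambda>n. \<Sum>x\<in>EE. \<Sum>y\<in>EE. al x powi i * (al y powi j * (rh x * (rh y * (dn n * (1 / (al x * al y)) powi n))))) =
     (\<lambda>n. en (i - n) * (en (j - n) * dn n))"
  proof
    fix n
    have "al x powi i * (al y powi j * (rh x * (rh y * (dn n * (1 / (al x * al y)) powi n)))) =
        rh x * al x powi (i - n) * (rh y * al y powi (j - n) * dn n)" for x y
      by (simp add: power_int_divide_distrib power_int_mult_distrib power_int_diff)
    then show "(\<Sum>x\<in>EE. \<Sum>y\<in>EE. al x powi i * (al y powi j * (rh x * (rh y * (dn n * (1 / (al x * al y)) powi n))))) =
        en (i - n) * (en (j - n) * dn n)"
      unfolding en_def sum_distrib_right[where r = "dn n"] sum_product by (simp only:)
  qed
  also have "(\<Sum>x\<in>EE. \<Sum>y\<in>EE. al x powi i * (al y powi j * (rh x * (rh y * V x y)))) =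
    ((\<Sum>k\<le>l. \<Sum>s\<le>l. (t * q ^ k) powi i * ((t * q ^ s) powi j * AA k s)) +
     (\<Sum>k<l. \<Sum>s<l. (1 / (t * q ^ Suc k)) powi i * ((1 / (t * q ^ Suc s)) powi j * BB k s)))"
    unfolding W sum_EE al_def
    by (simp only: sum.case mult_zero_right sum.neutral_const add_0_left add_0_right)
  finally show ?thesis .
qed

text \<open>Rules out the constant sequence, the one exponential without regularised sum 0. In each
  case equality would force either t^3 q^(j+1) = 1 or that t is an integral power of q.\<close>

lemma al_mult_neq: "al x * al y \<noteq> al z"
proof
  assume e: "al x * al y = al z"
  have c: "t * t * t * q ^ Suc m \<noteq> 1" for m
    using t_cube[of m] by (simp only: power3_eq_cube not_False_eq_True)
  show False
  proof (cases x; cases y; cases z)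
    fix k s m assume "x = Inl k" "y = Inl s" "z = Inl m"
    then show False using e t_q_pow(2)[of "k + s" m] by (simp add: al_def power_add mult_ac)
  next
    fix k s m assume "x = Inl k" "y = Inl s" "z = Inr m"
    then have "t * q ^ k * (t * q ^ s) * (t * q ^ Suc m) = 1" using e by (simp add: al_def)
    then show False using c[of "k + s + m"] by (simp add: power_add mult_ac)
  next
    fix k s m assume "x = Inl k" "y = Inr s" "z = Inl m"
    then have "q ^ k = t * q ^ m * q ^ Suc s" using e by (simp add: al_def divide_eq_eq)
    then show False using t_q_pow(2)[of "m + Suc s" k] by (simp add: power_add mult_ac)
  next
    fix k s m assume "x = Inl k" "y = Inr s" "z = Inr m"
    then have "q ^ k * (t * q ^ Suc m) = q ^ Suc s" using e by (simp add: al_def frac_eq_eq)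
    then show False using t_q_pow(2)[of "k + Suc m" "Suc s"] by (simp add: power_add mult_ac)
  next
    fix k s m assume "x = Inr k" "y = Inl s" "z = Inl m"
    then have "q ^ s = t * q ^ m * q ^ Suc k" using e by (simp add: al_def divide_eq_eq)
    then show False using t_q_pow(2)[of "m + Suc k" s] by (simp add: power_add mult_ac)
  next
    fix k s m assume "x = Inr k" "y = Inl s" "z = Inr m"
    then have "q ^ s * (t * q ^ Suc m) = q ^ Suc k" using e by (simp add: al_def frac_eq_eq)
    then show False using t_q_pow(2)[of "s + Suc m" "Suc k"] by (simp add: power_add mult_ac)
  next
    fix k s m assume "x = Inr k" "y = Inr s" "z = Inl m"
    then have "1 = t * q ^ m * (t * q ^ Suc k * (t * q ^ Suc s))" using e by (simp add: al_def divide_eq_eq)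
    then show False using c[of "m + k + Suc s"] by (simp add: power_add mult_ac)
  next
    fix k s m assume "x = Inr k" "y = Inr s" "z = Inr m"
    then have "t * q ^ Suc m = t * q ^ Suc k * (t * q ^ Suc s)" using e by (simp add: al_def frac_eq_eq)
    then show False using t_q_pow(2)[of "Suc k + Suc s" "Suc m"] by (simp add: power_add mult_ac)
  qed
qed

lemma regsum_eee: "regsum (\<lambda>n. en (i - n) * (en (j - n) * en n)) 0"
proof -
  have "regsum (\<lambda>n. \<Sum>x\<in>EE. \<Sum>y\<in>EE. \<Sum>z\<in>EE. al x powi i * (al y powi j * (rh x * (rh y * (rh z * (al z / (al x * al y)) powi n)))))
    (\<Sum>x\<in>EE. \<Sum>y\<in>EE. \<Sum>z\<in>EE. al x powi i * (al y powi j * (rh x * (rh y * (rh z * 0)))))"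
  proof (intro regsum_sum regsum_cmult regsum_exponential)
    fix x y z
    show "al z / (al x * al y) \<noteq> 0" by simp
    have "al z \<noteq> al x * al y" using al_mult_neq[of x y z] by (rule not_sym)
    then show "al z / (al x * al y) \<noteq> 1" by simp
  qed
  also have "(\<lambda>n. \<Sum>x\<in>EE. \<Sum>y\<in>EE. \<Sum>z\<in>EE. al x powi i * (al y powi j * (rh x * (rh y * (rh z * (al z / (al x * al y)) powi n))))) =
     (\<lambda>n. en (i - n) * (en (j - n) * en n))"
  proof
    fix n
    have "al x powi i * (al y powi j * (rh x * (rh y * (rh z * (al z / (al x * al y)) powi n)))) =
        rh x * al x powi (i - n) * (rh y * al y powi (j - n) * (rh z * al z powi n))" for x y z
      by (simp add: power_int_divide_distrib power_int_mult_distrib power_int_diff)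
    then show "(\<Sum>x\<in>EE. \<Sum>y\<in>EE. \<Sum>z\<in>EE. al x powi i * (al y powi j * (rh x * (rh y * (rh z * (al z / (al x * al y)) powi n))))) =
        en (i - n) * (en (j - n) * en n)"
      unfolding en_def sum_product unfolding sum_distrib_left by (simp only:)
  qed
  finally show ?thesis by simp
qed

text \<open>In each term with one exponential factor, one of the other two factors is kept as the
  full c = d + e, since that is the form evaluated by \<open>W1\<close> and \<open>W2\<close>. The
  term e d e is thereby counted twice and must be subtracted once; e e d and e e e are
  added.\<close>

lemma regsum_cprod_aux:
  fixes i j defines "E \<equiv> \<lambda>i j. \<Sum>x\<in>EE. al x powi i * case_sum W1 W2 x j"
  shows "regsum (cprod i j t) (DInt i j + E i j + E j i + (\<Sum>x\<in>EE. al x powi i * case_sum W2 W1 x (j - i))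
    - ((\<Sum>k\<le>l. \<Sum>s<l. (t * q ^ k) powi i * (AA k s * (t\<^sup>2 * q ^ Suc (k + s)) powi (- j))) +
       (\<Sum>k<l. \<Sum>s\<le>l. (1 / (t * q ^ Suc k)) powi i * (BB k s * (t\<^sup>2 * q ^ Suc (k + s)) powi j)))
    + ((\<Sum>k\<le>l. \<Sum>s\<le>l. (t * q ^ k) powi i * ((t * q ^ s) powi j * AA k s)) +
       (\<Sum>k<l. \<Sum>s<l. (1 / (t * q ^ Suc k)) powi i * ((1 / (t * q ^ Suc s)) powi j * BB k s))) + 0)"
proof -
  have e: "cprod i j t = (\<lambda>n. dn (i - n) * (dn (j - n) * dn n) + en (i - n) * (dn (j - n) * cc t n) +
      en (j - n) * (dn (i - n) * cc t n) + cc t (i - n) * (dn (j - n) * en n)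
      - en (i - n) * (dn (j - n) * en n) + en (i - n) * (en (j - n) * dn n) + en (i - n) * (en (j - n) * en n))"
  proof -
    have "(a + b) * (c + d) * (e + f) = a * (c * e) + b * (c * (e + f)) + d * (a * (e + f)) + (a + b) * (c * f)
        - b * (c * f) + b * (d * e) + b * (d * f)" for a b c d e f :: complex
      by (simp add: algebra_simps)
    then show ?thesis unfolding cprod_def[abs_def] cc_split by (intro ext)
  qed
  show ?thesis unfolding e E_def
    by (intro regsum_add regsum_diff regsum_ddd regsum_e1 regsum_e3 regsum_ede regsum_eed regsum_eee)
qed

end


section \<open>Matching the residues with varpi_1 and varpi_2\<close>

lemma sum_triangle_swap: "(\<Sum>k<n. \<Sum>s<n - k. f k s) = (\<Sum>k<n. \<Sum>s<n - k. f s k)" for f :: "nat \<Rightarrow> nat \<Rightarrow> complex"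
  unfolding sum.Sigma[OF finite_lessThan ballI[OF finite_lessThan]]
  by (rule sum.reindex_bij_witness[of _ prod.swap prod.swap]) auto

text \<open>If k + s < 2 l then k <= l or s < l, and both hold exactly on a full rectangle. The
  rectangle will cancel against the subtracted e d e term, which leaves the full triangle up to 2
  l.\<close>

lemma sum_triangle_cover:
  fixes f :: "nat \<Rightarrow> nat \<Rightarrow> complex"
  shows "(\<Sum>k\<le>l. \<Sum>s<2*l-k. f k s) + (\<Sum>s<l. \<Sum>k<2*l-s. f k s) =
    (\<Sum>k<2*l. \<Sum>s<2*l-k. f k s) + (\<Sum>k\<le>l. \<Sum>s<l. f k s)"
proof -
  define A where "A = Sigma {..l} (\<lambda>k. {..<2*l-k})"
  define B where "B = (\<Union>s<l. {..<2*l-s} \<times> {s})"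
  have "(\<Sum>s<l. \<Sum>k<2*l-s. f k s) = (\<Sum>(k, s)\<in>B. f k s)"
    unfolding B_def sum.Sigma[OF finite_lessThan ballI[OF finite_lessThan]]
    by (rule sum.reindex_bij_witness[of _ prod.swap prod.swap]) auto
  moreover have "(\<Sum>k\<le>l. \<Sum>s<2*l-k. f k s) = (\<Sum>(k, s)\<in>A. f k s)"
    unfolding A_def by (simp add: sum.Sigma)
  moreover have "A \<union> B = Sigma {..<2*l} (\<lambda>k. {..<2*l-k})" "A \<inter> B = {..l} \<times> {..<l}"
    unfolding A_def B_def by auto
  then have "(\<Sum>k<2*l. \<Sum>s<2*l-k. f k s) = (\<Sum>(k, s)\<in>A \<union> B. f k s)"
    "(\<Sum>k\<le>l. \<Sum>s<l. f k s) = (\<Sum>(k, s)\<in>A \<inter> B. f k s)"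
    by (simp_all add: sum.Sigma sum.cartesian_product)
  moreover have "finite A" "finite B" unfolding A_def B_def by auto
  ultimately show ?thesis by (simp only: sum.union_inter)
qed

context strip
begin

lemma rho_eq: "rho q t = (rho0 q t)\<^sup>2 * dl t (t\<^sup>2 * q)"
proof -
  have "rho q t = prodinf (\<lambda>i. ((1 - 1 / t * q ^ i) * ((1 - t * q * q ^ i) * (1 - t * q * q ^ i)) * (1 - 1 / t\<^sup>2 * q ^ i)) /
      ((1 - q * q ^ i) * (1 - q * q ^ i) * (1 - t\<^sup>2 * q * q ^ i) * (1 - t ^ 3 * q * q ^ i)))"
    unfolding rho_def by (simp add: power2_eq_square divide_inverse power_int_minus mult_ac)
  also have "\<dots> = ph (1 / t) * (ph (t * q) * ph (t * q)) * ph (1 / t\<^sup>2) / (ph q * ph q * ph (t\<^sup>2 * q) * ph (t ^ 3 * q))"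
    unfolding ph_def
    by (simp only: prodinf_divide prodinf_mult convergent_prod_mult convergent_ph)
  finally have r: "rho q t = \<dots>" .
  have n1: "ph (1 / t) \<noteq> 0" using t_gt_1 by (intro ph_nonzero) (simp add: norm_divide)
  have n2: "ph (t\<^sup>2 * q) \<noteq> 0" using t2 by (auto simp: ph_eq_0_iff mult_ac)
  have e: "q / (t\<^sup>2 * q) = 1 / t\<^sup>2" "t * (t\<^sup>2 * q) = t ^ 3 * q" "t * q / (t\<^sup>2 * q) = 1 / t"
    by (simp_all add: power2_eq_square power3_eq_cube)
  show ?thesis unfolding r rho0_eq dl_def e using n1 n2 by (simp add: power2_eq_square mult_ac)
qed

text \<open>Quasi-periodicity iterated from t^2 q. Each step contributes one quotient (1 - t^3 q^j)
  / (1 - t q^j), the last product in varpi_1 and varpi_2.\<close>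

lemma dl_t2_q: "dl t (t\<^sup>2 * q ^ Suc M) = dl t (t\<^sup>2 * q) * (\<Prod>j=1..M. (1 - t ^ 3 * q ^ j) / (1 - t * q ^ j)) / t ^ M"
proof (induction M)
  case (Suc M)
  define Z where "Z = t\<^sup>2 * q ^ Suc M"
  have n: "1 - t * q ^ Suc M \<noteq> 0" using t_q_pow(1)[of "Suc M"] by (simp only: right_minus_eq not_sym)
  have e: "Z - t = - t * (1 - t * q ^ Suc M)" "t * Z - 1 = - (1 - t ^ 3 * q ^ Suc M)"
    by (simp_all add: Z_def power2_eq_square power3_eq_cube algebra_simps)
  have "dl t (q * Z) * (Z - t) = dl t Z * (t * Z - 1)"
  proof (rule dl_q_shift)
    show "Z \<noteq> 0" by (simp add: Z_def)
    show "Z \<noteq> 1" unfolding Z_def by (rule t2)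
    show "t * Z \<noteq> 1" using t_cube[of M] by (simp add: Z_def power2_eq_square power3_eq_cube mult_ac)
    show "Z \<noteq> t" using t_q_pow(1)[of "Suc M"] by (simp add: Z_def power2_eq_square)
  qed
  then have "dl t (q * Z) * t * (1 - t * q ^ Suc M) = dl t Z * (1 - t ^ 3 * q ^ Suc M)"
    unfolding e by (simp only: mult_minus_left mult_minus_right neg_equal_iff_equal mult.assoc)
  then have "dl t (q * Z) * t = dl t Z * ((1 - t ^ 3 * q ^ Suc M) / (1 - t * q ^ Suc M))"
    by (simp only: times_divide_eq_right nonzero_eq_divide_eq[OF n])
  then have "dl t (q * Z) = dl t Z * ((1 - t ^ 3 * q ^ Suc M) / (1 - t * q ^ Suc M)) / t"
    by (simp only: nonzero_eq_divide_eq[OF t_nonzero])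
  moreover have "q * Z = t\<^sup>2 * q ^ Suc (Suc M)" by (simp add: Z_def mult_ac)
  ultimately show ?case using Suc by (simp add: Z_def mult_ac)
qed simp

lemma powi_minus_nat: "t powi (n - int m) = t powi n / t ^ m"
  using power_int_diff[of t n "int m"] by simp

lemma rho_varpi1: "rho q t * varpi1 q t (Suc k) (Suc s) = BB k s"
proof -
  have p: "t powi (3 - 2 * (int (Suc k) + int (Suc s))) = 1 / (t ^ k * t ^ s * t ^ Suc (k + s))"
  proof -
    have "3 - 2 * (int (Suc k) + int (Suc s)) = 0 - int (k + s + Suc (k + s))" by simp
    then show ?thesis unfolding powi_minus_nat[of 0, symmetric] by (simp only: powi_minus_nat power_add power_int_0_right)
  qed
  have n: "Suc k + Suc s - 1 = Suc (k + s)" "Suc k - 1 = k" "Suc s - 1 = s" by simp_all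
  show ?thesis
    unfolding varpi1_def BB_def p n rho_eq Rk_def gk_def dl_t2_q by (simp add: power2_eq_square mult_ac)
qed

text \<open>The factors of varpi_2 with n - j run backwards; reversed, they cancel the last s
  factors of the product up to k + s, and the product up to k required by \<open>Rk t k\<close>
  remains.\<close>

lemma rho_varpi2: "rho q t * varpi2 q t (Suc s) (Suc (k + s)) = AA k s"
proof -
  define P where "P n = (\<Prod>j=1..n. (1 - t\<^sup>2 * q ^ j) / (1 - q ^ j))" for n
  define g where "g j = (1 - q ^ j) / (1 - t\<^sup>2 * q ^ j)" for j
  have p: "t powi (2 - 2 * int (Suc (k + s))) = 1 / (t ^ k * t ^ s * t ^ (k + s))"
  proof -
    have "2 - 2 * int (Suc (k + s)) = 0 - int (k + s + (k + s))" by simp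
    then show ?thesis by (simp only: powi_minus_nat power_add power_int_0_right)
  qed
  have n: "Suc (k + s) - 1 = k + s" "Suc s - 1 = s" by simp_all
  have "(\<Prod>j=1..s. g (Suc (k + s) - j)) = (\<Prod>j=1..s. g (k + (1 + s - j)))"
    by (intro prod.cong arg_cong[where f = g]) auto
  also have "\<dots> = (\<Prod>j=1..s. g (k + j))"
    using prod.atLeastAtMost_rev[of "\<lambda>j. g (k + j)" 1 s] by simp
  finally have rev: "(\<Prod>j=1..s. g (Suc (k + s) - j)) = \<dots>" .
  have "(\<Prod>j=1..s. g (k + j)) * P (k + s) = P k"
  proof (induction s)
    case (Suc s)
    have "1 - q ^ Suc (k + s) \<noteq> 0" "1 - t\<^sup>2 * q ^ Suc (k + s) \<noteq> 0"
      using q_power_Suc_neq_1(1)[of "k + s"] t2[of "k + s"] by (metis right_minus_eq)+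
    then have f1: "g (k + Suc s) * ((1 - t\<^sup>2 * q ^ Suc (k + s)) / (1 - q ^ Suc (k + s))) = 1"
      by (simp add: g_def del: power_Suc)
    have f2: "(\<Prod>j=1..Suc s. g (k + j)) * P (k + Suc s) = (\<Prod>j=1..s. g (k + j)) * P (k + s) *
       (g (k + Suc s) * ((1 - t\<^sup>2 * q ^ Suc (k + s)) / (1 - q ^ Suc (k + s))))"
      by (simp add: P_def del: power_Suc)
    show ?case by (simp only: f2 f1 Suc mult_1_right)
  qed simp
  then have G: "(\<Prod>j=1..s. g (Suc (k + s) - j)) * P (k + s) = P k" unfolding rev .
  have w: "varpi2 q t (Suc s) (Suc (k + s)) = 1 / (t ^ k * t ^ s * t ^ (k + s)) * P s *
      ((\<Prod>j=1..s. g (Suc (k + s) - j)) * P (k + s)) * (\<Prod>j=1..k+s. (1 - t ^ 3 * q ^ j) / (1 - t * q ^ j))"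
    unfolding varpi2_def p n P_def g_def times_divide_times_eq[symmetric] prod.distrib by (simp only: mult_ac)
  show ?thesis
    unfolding w G rho_eq AA_def Rk_def gk_def dl_t2_q P_def[symmetric] by (simp add: power2_eq_square mult_ac)
qed

definition res :: "(complex \<Rightarrow> complex \<Rightarrow> complex) \<Rightarrow> complex" where
  "res F =
    (\<Sum>k<l. \<Sum>s<l. BB k s * F (t * q ^ Suc k) (t * q ^ Suc s)) +
    (\<Sum>k<2*l. \<Sum>s<2*l-k. BB k s * F (t * q ^ Suc k) (1 / (t\<^sup>2 * q ^ Suc (k + s)))) +
    (\<Sum>k<2*l. \<Sum>s<2*l-k. AA k s * F (1 / (t * q ^ k)) (t\<^sup>2 * q ^ Suc (k + s))) +
    (\<Sum>k\<le>l. \<Sum>s<2*l-k. AA k s * F (t\<^sup>2 * q ^ Suc (k + s)) (1 / (t * q ^ k))) +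
    (\<Sum>k\<le>l. \<Sum>s\<le>l. AA k s * F (1 / (t * q ^ k)) (1 / (t * q ^ s))) +
    (\<Sum>k<l. \<Sum>s<2*l-k. BB k s * F (1 / (t\<^sup>2 * q ^ Suc (k + s))) (t * q ^ Suc k))"

text \<open>A change of indices in each sum: varpi_1 is taken at (k + 1, s + 1), varpi_2 at (s + 1,
  k + s + 1). The last sum has the arguments of varpi_1 exchanged and uses its symmetry.\<close>

lemma res_eq: "rho q t *
   ((\<Sum>m=1..l. \<Sum>n=1..l. varpi1 q t m n * F (t * q ^ m) (t * q ^ n))
    + (\<Sum>m=1..2*l. \<Sum>n=m+1..2*l+1.
         varpi1 q t m (n - m) * F (t * q ^ m) (t powi (-2) * q powi (- int n + 1)))
    + (\<Sum>m=1..2*l. \<Sum>n=m..2*l.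
         varpi2 q t m n * F (t powi (-1) * q powi (int m - int n)) (t\<^sup>2 * q ^ n))
    + (\<Sum>m=0..l. \<Sum>n=m+1..2*l.
         varpi2 q t (n - m) n * F (t\<^sup>2 * q ^ n) (t powi (-1) * q powi (- int m)))
    + (\<Sum>m=1..l+1. \<Sum>n=m..m+l.
         varpi2 q t m n *
         F (t powi (-1) * q powi (int m - int n)) (t powi (-1) * q powi (- int m + 1)))
    + (\<Sum>m=1..l. \<Sum>n=m+1..2*l+1.
         varpi1 q t (n - m) m * F (t powi (-2) * q powi (- int n + 1)) (t * q ^ m))) = res F"
proof -
  have p1: "t powi (-2) * q powi (- int (Suc (Suc (k + s))) + 1) = 1 / (t\<^sup>2 * q ^ Suc (k + s))" for k s
  proof -
    have "- int (Suc (Suc (k + s))) + 1 = - int (Suc (k + s))" by simp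
    then show ?thesis by (simp only: power_int_minus power_int_of_nat divide_inverse inverse_mult_distrib mult_1_left power_int_numeral)
  qed
  have p2: "t powi (-1) * q powi (- int k) = 1 / (t * q ^ k)" for k
    by (simp only: power_int_minus power_int_of_nat divide_inverse inverse_mult_distrib mult_1_left power_int_1_right)
  have p3: "int (Suc s) - int (Suc (k + s)) = - int k" "- int (Suc s) + 1 = - int s" for k s by simp_all
  have fin: "finite {x..y}" for x y :: nat by simp
  note Sg = sum.Sigma[OF finite_lessThan ballI[OF finite_lessThan]] sum.Sigma[OF finite_atMost ballI[OF finite_lessThan]]
    sum.Sigma[OF finite_atMost ballI[OF finite_atMost]] sum.Sigma[OF finite_atLeastAtMost ballI[OF finite_atLeastAtMost]]
  have s: "rho q t * varpi1 q t (Suc s) (Suc k) = BB k s" for k s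
    using rho_varpi1[of s k] by (simp add: BB_def mult_ac add.commute)
  have e1: "rho q t * (\<Sum>m=1..l. \<Sum>n=1..l. varpi1 q t m n * F (t * q ^ m) (t * q ^ n)) =
      (\<Sum>k<l. \<Sum>s<l. BB k s * F (t * q ^ Suc k) (t * q ^ Suc s))"
    unfolding sum_distrib_left mult.assoc[symmetric] Sg rho_varpi1[symmetric]
    by (rule sum.reindex_bij_witness[of _ "\<lambda>(k, s). (Suc k, Suc s)" "\<lambda>(m, n). (m - 1, n - 1)"])
      (auto simp del: power_Suc simp: Suc_diff_Suc of_nat_diff)
  have e2: "rho q t * (\<Sum>m=1..2*l. \<Sum>n=m+1..2*l+1.
         varpi1 q t m (n - m) * F (t * q ^ m) (t powi (-2) * q powi (- int n + 1))) =
      (\<Sum>k<2*l. \<Sum>s<2*l-k. BB k s * F (t * q ^ Suc k) (1 / (t\<^sup>2 * q ^ Suc (k + s))))"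
    unfolding sum_distrib_left mult.assoc[symmetric] Sg p1[symmetric] rho_varpi1[symmetric]
    by (rule sum.reindex_bij_witness[of _ "\<lambda>(k, s). (Suc k, Suc (Suc (k + s)))" "\<lambda>(m, n). (m - 1, n - m - 1)"])
      (auto simp del: power_Suc simp: Suc_diff_Suc of_nat_diff)
  have e3: "rho q t * (\<Sum>m=1..2*l. \<Sum>n=m..2*l.
         varpi2 q t m n * F (t powi (-1) * q powi (int m - int n)) (t\<^sup>2 * q ^ n)) =
      (\<Sum>k<2*l. \<Sum>s<2*l-k. AA k s * F (1 / (t * q ^ k)) (t\<^sup>2 * q ^ Suc (k + s)))"
    unfolding sum_distrib_left mult.assoc[symmetric] Sg p2[symmetric] rho_varpi2[symmetric]
    by (rule sum.reindex_bij_witness[of _ "\<lambda>(k, s). (Suc s, Suc (k + s))" "\<lambda>(m, n). (n - m, m - 1)"])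
      (auto simp del: power_Suc simp: Suc_diff_Suc of_nat_diff)
  have e4: "rho q t * (\<Sum>m=0..l. \<Sum>n=m+1..2*l.
         varpi2 q t (n - m) n * F (t\<^sup>2 * q ^ n) (t powi (-1) * q powi (- int m))) =
      (\<Sum>k\<le>l. \<Sum>s<2*l-k. AA k s * F (t\<^sup>2 * q ^ Suc (k + s)) (1 / (t * q ^ k)))"
    unfolding sum_distrib_left mult.assoc[symmetric] Sg p2[symmetric] rho_varpi2[symmetric]
    by (rule sum.reindex_bij_witness[of _ "\<lambda>(k, s). (k, Suc (k + s))" "\<lambda>(m, n). (m, n - m - 1)"])
      (auto simp del: power_Suc simp: Suc_diff_Suc of_nat_diff)
  have e5: "rho q t * (\<Sum>m=1..l+1. \<Sum>n=m..m+l.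
         varpi2 q t m n *
         F (t powi (-1) * q powi (int m - int n)) (t powi (-1) * q powi (- int m + 1))) =
      (\<Sum>k\<le>l. \<Sum>s\<le>l. AA k s * F (1 / (t * q ^ k)) (1 / (t * q ^ s)))"
    unfolding sum_distrib_left mult.assoc[symmetric] Sg p2[symmetric] rho_varpi2[symmetric]
    by (rule sum.reindex_bij_witness[of _ "\<lambda>(k, s). (Suc s, Suc (k + s))" "\<lambda>(m, n). (n - m, m - 1)"])
      (auto simp del: power_Suc simp: Suc_diff_Suc of_nat_diff)
  have e6: "rho q t * (\<Sum>m=1..l. \<Sum>n=m+1..2*l+1.
         varpi1 q t (n - m) m * F (t powi (-2) * q powi (- int n + 1)) (t * q ^ m)) =
      (\<Sum>k<l. \<Sum>s<2*l-k. BB k s * F (1 / (t\<^sup>2 * q ^ Suc (k + s))) (t * q ^ Suc k))"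
    unfolding sum_distrib_left mult.assoc[symmetric] Sg p1[symmetric] s[symmetric]
    by (rule sum.reindex_bij_witness[of _ "\<lambda>(k, s). (Suc k, Suc (Suc (k + s)))" "\<lambda>(m, n). (m - 1, n - m - 1)"])
      (auto simp del: power_Suc simp: Suc_diff_Suc of_nat_diff)
  show ?thesis unfolding distrib_left e1 e2 e3 e4 e5 e6 res_def ..
qed

end


section \<open>Linearity in f and the assembly of the formula\<close>

context qcircle
begin

lemma cmean_linear:
  assumes "\<And>p. p \<in> I \<Longrightarrow> continuous_on (sphere 0 1) (G p)"
    and "\<And>Z. norm Z = 1 \<Longrightarrow> H Z = (\<Sum>p\<in>I. c p * G p Z)"
  shows "cmean a H = (\<Sum>p\<in>I. c p * cmean a (G p))"
proof -
  have "cmean a H = cmean a (\<lambda>Z. \<Sum>p\<in>I. c p * G p Z)"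
    by (rule cmean_cong) (rule assms)
  also have "\<dots> = (\<Sum>p\<in>I. cmean a (\<lambda>Z. c p * G p Z))"
    by (rule cmean_sum) (intro continuous_on_mult continuous_on_const assms)
  also have "\<dots> = (\<Sum>p\<in>I. c p * cmean a (G p))"
    by (intro sum.cong refl cmean_cmult assms)
  finally show ?thesis .
qed

end

text \<open>The exponents are negated so that \<open>mn (i, j)\<close> is the monomial whose
  constant term against mu is the sum of \<open>cprod i j\<close>.\<close>

definition mn :: "int \<times> int \<Rightarrow> complex \<Rightarrow> complex \<Rightarrow> complex" where
  "mn p X Y = X powi (- fst p) * Y powi (- snd p)"

lemma leval_mn: "leval f X Y = (\<Sum>p\<in>Poly_Mapping.keys f. Poly_Mapping.lookup f p * mn (- p) X Y)"
  unfolding leval_def mn_def by (simp add: case_prod_beta mult.assoc)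

lemma continuous_on_mn [continuous_intros]:
  assumes "continuous_on S u" "continuous_on S v" "\<And>Z. Z \<in> S \<Longrightarrow> u Z \<noteq> 0" "\<And>Z. Z \<in> S \<Longrightarrow> v Z \<noteq> 0"
  shows "continuous_on S (\<lambda>Z. mn p (u Z) (v Z))"
  unfolding mn_def by (intro continuous_intros assms) (use assms in auto)

context strip
begin

lemma BB_commute: "BB k s = BB s k"
  by (simp add: BB_def mult.commute add.commute)

lemma AA_commute: "AA k s = AA s k"
  by (simp add: AA_def mult.commute add.commute)

definition DD :: "(complex \<Rightarrow> complex \<Rightarrow> complex) \<Rightarrow> complex" where
  "DD F =
    (\<Sum>m\<le>l. cmean a (\<lambda>Z. (F (1 / (t * q ^ m)) Z + F Z (1 / (t * q ^ m))) * zeta1 q t m Z)) +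
    (\<Sum>m\<le>l. cmean a (\<lambda>Z. F (1 / (t * q ^ m * Z)) Z * zeta2 q t m Z)) +
    (\<Sum>m<l. cmean a (\<lambda>Z. F (t * q ^ Suc m / Z) Z * zeta1 q t m Z)) +
    (\<Sum>m<l. cmean a (\<lambda>Z. (F (t * q ^ Suc m) Z + F Z (t * q ^ Suc m)) * zeta2 q t m Z))"

lemma DD_eq: "1 / (2 * of_real pi * \<i> * of_real a) *
     ((\<Sum>m=0..l. contour_integral (Ppath a) (\<lambda>y.
         (F (t powi (-1) * q powi (- int m)) (q powr y)
          + F (q powr y) (t powi (-1) * q powi (- int m))) * zeta1 q t m (q powr y)))
      + (\<Sum>m=0..l. contour_integral (Ppath a) (\<lambda>y.
         F (t powi (-1) * q powr (- y - of_nat m)) (q powr y) * zeta2 q t m (q powr y)))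
      + (\<Sum>m=1..l. contour_integral (Ppath a) (\<lambda>y.
         F (t * q powr (- y + of_nat m)) (q powr y) * zeta1 q t (m - 1) (q powr y)))
      + (\<Sum>m=1..l. contour_integral (Ppath a) (\<lambda>y.
         (F (t * q ^ m) (q powr y) + F (q powr y) (t * q ^ m))
           * zeta2 q t (m - 1) (q powr y)))) = DD F"
proof -
  have p: "t powi (-1) * q powi (- int m) = 1 / (t * q ^ m)" for m
    by (simp only: power_int_minus power_int_of_nat divide_inverse inverse_mult_distrib mult_1_left power_int_1_right)
  have e: "q powr (- y - of_nat m) = 1 / (q ^ m * q powr y)" "q powr (- y + of_nat m) = q ^ m / q powr y" for y m
    by (simp_all add: powr_diff powr_add powr_minus powr_nat' divide_inverse mult_ac)
  have e': "t powi (-1) * (1 / (q ^ m * X)) = 1 / (t * q ^ m * X)" "t * (q ^ m / X) = t * q ^ m / X" for m X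
    by (simp_all add: divide_inverse power_int_minus mult_ac)
  have i: "(\<Sum>m=1..l. g m) = (\<Sum>m<l. g (Suc m))" for g :: "nat \<Rightarrow> complex"
    by (simp add: sum.atLeast1_atMost_eq)
  show ?thesis
    unfolding DD_def cmean_def p e e' atLeast0AtMost i diff_Suc_1
      sum_divide_distrib[symmetric] add_divide_distrib[symmetric] by simp
qed

lemma DD_leval: "DD (leval f) = (\<Sum>p\<in>Poly_Mapping.keys f. Poly_Mapping.lookup f p * DD (mn (- p)))"
proof -
  have sub: "sphere 0 1 \<subseteq> {Z. r0 < norm Z \<and> norm Z \<le> 1}" using r0_less_1 by auto
  note cont = zeta_continuous[OF sub]
  have Z: "Z \<noteq> 0" if "Z \<in> sphere 0 1" for Z :: complex using that by auto
  have d1: "cmean a (\<lambda>Z. (leval f c Z + leval f Z c) * z Z) =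
      (\<Sum>p\<in>Poly_Mapping.keys f. Poly_Mapping.lookup f p * cmean a (\<lambda>Z. (mn (- p) c Z + mn (- p) Z c) * z Z))"
    if c: "c \<noteq> 0" and z: "continuous_on (sphere 0 1) z" for c z
  proof (rule cmean_linear)
    show "continuous_on (sphere 0 1) (\<lambda>Z. (mn (- p) c Z + mn (- p) Z c) * z Z)" for p
      by (intro continuous_intros c z Z)
  qed (simp add: leval_mn sum_distrib_right distrib_right distrib_left sum.distrib mult.assoc)
  have d2: "cmean a (\<lambda>Z. leval f (u Z) Z * z Z) =
      (\<Sum>p\<in>Poly_Mapping.keys f. Poly_Mapping.lookup f p * cmean a (\<lambda>Z. mn (- p) (u Z) Z * z Z))"
    if u: "continuous_on (sphere 0 1) u" "\<And>Z. Z \<in> sphere 0 1 \<Longrightarrow> u Z \<noteq> 0" and z: "continuous_on (sphere 0 1) z" for u z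
  proof (rule cmean_linear)
    show "continuous_on (sphere 0 1) (\<lambda>Z. mn (- p) (u Z) Z * z Z)" for p
      by (intro continuous_intros u z Z)
  qed (simp add: leval_mn sum_distrib_right mult.assoc)
  have d: "cmean a (\<lambda>Z. (leval f (1 / (t * q ^ m)) Z + leval f Z (1 / (t * q ^ m))) * zeta1 q t m Z) =
      (\<Sum>p\<in>Poly_Mapping.keys f. Poly_Mapping.lookup f p * cmean a (\<lambda>Z. (mn (- p) (1 / (t * q ^ m)) Z + mn (- p) Z (1 / (t * q ^ m))) * zeta1 q t m Z))"
    "cmean a (\<lambda>Z. (leval f (t * q ^ Suc m) Z + leval f Z (t * q ^ Suc m)) * zeta2 q t m Z) =
      (\<Sum>p\<in>Poly_Mapping.keys f. Poly_Mapping.lookup f p * cmean a (\<lambda>Z. (mn (- p) (t * q ^ Suc m) Z + mn (- p) Z (t * q ^ Suc m)) * zeta2 q t m Z))"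
    "cmean a (\<lambda>Z. leval f (1 / (t * q ^ m * Z)) Z * zeta2 q t m Z) =
      (\<Sum>p\<in>Poly_Mapping.keys f. Poly_Mapping.lookup f p * cmean a (\<lambda>Z. mn (- p) (1 / (t * q ^ m * Z)) Z * zeta2 q t m Z))"
    "cmean a (\<lambda>Z. leval f (t * q ^ Suc m / Z) Z * zeta1 q t m Z) =
      (\<Sum>p\<in>Poly_Mapping.keys f. Poly_Mapping.lookup f p * cmean a (\<lambda>Z. mn (- p) (t * q ^ Suc m / Z) Z * zeta1 q t m Z))" for m
    by (intro d1 d2 cont; (intro continuous_intros)?; simp add: Z; fastforce)+
  show ?thesis
    unfolding DD_def d distrib_left sum.distrib sum_distrib_left
    by (intro arg_cong2[where f = "(+)"] sum.swap)
qed

lemma res_leval: "res (leval f) = (\<Sum>p\<in>Poly_Mapping.keys f. Poly_Mapping.lookup f p * res (mn (- p)))"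
proof -
  have s: "(\<Sum>k\<in>K. \<Sum>s\<in>S k. w k s * leval f (u k s) (v k s)) =
      (\<Sum>p\<in>Poly_Mapping.keys f. Poly_Mapping.lookup f p * (\<Sum>k\<in>K. \<Sum>s\<in>S k. w k s * mn (- p) (u k s) (v k s)))"
    for K :: "nat set" and S :: "nat \<Rightarrow> nat set" and w u v
  proof -
    have "(\<Sum>k\<in>K. \<Sum>s\<in>S k. w k s * leval f (u k s) (v k s)) =
        (\<Sum>k\<in>K. \<Sum>s\<in>S k. \<Sum>p\<in>Poly_Mapping.keys f. Poly_Mapping.lookup f p * (w k s * mn (- p) (u k s) (v k s)))"
      unfolding leval_mn sum_distrib_left by (simp only: mult.left_commute)
    also have "\<dots> = (\<Sum>k\<in>K. \<Sum>p\<in>Poly_Mapping.keys f. \<Sum>s\<in>S k. Poly_Mapping.lookup f p * (w k s * mn (- p) (u k s) (v k s)))"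
      by (intro sum.cong refl sum.swap)
    also have "\<dots> = (\<Sum>p\<in>Poly_Mapping.keys f. \<Sum>k\<in>K. \<Sum>s\<in>S k. Poly_Mapping.lookup f p * (w k s * mn (- p) (u k s) (v k s)))"
      by (rule sum.swap)
    finally show ?thesis by (simp only: sum_distrib_left)
  qed
  show ?thesis unfolding res_def s distrib_left sum.distrib ..
qed

lemma inverse_powi: "(1 / x) powi n = x powi (- n)" for x :: complex
  by (simp only: divide_inverse mult_1_left power_int_inverse power_int_minus)

lemma cmean_zeta_cmult:
  "cmean a (\<lambda>Z. c * (Z powi n * zeta1 q t m Z)) = c * cmean a (\<lambda>Z. Z powi n * zeta1 q t m Z)"
  "cmean a (\<lambda>Z. c * (Z powi n * zeta2 q t m Z)) = c * cmean a (\<lambda>Z. Z powi n * zeta2 q t m Z)"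
  "cmean a (\<lambda>Z. c * (Z powi n * zeta1 q t m Z) + d * (Z powi n' * zeta1 q t m Z)) =
    c * cmean a (\<lambda>Z. Z powi n * zeta1 q t m Z) + d * cmean a (\<lambda>Z. Z powi n' * zeta1 q t m Z)"
  "cmean a (\<lambda>Z. c * (Z powi n * zeta2 q t m Z) + d * (Z powi n' * zeta2 q t m Z)) =
    c * cmean a (\<lambda>Z. Z powi n * zeta2 q t m Z) + d * cmean a (\<lambda>Z. Z powi n' * zeta2 q t m Z)"
proof -
  have sub: "sphere 0 1 \<subseteq> {Z. r0 < norm Z \<and> norm Z \<le> 1}" using r0_less_1 by auto
  have c: "continuous_on (sphere 0 1) (\<lambda>Z. Z powi n * zeta1 q t m Z)"
    "continuous_on (sphere 0 1) (\<lambda>Z. Z powi n * zeta2 q t m Z)" for n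
    by (intro continuous_on_mult zeta_continuous[OF sub] continuous_intros; auto)+
  have c': "continuous_on (sphere 0 1) (\<lambda>Z. c * (Z powi n * zeta1 q t m Z))"
    "continuous_on (sphere 0 1) (\<lambda>Z. c * (Z powi n * zeta2 q t m Z))" for c n
    by (intro continuous_on_mult continuous_on_const c)+
  show "cmean a (\<lambda>Z. c * (Z powi n * zeta1 q t m Z)) = c * cmean a (\<lambda>Z. Z powi n * zeta1 q t m Z)"
    "cmean a (\<lambda>Z. c * (Z powi n * zeta2 q t m Z)) = c * cmean a (\<lambda>Z. Z powi n * zeta2 q t m Z)"
    for c n by (intro cmean_cmult c)+
  note v = this
  show "cmean a (\<lambda>Z. c * (Z powi n * zeta1 q t m Z) + d * (Z powi n' * zeta1 q t m Z)) =
    c * cmean a (\<lambda>Z. Z powi n * zeta1 q t m Z) + d * cmean a (\<lambda>Z. Z powi n' * zeta1 q t m Z)"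
    "cmean a (\<lambda>Z. c * (Z powi n * zeta2 q t m Z) + d * (Z powi n' * zeta2 q t m Z)) =
    c * cmean a (\<lambda>Z. Z powi n * zeta2 q t m Z) + d * cmean a (\<lambda>Z. Z powi n' * zeta2 q t m Z)"
    unfolding v[symmetric] by (intro cmean_add c')+
qed

lemma DD_mn: "DD (mn (i, j)) =
    (\<Sum>k\<le>l. (t * q ^ k) powi i * I1 k j) + (\<Sum>k\<le>l. (t * q ^ k) powi j * I1 k i) +
    (\<Sum>k\<le>l. (t * q ^ k) powi i * I2 k (j - i)) +
    (\<Sum>k<l. (1 / (t * q ^ Suc k)) powi i * I1 k (j - i)) +
    ((\<Sum>k<l. (1 / (t * q ^ Suc k)) powi i * I2 k j) + (\<Sum>k<l. (1 / (t * q ^ Suc k)) powi j * I2 k i))"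
proof -
  have a: "cmean a (\<lambda>Z. (mn (i, j) (1 / x) Z + mn (i, j) Z (1 / x)) * zeta1 q t m Z) =
      x powi i * I1 m j + x powi j * I1 m i" for x m
    unfolding I1_def cmean_zeta_cmult(3)[symmetric] mn_def
    by (rule cmean_cong) (simp only: inverse_powi minus_minus fst_conv snd_conv distrib_right distrib_left mult_ac)
  have b: "cmean a (\<lambda>Z. (mn (i, j) x Z + mn (i, j) Z x) * zeta2 q t m Z) =
      (1 / x) powi i * I2 m j + (1 / x) powi j * I2 m i" for x m
    unfolding I2_def cmean_zeta_cmult(4)[symmetric] mn_def
    by (rule cmean_cong) (simp only: inverse_powi minus_minus fst_conv snd_conv distrib_right distrib_left mult_ac)
  have z: "Z powi (- (j - i)) = Z powi i * Z powi (- j)" if "norm Z = 1" for Z :: complex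
  proof -
    have "Z \<noteq> 0" using that by auto
    then show ?thesis by (simp flip: power_int_add)
  qed
  have c: "cmean a (\<lambda>Z. mn (i, j) (1 / (x * Z)) Z * zeta2 q t m Z) = x powi i * I2 m (j - i)" for x m
    unfolding I2_def cmean_zeta_cmult(2)[symmetric] mn_def
    by (rule cmean_cong) (simp only: z inverse_powi minus_minus fst_conv snd_conv power_int_mult_distrib mult_ac)
  have d: "cmean a (\<lambda>Z. mn (i, j) (x / Z) Z * zeta1 q t m Z) = (1 / x) powi i * I1 m (j - i)" for x m
    unfolding I1_def cmean_zeta_cmult(1)[symmetric] mn_def
  proof (rule cmean_cong)
    fix Z :: complex assume Z: "norm Z = 1"
    have "(x / Z) powi (- i) = x powi (- i) * Z powi i"
      by (simp only: divide_inverse power_int_mult_distrib power_int_inverse power_int_minus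
          inverse_mult_distrib inverse_inverse_eq)
    then show "(x / Z) powi - fst (i, j) * Z powi - snd (i, j) * zeta1 q t m Z =
        (1 / x) powi i * (Z powi - (j - i) * zeta1 q t m Z)"
      unfolding z[OF Z] inverse_powi by (simp only: fst_conv snd_conv mult_ac)
  qed
  show ?thesis unfolding DD_def a b c d sum.distrib by (simp only: add.assoc)
qed

lemma powi_balance: "x \<noteq> 0 \<Longrightarrow> y \<noteq> 0 \<Longrightarrow> x powi i * (x * y) powi (j - i) = y powi (- i) * (x * y) powi j" for x y :: complex
  by (simp add: power_int_mult_distrib power_int_diff power_int_minus field_simps)

text \<open>By \<open>w1\<close> and \<open>w2\<close> the residues produced by the third factor are
  those produced by the first with k and s exchanged. Together they cover two triangles, overlapping
  in the two rectangles of the e d e term; \<open>alg\<close> carries out this cancellation.\<close>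

lemma regsum_cprod: "regsum (cprod i j t) (DInt i j + DD (mn (i, j)) + res (mn (i, j)))"
proof -
  define \<psi> where "\<psi> = (\<lambda>i j k s. (t * q ^ k) powi i * (AA k s * (t\<^sup>2 * q ^ Suc (k + s)) powi (- j)))"
  define \<phi> where "\<phi> = (\<lambda>i j k s. (1 / (t * q ^ Suc k)) powi i * (BB k s * (t\<^sup>2 * q ^ Suc (k + s)) powi j))"
  have xy: "t * q ^ k * (t * q ^ Suc s) = t\<^sup>2 * q ^ Suc (k + s)" for k s
    by (simp add: power_add power2_eq_square mult_ac)
  have w1: "(t * q ^ k) powi i * (BB k s * (t\<^sup>2 * q ^ Suc (k + s)) powi (j - i)) = \<phi> i j s k" for k s
  proof -
    have "(t * q ^ k) powi i * (t\<^sup>2 * q ^ Suc (k + s)) powi (j - i) =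
        (t * q ^ Suc s) powi (- i) * (t\<^sup>2 * q ^ Suc (k + s)) powi j"
      unfolding xy[symmetric] by (rule powi_balance) auto
    then show ?thesis
      unfolding \<phi>_def inverse_powi BB_commute[of s k] add.commute[of s k] by (simp only: mult.left_commute)
  qed
  have w2: "(1 / (t * q ^ Suc k)) powi i * (AA k s * (t\<^sup>2 * q ^ Suc (k + s)) powi (- (j - i))) = \<psi> i j s k" for k s
  proof -
    have e: "- (j - i) = - j - (- i)" by simp
    have "(t * q ^ Suc k) powi (- i) * (t * q ^ Suc k * (t * q ^ s)) powi (- j - (- i)) =
        (t * q ^ s) powi (- (- i)) * (t * q ^ Suc k * (t * q ^ s)) powi (- j)"
      by (rule powi_balance) auto
    then have "(t * q ^ Suc k) powi (- i) * (t\<^sup>2 * q ^ Suc (s + k)) powi (- (j - i)) =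
        (t * q ^ s) powi i * (t\<^sup>2 * q ^ Suc (s + k)) powi (- j)"
      unfolding e mult.commute[of "t * q ^ Suc k"] xy minus_minus by (simp only: mult.commute)
    then show ?thesis
      unfolding \<psi>_def inverse_powi AA_commute[of k s] add.commute[of k s] by (simp only: mult.left_commute)
  qed
  have E: "(\<Sum>x\<in>EE. al x powi i * case_sum W1 W2 x j) =
      (\<Sum>k\<le>l. (t * q ^ k) powi i * I1 k j) + (\<Sum>k\<le>l. \<Sum>s<2*l-k. \<psi> i j k s) +
      ((\<Sum>k<l. (1 / (t * q ^ Suc k)) powi i * I2 k j) + (\<Sum>k<l. \<Sum>s<2*l-k. \<phi> i j k s))" for i j
    unfolding sum_EE al_def W1_def W2_def sum.case distrib_left sum.distrib sum_distrib_left \<psi>_def \<phi>_def ..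
  have E3: "(\<Sum>x\<in>EE. al x powi i * case_sum W2 W1 x (j - i)) =
      (\<Sum>k\<le>l. (t * q ^ k) powi i * I2 k (j - i)) + (\<Sum>k\<le>l. \<Sum>s<2*l-k. \<phi> i j s k) +
      ((\<Sum>k<l. (1 / (t * q ^ Suc k)) powi i * I1 k (j - i)) + (\<Sum>k<l. \<Sum>s<2*l-k. \<psi> i j s k))"
    unfolding sum_EE al_def W1_def W2_def sum.case distrib_left sum.distrib sum_distrib_left w1 w2 ..
  have c1: "(\<Sum>k\<le>l. \<Sum>s<2*l-k. \<psi> i j k s) + (\<Sum>k<l. \<Sum>s<2*l-k. \<psi> i j s k) =
    (\<Sum>k<2*l. \<Sum>s<2*l-k. \<psi> i j k s) + (\<Sum>k\<le>l. \<Sum>s<l. \<psi> i j k s)"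
    by (rule sum_triangle_cover)
  have c2: "(\<Sum>k\<le>l. \<Sum>s<2*l-k. \<phi> i j s k) + (\<Sum>k<l. \<Sum>s<2*l-k. \<phi> i j k s) =
    (\<Sum>k<2*l. \<Sum>s<2*l-k. \<phi> i j k s) + (\<Sum>k<l. \<Sum>s\<le>l. \<phi> i j k s)"
    using sum_triangle_cover[of "\<lambda>k s. \<phi> i j s k" l]
    unfolding sum_triangle_swap[of "\<lambda>k s. \<phi> i j s k" "2 * l"] sum.swap[of "\<lambda>k s. \<phi> i j s k" "{..<l}" "{..l}"] .
  have R: "res (mn (i, j)) =
    (\<Sum>k<l. \<Sum>s<l. (1 / (t * q ^ Suc k)) powi i * ((1 / (t * q ^ Suc s)) powi j * BB k s)) +
    (\<Sum>k<2*l. \<Sum>s<2*l-k. \<phi> i j k s) + (\<Sum>k<2*l. \<Sum>s<2*l-k. \<psi> i j k s) +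
    (\<Sum>k\<le>l. \<Sum>s<2*l-k. \<psi> j i k s) +
    (\<Sum>k\<le>l. \<Sum>s\<le>l. (t * q ^ k) powi i * ((t * q ^ s) powi j * AA k s)) +
    (\<Sum>k<l. \<Sum>s<2*l-k. \<phi> j i k s)"
    unfolding res_def mn_def \<psi>_def \<phi>_def inverse_powi fst_conv snd_conv minus_minus
    by (intro arg_cong2[where f = "(+)"] sum.cong refl) (simp_all only: mult_ac)
  have alg: "N + (a1 + r1 + (a2 + r2)) + (a1' + r1' + (a2' + r2')) + (b1 + r3 + (b2 + r4)) - (p1 + p2) + (v1 + v2) + 0 =
      N + (a1 + a1' + b1 + b2 + (a2 + a2')) + (v2 + T2 + T1 + r1' + v1 + r2')"
    if "r1 + r4 = T1 + p1" "r3 + r2 = T2 + p2"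
    for N a1 r1 a2 r2 a1' r1' a2' r2' b1 r3 b2 r4 p1 p2 v1 v2 T1 T2 :: complex
  proof -
    have r: "r4 = T1 + p1 - r1" "r3 = T2 + p2 - r2" using that by (simp_all add: algebra_simps)
    show ?thesis unfolding r by (simp add: algebra_simps)
  qed
  show ?thesis
    using regsum_cprod_aux[of i j] unfolding E E3 \<psi>_def[symmetric, THEN fun_cong, THEN fun_cong, THEN fun_cong, THEN fun_cong]
    unfolding DD_mn R alg[OF c1 c2, symmetric] unfolding \<psi>_def \<phi>_def .
qed

lemma Int0_eq:
  assumes "t = q powr k"
  shows "Int0 a k f = (\<Sum>p\<in>Poly_Mapping.keys f. Poly_Mapping.lookup f p * DInt (- fst p) (- snd p))"
proof -
  define c where "c = 2 * complex_of_real pi * \<i> * complex_of_real a"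
  have c: "c \<noteq> 0" using a_pos by (simp add: c_def)
  define G where "G = (\<lambda>p Y. cmean a (\<lambda>X. X powi (- (- fst p)) * Y powi (- (- snd p)) * mu q t X Y))"
  define h where "h = (\<lambda>Y. \<Sum>p\<in>Poly_Mapping.keys f. Poly_Mapping.lookup f p * G p Y)"
  have cG: "continuous_on (sphere 0 1) (G p)" for p
    unfolding G_def by (rule cmean_cmean_mu(2)[OF dn_has_sum])
  have ch: "continuous_on (sphere 0 1) h" unfolding h_def by (intro continuous_intros cG)
  have h: "cmean a (\<lambda>X. leval f X Y * mu q t X Y) = h Y" if "norm Y = 1" for Y
    unfolding h_def G_def
  proof (rule cmean_linear)
    show "continuous_on (sphere 0 1) (\<lambda>X. X powi (- (- fst p)) * Y powi (- (- snd p)) * mu q t X Y)" for p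
      by (rule cmean_cmean_mu(3)[OF dn_has_sum that])
  qed (simp add: leval_mn mn_def sum_distrib_right mult.assoc)
  have "contour_integral (Ppath a) (\<lambda>y. contour_integral (Ppath a) (\<lambda>x.
       leval f (q powr x) (q powr y) * mu q t (q powr x) (q powr y))) =
      contour_integral (Ppath a) (\<lambda>y. c * h (q powr y))"
  proof (rule contour_integral_Ppath_cong)
    fix y assume "norm (q powr y) = 1"
    then show "contour_integral (Ppath a) (\<lambda>x.
       leval f (q powr x) (q powr y) * mu q t (q powr x) (q powr y)) = c * h (q powr y)"
      using contour_integral_cmean[of "\<lambda>X. leval f X (q powr y) * mu q t X (q powr y)"] h
      by (simp add: c_def)
  qed
  also have "\<dots> = c * cmean a (\<lambda>Y. c * h Y)"
    using contour_integral_cmean[of "\<lambda>Y. c * h Y"] by (simp add: c_def)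
  also have "\<dots> = c\<^sup>2 * cmean a h"
    by (simp add: cmean_cmult[OF ch] power2_eq_square)
  finally have "Int0 a k f = cmean a h"
    using c unfolding Int0_def assms[symmetric] c_def[symmetric] by simp
  also have "\<dots> = (\<Sum>p\<in>Poly_Mapping.keys f. Poly_Mapping.lookup f p * cmean a (G p))"
    by (rule cmean_linear[OF cG]) (simp add: h_def)
  finally show ?thesis unfolding DInt_def G_def .
qed

lemma ct_strip:
  assumes k: "t = q powr k"
  shows "ct a f k = Int0 a k f + DD (leval f) + res (leval f)"
proof -
  have "ct a f k = (\<Sum>(i, j)\<in>Poly_Mapping.keys f. Poly_Mapping.lookup f (i, j) *
      (DInt (- i) (- j) + DD (mn (- i, - j)) + res (mn (- i, - j))))"
    by (rule ct_eqI) (use regsum_cprod t_cube t2 k in simp_all)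
  also have "\<dots> = Int0 a k f + DD (leval f) + res (leval f)"
    unfolding Int0_eq[OF k] DD_leval res_leval
    by (simp add: case_prod_beta uminus_prod_def distrib_left sum.distrib)
  finally show ?thesis .
qed

end

section \<open>From moduli of t to the strip in k, and the exceptional points\<close>

context qcircle
begin

lemma strip_powr:
  assumes "- real l - 1 / 2 < Re k" "Re k < - real l" "\<And>j. (qpar a powr k) ^ 3 * qpar a ^ (j + 1) \<noteq> 1"
  shows "strip a (qpar a powr k) l"
proof unfold_locales
  have t: "norm (qpar a powr k) = exp (- Re k / a)"
    unfolding qpar_powr norm_exp_eq_Re by (simp add: Re_divide_of_real)
  have q: "norm (qpar a) = exp (- 1 / a)" by (simp add: qpar_def)
  have "norm (qpar a powr k * qpar a ^ l) = exp (- Re k / a + real l * (- 1 / a))"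
    unfolding norm_mult norm_power t q by (simp only: exp_add exp_of_nat_mult)
  also have "- Re k / a + real l * (- 1 / a) = (- Re k - real l) / a" by (simp add: diff_divide_distrib)
  finally show "1 < norm (qpar a powr k * qpar a ^ l)" using assms a_pos by simp
  have "norm ((qpar a powr k)\<^sup>2 * qpar a ^ Suc (2 * l)) = exp (real 2 * (- Re k / a) + real (Suc (2 * l)) * (- 1 / a))"
    unfolding norm_mult norm_power t q by (simp only: exp_add exp_of_nat_mult)
  also have "real 2 * (- Re k / a) + real (Suc (2 * l)) * (- 1 / a) = (- 2 * Re k - 2 * real l - 1) / a"
    by (simp add: diff_divide_distrib add_divide_distrib)
  finally show "norm ((qpar a powr k)\<^sup>2 * qpar a ^ Suc (2 * l)) < 1"
    using assms a_pos by (simp add: divide_less_0_iff)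
  show "(qpar a powr k) ^ 3 * qpar a ^ Suc j \<noteq> 1" for j using assms(3)[of j] by simp
qed

text \<open>The exceptional points are the zeros of ph (t^3 q). This entire function of k is not
  identically 0, as it equals \<open>ph q\<close> at k = 0, so near each point of the strip the two
  functions agree with at most that point excepted. \<open>ct\<close> is nicely meromorphic and
  hence unchanged by \<open>remove_sings\<close>.\<close>

lemma ct_eq_remove_sings:
  assumes "\<And>k. k \<in> {k. - real l - 1 / 2 < Re k \<and> Re k < - real l} \<Longrightarrow>
      \<forall>j. (qpar a powr k) ^ 3 * qpar a ^ (j + 1) \<noteq> 1 \<Longrightarrow> ct a f k = R k"
  shows "(\<forall>k\<in>{k. - real l - 1 / 2 < Re k \<and> Re k < - real l}.
      (\<forall>j. (qpar a powr k) ^ 3 * qpar a ^ (j + 1) \<noteq> 1) \<longrightarrow> ct a f k = R k) \<and>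
    (\<forall>k\<in>{k. - real l - 1 / 2 < Re k \<and> Re k < - real l}. ct a f k = remove_sings R k)"
proof (intro conjI ballI impI)
  let ?S = "{k. - real l - 1 / 2 < Re k \<and> Re k < - real l}"
  show "ct a f k = R k" if "k \<in> ?S" "\<forall>j. (qpar a powr k) ^ 3 * qpar a ^ (j + 1) \<noteq> 1" for k
    using that by (rule assms)
  fix k assume k: "k \<in> ?S"
  have "open ?S"
    by (intro open_Collect_conj open_Collect_less continuous_intros)
  then have ev1: "\<forall>\<^sub>F w in at k. w \<in> ?S" using k by (rule eventually_at_in_open')
  define g where "g = (\<lambda>w. ph (exp (- w / of_real a) ^ 3 * qpar a))"
  have hol: "g holomorphic_on UNIV"
    unfolding g_def by (intro holomorphic_intros) (use a_pos in auto)
  have "g 0 \<noteq> 0" by (simp add: g_def)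
  then have ev2: "\<forall>\<^sub>F w in at k. g w \<noteq> 0 \<and> w \<in> UNIV"
    by (intro non_zero_neighbour_alt[OF hol]) auto
  have "\<forall>\<^sub>F w in at k. R w = ct a f w"
    using ev1 ev2
  proof eventually_elim
    case (elim w)
    have "(qpar a powr w) ^ 3 * qpar a ^ (j + 1) \<noteq> 1" for j
      using elim(2) by (auto simp: g_def ph_eq_0_iff qpar_powr mult.assoc)
    then show ?case using assms[OF elim(1)] by simp
  qed
  then have "remove_sings R k = remove_sings (ct a f) k" by (rule remove_sings_cong) simp
  also have "\<dots> = ct a f k"
    using nicely_meromorphic_remove_sings[OF ct_nicely_meromorphic[of f]] by simp
  finally show "ct a f k = remove_sings R k" by simp
qed

end


theorem theorem11p3:
  fixes a :: real and l :: nat and f :: laurent2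
  assumes "a > 0"
  shows
    "let q = qpar a;
         F = leval f;
         S = {k. - real l - 1 / 2 < Re k \<and> Re k < - real l};
         RHS = (\<lambda>k. let t = q powr k in
           Int0 a k f
           + 1 / (2 * of_real pi * \<i> * of_real a) *
             ((\<Sum>m=0..l. contour_integral (Ppath a) (\<lambda>y.
                 (F (t powi (-1) * q powi (- int m)) (q powr y)
                  + F (q powr y) (t powi (-1) * q powi (- int m))) * zeta1 q t m (q powr y)))
              + (\<Sum>m=0..l. contour_integral (Ppath a) (\<lambda>y.
                 F (t powi (-1) * q powr (- y - of_nat m)) (q powr y) * zeta2 q t m (q powr y)))
              + (\<Sum>m=1..l. contour_integral (Ppath a) (\<lambda>y.
                 F (t * q powr (- y + of_nat m)) (q powr y) * zeta1 q t (m - 1) (q powr y)))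
              + (\<Sum>m=1..l. contour_integral (Ppath a) (\<lambda>y.
                 (F (t * q ^ m) (q powr y) + F (q powr y) (t * q ^ m))
                   * zeta2 q t (m - 1) (q powr y))))
           + rho q t *
             ((\<Sum>m=1..l. \<Sum>n=1..l. varpi1 q t m n * F (t * q ^ m) (t * q ^ n))
              + (\<Sum>m=1..2*l. \<Sum>n=m+1..2*l+1.
                   varpi1 q t m (n - m) * F (t * q ^ m) (t powi (-2) * q powi (- int n + 1)))
              + (\<Sum>m=1..2*l. \<Sum>n=m..2*l.
                   varpi2 q t m n * F (t powi (-1) * q powi (int m - int n)) (t\<^sup>2 * q ^ n))
              + (\<Sum>m=0..l. \<Sum>n=m+1..2*l.
                   varpi2 q t (n - m) n * F (t\<^sup>2 * q ^ n) (t powi (-1) * q powi (- int m)))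
              + (\<Sum>m=1..l+1. \<Sum>n=m..m+l.
                   varpi2 q t m n *
                   F (t powi (-1) * q powi (int m - int n)) (t powi (-1) * q powi (- int m + 1)))
              + (\<Sum>m=1..l. \<Sum>n=m+1..2*l+1.
                   varpi1 q t (n - m) m * F (t powi (-2) * q powi (- int n + 1)) (t * q ^ m))))
     in (\<forall>k\<in>S. (\<forall>j. (q powr k) ^ 3 * q ^ (j + 1) \<noteq> 1) \<longrightarrow> ct a f k = RHS k) \<and>
        (\<forall>k\<in>S. ct a f k = remove_sings RHS k)"
proof -
  interpret qcircle a by unfold_locales (rule assms)
  show ?thesis unfolding Let_def
  proof (rule ct_eq_remove_sings, goal_cases)
    case (1 k)
    interpret strip a "qpar a powr k" l by (rule strip_powr) (use 1 in auto)
    show ?case unfolding res_eq[of "leval f"] DD_eq[of "leval f"] by (rule ct_strip) simp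
  qed
qed

end
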